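(* Let $c\geq 1$ be a real number. Then the following statements are equivalent. (i) For any CI problem $\mathcal{P}$, if $\mathcal{P}$ has a solution, then the $\lfloor c\rfloor^{\mathrm{odd}}$-weakening of $\mathcal{P}$ has a simple solution. (ii) For any benign set $\mathcal{I}$ of intervals of $\mathbb{R}^d$, any $\epsilon\ge0$, and any $\epsilon$-interleaved modules $M$ and $N$ over $\mathbb{R}^d$ such that $B(M)$ and $B(N)$ are finite and only contain (interval modules of) intervals in $\mathcal{I}$, there is a $c\epsilon$-matching between $M$ and $N$.
   Context: Fix a field $k$ and an integer $d\ge2$. Modules. $\mathbb{R}^d$ has the product partial order. A module is a functor $M\colon\mathbb{R}^d\to\mathbf{Vec}_k$, with spaces $M_p$ and maps $M_{p\to q}$ for $p\le q$; morphisms are natural transformations. It is pfd if all $M_p$ are finite-dimensional. Write $\vec\epsilon=(\epsilon,\dots,\epsilon)$. $M(\epsilon)_p=M_{p+\vec\epsilon}$ with the corresponding maps; $f(\epsilon)_p=f_{p+\vec\epsilon}$; $M_{0\to\epsilon}\colon M\to M(\epsilon)$ has components $M_{p\to p+\vec\epsilon}$. $M,N$ are $\epsilon$-interleaved if there are morphisms $\phi\colon M\to N(\epsilon)$, $\psi\colon N\to M(\epsilon)$ with $\psi(\epsilon)\circ\phi=M_{0\to2\epsilon}$, $\phi(\epsilon)\circ\psi=N_{0\to2\epsilon}$. Every pfd module is an essentially unique direct sum of nonzero indecomposables; $B(M)$ is the multiset of isomorphism classes of these summands. An $\epsilon$-matching between pfd $M$ and $N$ is a bijection $\sigma\colon\bar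 B(M)\to\bar B(N)$ with $\bar B(M)\subseteq B(M)$, $\bar B(N)\subseteq B(N)$ such that $Q$ and $\sigma(Q)$ are $\epsilon$-interleaved for each $Q\in\bar B(M)$, and every element of $B(M)\setminus\bar B(M)$ and of $B(N)\setminus\bar B(N)$ is $\epsilon$-interleaved with the zero module. Intervals. An interval is a subset $I\subseteq\mathbb{R}^d$ such that $p\le q\le r$ and $p,r\in I$ imply $q\in I$, and any $p,q\in I$ are joined by a sequence $p=p_1\ge p_2\le p_3\ge\dots\le p_\ell=q$ in $I$. The interval module $I$ has $I_p=k$ for $p\in I$, $I_p=0$ otherwise, and $I_{p\to q}=\mathrm{id}_k$ for $p\le q$ in $I$. The shift of an interval is $I(\epsilon)=\{p\mid p+\vec\epsilon\in I\}$. An upset is a set $U\subseteq\mathbb{R}^d$ with $p\le q$, $p\in U$ implying $q\in U$. For an interval $I$ let $U(I)$ be the smallest upset containing $I$ and $E(I)=U(I)\setminus I$. Write $I\le J$ if $U(I)\subseteq U(J)$ and $E(I)\subseteq E(J)$. A set $\mathcal{I}$ of intervals of $\mathbb{R}^d$ closed under shift by any $\epsilon\in\mathbb{R}$ is benign if for all $I,J\in\mathcal{I}$ such that there is a nonzero morphism from (the interval module) $I$ to $J$, the set $I\cap J$ is an interval and $I\le J$. CI problems. A CI problem of size $n$ is a pair $(P,Q)$ of $n\times n$-matrices with entries in $\{0,*\}$. A solution is a pair $(A,B)$ of $n\times n$-matrices over $k$ such that $AB$ is the identity, $A$ is zero wherever $P$ is $0$, and $B$ is zero wherever $Q$ is $0$.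 It is simple if each row of $A$ has exactly one $1$ and all other entries of $A$ are zero. To $(P,Q)$ associate the directed bipartite graph on vertices $u_1,\dots,u_n,v_1,\dots,v_n$ with an edge $u_i\to v_j$ iff $P_{j,i}=*$ and an edge $v_j\to u_i$ iff $Q_{i,j}=*$; the graph determines $(P,Q)$. For odd $c'\ge1$, the $c'$-weakening of $(P,Q)$ is the CI problem whose graph has an edge $u_i\to v_j$ (resp. $v_j\to u_i$) iff the graph of $(P,Q)$ has a directed path from $u_i$ to $v_j$ (resp. $v_j$ to $u_i$) of length at most $c'$. $\lfloor c\rfloor^{\mathrm{odd}}$ is the largest odd integer less than or equal to $c$. *)

theory Defs
  imports "Jordan_Normal_Form.Matrix" "HOL-Analysis.Analysis"
begin

text \<open>The diagonal vector \<open>(\<epsilon>,\<dots>,\<epsilon>)\<close>. The index type \<open>'d\<close> plays the role of the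
  dimension, and \<open>real^'d\<close> carries the product order (\<open>less_eq_vec_def\<close>).\<close>

definition diag :: "real \<Rightarrow> real^'d::finite" where
  "diag \<epsilon> = (\<chi> i. \<epsilon>)"


section \<open>Persistence modules\<close>

text \<open>A functor from \<open>real^'d\<close> to \<open>'k\<close>-vector spaces: the space at \<open>p\<close> is a subspace
  \<open>pspace M p\<close> of the vector space \<open>'v\<close> with scalar multiplication \<open>pscale M\<close>.
  No compatibility between the subspaces at different points is intended, \<open>'v\<close> only
  is a universe in which the spaces live. The value of \<open>pmap M p q\<close> is irrelevant outside of
  \<open>pspace M p\<close> and unless \<open>p \<le> q\<close>.\<close>

record ('k, 'v, 'd) pmod =
  pscale :: "'k \<Rightarrow> 'v \<Rightarrow> 'v"
  pspace :: "real^'d \<Rightarrow> 'v set"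
  pmap :: "real^'d \<Rightarrow> real^'d \<Rightarrow> 'v \<Rightarrow> 'v"

text \<open>Linear maps between subspaces, where \<open>s\<close> and \<open>t\<close> are the scalar multiplications.\<close>

definition linear_btw ::
  "('k \<Rightarrow> 'v::ab_group_add \<Rightarrow> 'v) \<Rightarrow> 'v set \<Rightarrow> ('k \<Rightarrow> 'w::ab_group_add \<Rightarrow> 'w) \<Rightarrow> 'w set
    \<Rightarrow> ('v \<Rightarrow> 'w) \<Rightarrow> bool" where
  "linear_btw s V t W f \<longleftrightarrow>
     f ` V \<subseteq> W \<and>
     (\<forall>x\<in>V. \<forall>y\<in>V. f (x + y) = f x + f y) \<and>
     (\<forall>a. \<forall>x\<in>V. f (s a x) = t a (f x))"

definition pmodule :: "('k::field, 'v::ab_group_add, 'd::finite) pmod \<Rightarrow> bool" where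
  "pmodule M \<longleftrightarrow>
     vector_space (pscale M) \<and>
     (\<forall>p. module.subspace (pscale M) (pspace M p)) \<and>
     (\<forall>p q. p \<le> q \<longrightarrow>
        linear_btw (pscale M) (pspace M p) (pscale M) (pspace M q) (pmap M p q)) \<and>
     (\<forall>p. \<forall>x\<in>pspace M p. pmap M p p x = x) \<and>
     (\<forall>p q r. p \<le> q \<longrightarrow> q \<le> r \<longrightarrow>
        (\<forall>x\<in>pspace M p. pmap M q r (pmap M p q x) = pmap M p r x))"

definition pfd :: "('k::field, 'v::ab_group_add, 'd::finite) pmod \<Rightarrow> bool" where
  "pfd M \<longleftrightarrow> (\<forall>p. \<exists>S. finite S \<and> module.span (pscale M) S = pspace M p)"

definition pmorphism ::
  "('k::field, 'v::ab_group_add, 'd::finite) pmod \<Rightarrow> ('k, 'w::ab_group_add, 'd) pmod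
    \<Rightarrow> (real^'d \<Rightarrow> 'v \<Rightarrow> 'w) \<Rightarrow> bool" where
  "pmorphism M N \<phi> \<longleftrightarrow>
     (\<forall>p. linear_btw (pscale M) (pspace M p) (pscale N) (pspace N p) (\<phi> p)) \<and>
     (\<forall>p q. p \<le> q \<longrightarrow>
        (\<forall>x\<in>pspace M p. \<phi> q (pmap M p q x) = pmap N p q (\<phi> p x)))"

definition piso ::
  "('k::field, 'v::ab_group_add, 'd::finite) pmod \<Rightarrow> ('k, 'w::ab_group_add, 'd) pmod \<Rightarrow> bool"
  where
  "piso M N \<longleftrightarrow>
     (\<exists>\<phi> \<psi>. pmorphism M N \<phi> \<and> pmorphism N M \<psi> \<and>
        (\<forall>p. \<forall>x\<in>pspace M p. \<psi> p (\<phi> p x) = x) \<and>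
        (\<forall>p. \<forall>y\<in>pspace N p. \<phi> p (\<psi> p y) = y))"

definition pshift :: "real \<Rightarrow> ('k, 'v, 'd::finite) pmod \<Rightarrow> ('k, 'v, 'd) pmod" where
  "pshift \<epsilon> M =
     \<lparr> pscale = pscale M,
       pspace = (\<lambda>p. pspace M (p + diag \<epsilon>)),
       pmap = (\<lambda>p q. pmap M (p + diag \<epsilon>) (q + diag \<epsilon>)) \<rparr>"

definition interleaved ::
  "real \<Rightarrow> ('k::field, 'v::ab_group_add, 'd::finite) pmod
    \<Rightarrow> ('k, 'w::ab_group_add, 'd) pmod \<Rightarrow> bool" where
  "interleaved \<epsilon> M N \<longleftrightarrow>
     (\<exists>\<phi> \<psi>. pmorphism M (pshift \<epsilon> N) \<phi> \<and> pmorphism N (pshift \<epsilon> M) \<psi> \<and>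
        (\<forall>p. \<forall>x\<in>pspace M p. \<psi> (p + diag \<epsilon>) (\<phi> p x) = pmap M p (p + diag (2 * \<epsilon>)) x) \<and>
        (\<forall>p. \<forall>y\<in>pspace N p. \<phi> (p + diag \<epsilon>) (\<psi> p y) = pmap N p (p + diag (2 * \<epsilon>)) y))"

definition zero_pmod :: "('k::field, 'k, 'd::finite) pmod" where
  "zero_pmod = \<lparr> pscale = (*), pspace = (\<lambda>p. {0}), pmap = (\<lambda>p q x. 0) \<rparr>"


section \<open>Decompositions and matchings\<close>

definition nonzero_pmod :: "('k, 'v::zero, 'd::finite) pmod \<Rightarrow> bool" where
  "nonzero_pmod M \<longleftrightarrow> (\<exists>p. pspace M p \<noteq> {0})"

definition submodule ::
  "('k::field, 'v::ab_group_add, 'd::finite) pmod \<Rightarrow> ('k, 'v, 'd) pmod \<Rightarrow> bool" where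
  "submodule Q M \<longleftrightarrow>
     pmodule Q \<and> pscale Q = pscale M \<and> (\<forall>p. pspace Q p \<subseteq> pspace M p) \<and>
     (\<forall>p q. p \<le> q \<longrightarrow> (\<forall>x\<in>pspace Q p. pmap Q p q x = pmap M p q x))"

definition indecomposable :: "('k::field, 'v::ab_group_add, 'd::finite) pmod \<Rightarrow> bool" where
  "indecomposable M \<longleftrightarrow>
     (\<forall>Q R. submodule Q M \<longrightarrow> submodule R M \<longrightarrow>
        (\<forall>p. pspace M p = {y + z | y z. y \<in> pspace Q p \<and> z \<in> pspace R p} \<and>
             pspace Q p \<inter> pspace R p = {0}) \<longrightarrow>
        \<not> nonzero_pmod Q \<or> \<not> nonzero_pmod R)"

text \<open>Internal direct sum of a family of submodules, pointwise: every element is a finite sum of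
  elements of the summands in a unique way.\<close>

definition is_direct_sum ::
  "('k::field, 'v::ab_group_add, 'd::finite) pmod \<Rightarrow> ('k, 'v, 'd) pmod set \<Rightarrow> bool" where
  "is_direct_sum M \<B> \<longleftrightarrow>
     (\<forall>Q\<in>\<B>. submodule Q M) \<and>
     (\<forall>p. \<forall>x\<in>pspace M p. \<exists>!f.
        (\<forall>Q\<in>\<B>. f Q \<in> pspace Q p) \<and> (\<forall>Q. Q \<notin> \<B> \<longrightarrow> f Q = 0) \<and>
        finite {Q. f Q \<noteq> 0} \<and> x = (\<Sum>Q | f Q \<noteq> 0. f Q))"

text \<open>\<open>\<B>\<close> represents the multiset \<open>B(M)\<close>. The multiplicity of an isomorphism class is the number
  of elements of \<open>\<B>\<close> in this class: isomorphic summands are different submodules of \<open>M\<close>, hence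
  different elements of \<open>\<B>\<close>. Conversely, a nonzero submodule cannot occur twice (with different
  irrelevant values of \<open>pmap\<close>), since this contradicts uniqueness in \<open>is_direct_sum\<close>.
  A representing \<open>\<B>\<close> is unique up to a bijection that preserves isomorphism classes.\<close>

definition is_barcode ::
  "('k::field, 'v::ab_group_add, 'd::finite) pmod \<Rightarrow> ('k, 'v, 'd) pmod set \<Rightarrow> bool" where
  "is_barcode M \<B> \<longleftrightarrow>
     is_direct_sum M \<B> \<and> (\<forall>Q\<in>\<B>. nonzero_pmod Q \<and> indecomposable Q)"

definition is_matching ::
  "real \<Rightarrow> ('k::field, 'v::ab_group_add, 'd::finite) pmod set \<Rightarrow> ('k, 'w::ab_group_add, 'd) pmod set
    \<Rightarrow> ('k, 'v, 'd) pmod set \<Rightarrow> ('k, 'w, 'd) pmod set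
    \<Rightarrow> (('k, 'v, 'd) pmod \<Rightarrow> ('k, 'w, 'd) pmod) \<Rightarrow> bool" where
  "is_matching \<epsilon> \<B> \<C> \<B>' \<C>' \<sigma> \<longleftrightarrow>
     \<B>' \<subseteq> \<B> \<and> \<C>' \<subseteq> \<C> \<and> bij_betw \<sigma> \<B>' \<C>' \<and>
     (\<forall>Q\<in>\<B>'. interleaved \<epsilon> Q (\<sigma> Q)) \<and>
     (\<forall>Q \<in> \<B> - \<B>'. interleaved \<epsilon> Q (zero_pmod :: ('k, 'k, 'd) pmod)) \<and>
     (\<forall>Q \<in> \<C> - \<C>'. interleaved \<epsilon> Q (zero_pmod :: ('k, 'k, 'd) pmod))"


section \<open>Intervals\<close>

text \<open>In the zigzag \<open>f 0 \<ge> f 1 \<le> f 2 \<ge> \<dots> \<le> f (2 * m)\<close>. As in the definition followed here,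
  the empty set is not excluded; its interval module is zero.\<close>

definition interval :: "(real^'d::finite) set \<Rightarrow> bool" where
  "interval I \<longleftrightarrow>
     (\<forall>p q r. p \<le> q \<longrightarrow> q \<le> r \<longrightarrow> p \<in> I \<longrightarrow> r \<in> I \<longrightarrow> q \<in> I) \<and>
     (\<forall>p\<in>I. \<forall>q\<in>I. \<exists>f (m::nat). f 0 = p \<and> f (2 * m) = q \<and> (\<forall>i \<le> 2 * m. f i \<in> I) \<and>
        (\<forall>i<m. f (2 * i + 1) \<le> f (2 * i) \<and> f (2 * i + 1) \<le> f (2 * i + 2)))"

definition interval_pmod :: "(real^'d::finite) set \<Rightarrow> ('k::field, 'k, 'd) pmod" where
  "interval_pmod I =
     \<lparr> pscale = (*),
       pspace = (\<lambda>p. if p \<in> I then UNIV else {0}),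
       pmap = (\<lambda>p q x. if p \<in> I \<and> q \<in> I then x else 0) \<rparr>"

definition ishift :: "real \<Rightarrow> (real^'d::finite) set \<Rightarrow> (real^'d) set" where
  "ishift \<epsilon> I = {p. p + diag \<epsilon> \<in> I}"

definition upset :: "(real^'d::finite) set \<Rightarrow> bool" where
  "upset U \<longleftrightarrow> (\<forall>p q. p \<le> q \<longrightarrow> p \<in> U \<longrightarrow> q \<in> U)"

definition upset_gen :: "(real^'d::finite) set \<Rightarrow> (real^'d) set" where
  "upset_gen I = \<Inter> {U. upset U \<and> I \<subseteq> U}"

definition upset_exit :: "(real^'d::finite) set \<Rightarrow> (real^'d) set" where
  "upset_exit I = upset_gen I - I"

definition interval_le :: "(real^'d::finite) set \<Rightarrow> (real^'d) set \<Rightarrow> bool" where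
  "interval_le I J \<longleftrightarrow> upset_gen I \<subseteq> upset_gen J \<and> upset_exit I \<subseteq> upset_exit J"

text \<open>The type argument is the field over which the interval modules are formed.\<close>

definition benign :: "'k::field itself \<Rightarrow> (real^'d::finite) set set \<Rightarrow> bool" where
  "benign _ \<I> \<longleftrightarrow>
     (\<forall>I\<in>\<I>. interval I) \<and>
     (\<forall>I\<in>\<I>. \<forall>\<epsilon>. ishift \<epsilon> I \<in> \<I>) \<and>
     (\<forall>I\<in>\<I>. \<forall>J\<in>\<I>.
        (\<exists>\<phi>. pmorphism (interval_pmod I :: ('k, 'k, 'd) pmod) (interval_pmod J) \<phi> \<and>
             (\<exists>p. \<exists>x\<in>pspace (interval_pmod I) p. \<phi> p x \<noteq> 0)) \<longrightarrow>
        interval (I \<inter> J) \<and> interval_le I J)"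


section \<open>CI problems\<close>

text \<open>In the boolean matrices, \<open>True\<close> stands for the entry \<open>*\<close> and \<open>False\<close> for the entry \<open>0\<close>.\<close>

type_synonym ci = "bool mat \<times> bool mat"

fun ci_problem :: "nat \<Rightarrow> ci \<Rightarrow> bool" where
  "ci_problem n (P, Q) \<longleftrightarrow> P \<in> carrier_mat n n \<and> Q \<in> carrier_mat n n"

fun ci_solution :: "nat \<Rightarrow> ci \<Rightarrow> 'k::field mat \<Rightarrow> 'k mat \<Rightarrow> bool" where
  "ci_solution n (P, Q) A B \<longleftrightarrow>
     A \<in> carrier_mat n n \<and> B \<in> carrier_mat n n \<and> A * B = 1\<^sub>m n \<and>
     (\<forall>i<n. \<forall>j<n. \<not> P $$ (i, j) \<longrightarrow> A $$ (i, j) = 0) \<and>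
     (\<forall>i<n. \<forall>j<n. \<not> Q $$ (i, j) \<longrightarrow> B $$ (i, j) = 0)"

text \<open>Simplicity of a solution \<open>(A, B)\<close> is a condition on \<open>A\<close> only.\<close>

definition ci_simple :: "nat \<Rightarrow> 'k::field mat \<Rightarrow> bool" where
  "ci_simple n A \<longleftrightarrow>
     (\<forall>i<n. (\<exists>!j. j < n \<and> A $$ (i, j) = 1) \<and>
            (\<forall>j<n. A $$ (i, j) \<noteq> 1 \<longrightarrow> A $$ (i, j) = 0))"

datatype ci_vertex = U_vertex nat | V_vertex nat

fun ci_graph :: "nat \<Rightarrow> ci \<Rightarrow> (ci_vertex \<times> ci_vertex) set" where
  "ci_graph n (P, Q) =
     {(U_vertex i, V_vertex j) | i j. i < n \<and> j < n \<and> P $$ (j, i)} \<union>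
     {(V_vertex j, U_vertex i) | i j. i < n \<and> j < n \<and> Q $$ (i, j)}"

definition ci_weakening :: "nat \<Rightarrow> nat \<Rightarrow> ci \<Rightarrow> ci" where
  "ci_weakening n c' \<P> =
     (Matrix.mat n n (\<lambda>(j, i). \<exists>l\<le>c'. (U_vertex i, V_vertex j) \<in> ci_graph n \<P> ^^ l),
      Matrix.mat n n (\<lambda>(i, j). \<exists>l\<le>c'. (V_vertex j, U_vertex i) \<in> ci_graph n \<P> ^^ l))"

text \<open>Only used for \<open>c \<ge> 1\<close>, where the maximum exists and is positive.\<close>

definition floor_odd :: "real \<Rightarrow> nat" where
  "floor_odd c = (GREATEST m. odd m \<and> real m \<le> c)"


section \<open>Universe\<close>

text \<open>The type \<open>'v\<close> has room for vector spaces of arbitrary finite dimension over \<open>'k\<close> (e.g. the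
  type of finitely supported functions from \<open>nat\<close> to \<open>'k\<close>). Then every pfd module is isomorphic to
  one whose spaces are subspaces of \<open>'v\<close>; over a smaller type there would be too few modules.\<close>

definition pfd_universe :: "'k::field itself \<Rightarrow> 'v::ab_group_add itself \<Rightarrow> bool" where
  "pfd_universe _ _ \<longleftrightarrow>
     (\<exists>(s :: 'k \<Rightarrow> 'v \<Rightarrow> 'v) S. vector_space s \<and> infinite S \<and> \<not> module.dependent s S)"

end

theory Submission
  imports Defs "Jordan_Normal_Form.Determinant"
begin

text \<open>
  From (i) to (ii). Let \<open>M\<close> and \<open>N\<close> be \<open>\<epsilon>\<close>-interleaved sums of intervals from a benign set. A
  nonzero morphism between such intervals is a scalar multiple of the indicator of their
  intersection (\<open>benign_morphism_scalar\<close>), so the interleaving amounts to two scalar matrices \<open>A\<close>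
  and \<open>B\<close>, in general not square, whose nonzero entries are comparisons \<open>I \<le> J(\<epsilon>)\<close>. They are
  inverse to each other up to errors. An entry of \<open>B A - 1\<close> or \<open>A B - 1\<close> between \<open>I\<close> and \<open>I'\<close> can
  only be nonzero if \<open>I\<close> and \<open>I'(2\<epsilon>)\<close> are disjoint, in which case \<open>I\<close> is strictly below \<open>I'(2\<epsilon>)\<close>:
  the latter is dead wherever \<open>I\<close> lives (\<open>interleaving_near_inverse\<close>).

  A CI problem needs square matrices that are inverse to each other exactly. The matrix
  \<open>[[A, 1 - A B], [-1, B]]\<close> always has the inverse \<open>[[B, B A - 1], [1, A]]\<close> (\<open>dilation_inverse\<close>).
  Its additional rows and columns are labelled by delayed copies of the intervals, the dummies.
  All edges of the resulting graph still are comparisons \<open>X \<le> Y(\<epsilon>)\<close>, and the edges from dummies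
  back to the original intervals carry the error blocks, so they are strict (\<open>dilation_graph\<close>).
  The \<open>c'\<close>-weakening of this problem, \<open>c' \<le> c\<close>, has a simple solution by (i), that is, a perfect
  matching along walks of length at most \<open>c'\<close> in both directions. A pair of matched intervals is
  therefore \<open>c\<epsilon>\<close>-interleaved. If an interval \<open>I\<close> is matched with a dummy instead, there is a
  closed walk from \<open>I\<close> to itself of length at most \<open>2c\<close> with a strict step, so that \<open>I\<close> and
  \<open>I(2c\<epsilon>)\<close> are disjoint (\<open>closed_walk_avoids\<close>) and \<open>I\<close> may stay unmatched.

  From (ii) to (i). The vertices of the graph of a CI problem are realized by intervals such that,
  for \<open>0 \<le> t \<le> c\<close>, \<open>X \<le> Y(t)\<close> expresses that the distance from the vertex of \<open>X\<close> to the vertex of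
  \<open>Y\<close> is at most \<open>t\<close>. The interval of a vertex is the region above a staircase which has one step
  for each vertex \<open>z\<close>, raised by the distance from \<open>z\<close>. It is cut off only far out in one of the
  coordinates. Such regions are directed, so that intersections are connected, and the set of all
  their shifts is benign (\<open>benign_staircases\<close>). A solution of the CI problem is a \<open>1\<close>-interleaving
  of two direct sums of these intervals, all of which are too long to stay unmatched. A
  \<open>c\<close>-matching is thus a perfect matching between vertices of distance at most \<open>c\<close> in both
  directions (\<open>matching_property_imp_ci_property\<close>).
\<close>

section \<open>The order on intervals\<close>

lemma add_diag_diag [simp]: "p + diag a + diag b = p + diag (a + b)"
  by (simp add: diag_def vec_eq_iff)

lemma diag_0 [simp]: "diag 0 = 0"
  by (simp add: diag_def vec_eq_iff)

lemma add_diag_mono: "p \<le> q \<Longrightarrow> a \<le> b \<Longrightarrow> p + diag a \<le> q + diag b"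
  by (simp add: diag_def less_eq_vec_def add_mono)

lemma le_add_diag: "0 \<le> a \<Longrightarrow> p \<le> p + diag a"
  using add_diag_mono[of p p 0 a] by simp

lemma mem_ishift: "p \<in> ishift t I \<longleftrightarrow> p + diag t \<in> I"
  by (simp add: ishift_def)

lemma ishift_ishift [simp]: "ishift a (ishift b I) = ishift (a + b) I"
  by (simp add: ishift_def)

lemma ishift_0 [simp]: "ishift 0 I = I"
  by (simp add: ishift_def)

lemma mem_upset_gen: "p \<in> upset_gen I \<longleftrightarrow> (\<exists>q\<in>I. q \<le> p)"
proof
  assume "p \<in> upset_gen I"
  moreover have "upset {p. \<exists>q\<in>I. q \<le> p}" "I \<subseteq> {p. \<exists>q\<in>I. q \<le> p}"
    by (auto simp: upset_def intro: order_trans)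
  ultimately show "\<exists>q\<in>I. q \<le> p"
    by (auto simp: upset_gen_def)
qed (auto simp: upset_gen_def upset_def)

lemma subset_upset_gen: "I \<subseteq> upset_gen I"
  by (auto simp: mem_upset_gen)

lemma upset_gen_mono_point: "p \<in> upset_gen I \<Longrightarrow> p \<le> q \<Longrightarrow> q \<in> upset_gen I"
  by (auto simp: mem_upset_gen intro: order_trans)

lemma interval_convex: "interval I \<Longrightarrow> p \<le> q \<Longrightarrow> q \<le> r \<Longrightarrow> p \<in> I \<Longrightarrow> r \<in> I \<Longrightarrow> q \<in> I"
  unfolding interval_def by blast

lemma upset_exit_mono_point:
  assumes "interval I" "p \<in> upset_exit I" "p \<le> q"
  shows "q \<in> upset_exit I"
  using assms interval_convex[OF assms(1), of _ p q]
  by (auto simp: upset_exit_def mem_upset_gen intro: order_trans)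

lemma upset_gen_ishift: "upset_gen (ishift t I) = ishift t (upset_gen I)"
proof -
  have "(\<exists>q. q + diag t \<in> I \<and> q \<le> p) \<longleftrightarrow> (\<exists>q\<in>I. q \<le> p + diag t)" for p :: "real^'a"
  proof
    assume "\<exists>q\<in>I. q \<le> p + diag t"
    then obtain q where "q \<in> I" "q \<le> p + diag t" by blast
    then show "\<exists>q. q + diag t \<in> I \<and> q \<le> p"
      using add_diag_mono[of q "p + diag t" "-t" "-t"] by (intro exI[of _ "q + diag (-t)"]) auto
  qed (use add_diag_mono[of _ p t t] in blast)
  then show ?thesis
    by (simp add: set_eq_iff mem_upset_gen mem_ishift Bex_def)
qed

lemma upset_exit_ishift: "upset_exit (ishift t I) = ishift t (upset_exit I)"
  by (auto simp: upset_exit_def upset_gen_ishift mem_ishift)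

lemma interval_le_trans: "interval_le I J \<Longrightarrow> interval_le J K \<Longrightarrow> interval_le I K"
  by (auto simp: interval_le_def)

lemma interval_le_ishift: "interval_le I J \<Longrightarrow> interval_le (ishift t I) (ishift t J)"
  by (auto simp: interval_le_def upset_gen_ishift upset_exit_ishift mem_ishift)

lemma interval_le_ishift_self:
  assumes "interval I" "0 \<le> t"
  shows "interval_le I (ishift t I)"
  using upset_gen_mono_point[OF _ le_add_diag[OF assms(2)], of _ I]
    upset_exit_mono_point[OF assms(1) _ le_add_diag[OF assms(2)]]
  by (auto simp: interval_le_def upset_gen_ishift upset_exit_ishift mem_ishift)

text \<open>The strict companion of \<^const>\<open>interval_le\<close>: wherever \<open>I\<close> lives, \<open>J\<close> was born before and is dead
  already. It absorbs \<^const>\<open>interval_le\<close> on both sides and is irreflexive on nonempty sets.\<close>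

definition interval_less :: "(real^'d::finite) set \<Rightarrow> (real^'d) set \<Rightarrow> bool" where
  "interval_less I J \<longleftrightarrow> upset_gen I \<subseteq> upset_exit J"

lemma interval_less_imp_le: "interval_less I J \<Longrightarrow> interval_le I J"
  by (auto simp: interval_less_def interval_le_def upset_exit_def)

lemma interval_le_less_trans: "interval_le I J \<Longrightarrow> interval_less J K \<Longrightarrow> interval_less I K"
  by (auto simp: interval_less_def interval_le_def)

lemma interval_less_le_trans: "interval_less I J \<Longrightarrow> interval_le J K \<Longrightarrow> interval_less I K"
  by (auto simp: interval_less_def interval_le_def)

lemma interval_less_ishift: "interval_less I J \<Longrightarrow> interval_less (ishift t I) (ishift t J)"
  by (auto simp: interval_less_def upset_gen_ishift upset_exit_ishift mem_ishift)

lemma interval_less_disjoint: "interval_less I J \<Longrightarrow> I \<inter> J = {}"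
  using subset_upset_gen[of I] by (auto simp: interval_less_def upset_exit_def)

lemma interval_lessI:
  assumes "interval_le I J" "I \<inter> J = {}" "interval J"
  shows "interval_less I J"
  unfolding interval_less_def
proof
  fix p assume "p \<in> upset_gen I"
  then obtain q where "q \<in> I" "q \<le> p" by (auto simp: mem_upset_gen)
  moreover have "q \<in> upset_exit J"
    using assms \<open>q \<in> I\<close> subset_upset_gen[of I] by (auto simp: interval_le_def upset_exit_def)
  ultimately show "p \<in> upset_exit J"
    using upset_exit_mono_point[OF assms(3)] by blast
qed

text \<open>An intermediate interval is alive wherever the two outer ones are, so composing two
  morphisms along \<open>I \<le> J \<le> K\<close> loses nothing.\<close>

lemma interval_le_between:
  assumes "interval_le I J" "interval_le J K" "p \<in> I" "p \<in> K"
  shows "p \<in> J"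
  using assms subset_upset_gen[of I] by (auto simp: interval_le_def upset_exit_def)


section \<open>Morphisms and interleavings\<close>

lemma pshift_sel [simp]:
  "pscale (pshift t M) = pscale M"
  "pspace (pshift t M) p = pspace M (p + diag t)"
  "pmap (pshift t M) p q = pmap M (p + diag t) (q + diag t)"
  by (simp_all add: pshift_def)

lemma interval_pmod_sel [simp]:
  "pscale (interval_pmod I) = (*)"
  "pspace (interval_pmod I) p = (if p \<in> I then UNIV else {0})"
  "pmap (interval_pmod I) p q x = (if p \<in> I \<and> q \<in> I then x else 0)"
  by (simp_all add: interval_pmod_def)

lemma zero_pmod_sel [simp]:
  "pscale zero_pmod = (*)" "pspace zero_pmod p = {0}" "pmap zero_pmod p q x = 0"
  by (simp_all add: zero_pmod_def)

lemma pshift_interval_pmod: "pshift t (interval_pmod I) = interval_pmod (ishift t I)"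
  by (simp add: pshift_def interval_pmod_def ishift_def)

lemma linear_btw_in: "linear_btw s V t W f \<Longrightarrow> x \<in> V \<Longrightarrow> f x \<in> W"
  by (auto simp: linear_btw_def)

lemma linear_btw_add: "linear_btw s V t W f \<Longrightarrow> x \<in> V \<Longrightarrow> y \<in> V \<Longrightarrow> f (x + y) = f x + f y"
  by (auto simp: linear_btw_def)

lemma linear_btw_scale: "linear_btw s V t W f \<Longrightarrow> x \<in> V \<Longrightarrow> f (s a x) = t a (f x)"
  by (auto simp: linear_btw_def)

lemma linear_btw_0: "linear_btw s V t W f \<Longrightarrow> 0 \<in> V \<Longrightarrow> f 0 = 0"
  using linear_btw_add[of s V t W f 0 0] by simp

lemma linear_btw_sum:
  assumes "linear_btw s V t W f" "module.subspace s V" "vector_space s" "\<And>i. i \<in> A \<Longrightarrow> g i \<in> V"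
  shows "f (\<Sum>i\<in>A. g i) = (\<Sum>i\<in>A. f (g i))"
proof -
  interpret vector_space s by fact
  have "0 \<in> V" using assms(2) subspace_0 by blast
  show ?thesis
    using assms(4)
  proof (induction A rule: infinite_finite_induct)
    case (insert i A)
    moreover have "(\<Sum>i\<in>A. g i) \<in> V"
      using insert.prems by (intro subspace_sum[OF assms(2)]) auto
    ultimately show ?case
      using linear_btw_add[OF assms(1)] by simp
  qed (simp_all add: linear_btw_0[OF assms(1) \<open>0 \<in> V\<close>])
qed

lemma linear_btw_compose:
  "linear_btw s V t W f \<Longrightarrow> linear_btw t W u X g \<Longrightarrow> linear_btw s V u X (\<lambda>x. g (f x))"
  by (auto simp: linear_btw_def image_subset_iff)

lemma pmodule_vector_space: "pmodule M \<Longrightarrow> vector_space (pscale M)"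
  by (simp add: pmodule_def)

lemma pmodule_subspace: "pmodule M \<Longrightarrow> module.subspace (pscale M) (pspace M p)"
  by (simp add: pmodule_def)

lemma pmodule_zero:
  assumes "pmodule M"
  shows "0 \<in> pspace M p"
proof -
  interpret vector_space "pscale M" using assms by (rule pmodule_vector_space)
  show ?thesis using subspace_0[OF pmodule_subspace[OF assms]] .
qed

lemma pmodule_linear:
  "pmodule M \<Longrightarrow> p \<le> q \<Longrightarrow>
    linear_btw (pscale M) (pspace M p) (pscale M) (pspace M q) (pmap M p q)"
  by (simp add: pmodule_def)

lemma pmorphism_linear:
  "pmorphism M N f \<Longrightarrow> linear_btw (pscale M) (pspace M p) (pscale N) (pspace N p) (f p)"
  by (simp add: pmorphism_def)

lemma pmorphism_in: "pmorphism M N f \<Longrightarrow> x \<in> pspace M p \<Longrightarrow> f p x \<in> pspace N p"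
  using linear_btw_in pmorphism_linear by blast

lemma pmorphism_natural:
  "pmorphism M N f \<Longrightarrow> p \<le> q \<Longrightarrow> x \<in> pspace M p \<Longrightarrow> f q (pmap M p q x) = pmap N p q (f p x)"
  by (auto simp: pmorphism_def)

lemma pmorphism_compose:
  assumes "pmorphism M N f" "pmorphism N L g"
  shows "pmorphism M L (\<lambda>p x. g p (f p x))"
  using linear_btw_compose[OF assms[THEN pmorphism_linear]]
    pmorphism_natural[OF assms(1)] pmorphism_natural[OF assms(2)] pmorphism_in[OF assms(1)]
  unfolding pmorphism_def by simp

lemma pmorphism_pshift:
  "pmorphism M N f \<Longrightarrow> pmorphism (pshift t M) (pshift t N) (\<lambda>p. f (p + diag t))"
  by (auto simp: pmorphism_def add_diag_mono)

lemma interleaved_piso: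
  assumes "piso M M'" "piso N N'" "interleaved \<epsilon> M' N'" "0 \<le> \<epsilon>"
  shows "interleaved \<epsilon> M N"
proof -
  obtain a a' where a: "pmorphism M M' a" "pmorphism M' M a'"
    "\<And>p x. x \<in> pspace M p \<Longrightarrow> a' p (a p x) = x" "\<And>p x. x \<in> pspace M' p \<Longrightarrow> a p (a' p x) = x"
    using assms(1) unfolding piso_def by blast
  obtain b b' where b: "pmorphism N N' b" "pmorphism N' N b'"
    "\<And>p x. x \<in> pspace N p \<Longrightarrow> b' p (b p x) = x" "\<And>p x. x \<in> pspace N' p \<Longrightarrow> b p (b' p x) = x"
    using assms(2) unfolding piso_def by blast
  obtain f g where f: "pmorphism M' (pshift \<epsilon> N') f" and g: "pmorphism N' (pshift \<epsilon> M') g"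
    and gf: "\<And>p x. x \<in> pspace M' p \<Longrightarrow> g (p + diag \<epsilon>) (f p x) = pmap M' p (p + diag (2 * \<epsilon>)) x"
    and fg: "\<And>p x. x \<in> pspace N' p \<Longrightarrow> f (p + diag \<epsilon>) (g p x) = pmap N' p (p + diag (2 * \<epsilon>)) x"
    using assms(3) unfolding interleaved_def by blast
  have le: "p \<le> p + diag (2 * \<epsilon>)" for p :: "real^'c"
    using assms(4) by (intro le_add_diag) simp
  have F: "pmorphism M (pshift \<epsilon> N) (\<lambda>p x. b' (p + diag \<epsilon>) (f p (a p x)))"
    using pmorphism_compose[OF pmorphism_compose[OF a(1) f] pmorphism_pshift[OF b(2)]] .
  have G: "pmorphism N (pshift \<epsilon> M) (\<lambda>p x. a' (p + diag \<epsilon>) (g p (b p x)))"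
    using pmorphism_compose[OF pmorphism_compose[OF b(1) g] pmorphism_pshift[OF a(2)]] .
  have "a' (p + diag \<epsilon> + diag \<epsilon>) (g (p + diag \<epsilon>) (b (p + diag \<epsilon>) (b' (p + diag \<epsilon>) (f p (a p x)))))
      = pmap M p (p + diag (2 * \<epsilon>)) x" if "x \<in> pspace M p" for p x
  proof -
    have x: "a p x \<in> pspace M' p" using that a(1) pmorphism_in by blast
    have "f p (a p x) \<in> pspace N' (p + diag \<epsilon>)" using pmorphism_in[OF f x] by simp
    then have "a' (p + diag (2 * \<epsilon>)) (g (p + diag \<epsilon>) (b (p + diag \<epsilon>) (b' (p + diag \<epsilon>) (f p (a p x)))))
        = a' (p + diag (2 * \<epsilon>)) (pmap M' p (p + diag (2 * \<epsilon>)) (a p x))"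
      by (simp add: b(4) gf x)
    also have "\<dots> = pmap M p (p + diag (2 * \<epsilon>)) x"
      using pmorphism_natural[OF a(2) le x] a(3)[OF that] by simp
    finally show ?thesis by (simp flip: mult_2)
  qed
  moreover have "b' (p + diag \<epsilon> + diag \<epsilon>) (f (p + diag \<epsilon>) (a (p + diag \<epsilon>) (a' (p + diag \<epsilon>) (g p (b p x)))))
      = pmap N p (p + diag (2 * \<epsilon>)) x" if "x \<in> pspace N p" for p x
  proof -
    have x: "b p x \<in> pspace N' p" using that b(1) pmorphism_in by blast
    have "g p (b p x) \<in> pspace M' (p + diag \<epsilon>)" using pmorphism_in[OF g x] by simp
    then have "b' (p + diag (2 * \<epsilon>)) (f (p + diag \<epsilon>) (a (p + diag \<epsilon>) (a' (p + diag \<epsilon>) (g p (b p x)))))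
        = b' (p + diag (2 * \<epsilon>)) (pmap N' p (p + diag (2 * \<epsilon>)) (b p x))"
      by (simp add: a(4) fg x)
    also have "\<dots> = pmap N p (p + diag (2 * \<epsilon>)) x"
      using pmorphism_natural[OF b(2) le x] b(3)[OF that] by simp
    finally show ?thesis by (simp flip: mult_2)
  qed
  ultimately show ?thesis
    unfolding interleaved_def using F G by blast
qed

lemma piso_refl: "piso M M"
  unfolding piso_def pmorphism_def linear_btw_def by (intro exI[of _ "\<lambda>p x. x"]) auto

lemma piso_sym: "piso M N \<Longrightarrow> piso N M"
  unfolding piso_def by blast

text \<open>A comparison \<open>p \<le> q\<close> with \<open>p\<close> in the smaller and \<open>q\<close> in the larger interval puts both points
  into both intervals. Hence over \<open>I \<le> J\<close> the indicator of \<open>I \<inter> J\<close> is a morphism.\<close>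

lemma interval_le_source:
  assumes "interval_le I J" "p \<le> q" "p \<in> I" "q \<in> J"
  shows "q \<in> I"
proof -
  have "q \<in> upset_gen I" using assms(2,3) by (auto simp: mem_upset_gen)
  then show ?thesis using assms(1,4) by (auto simp: interval_le_def upset_exit_def)
qed

lemma interval_le_target:
  assumes "interval_le I J" "interval J" "p \<le> q" "p \<in> I" "q \<in> J"
  shows "p \<in> J"
  using assms subset_upset_gen[of I] upset_exit_mono_point[OF assms(2), of p q]
  by (auto simp: interval_le_def upset_exit_def)

lemma interval_le_imp_pmorphism:
  assumes "interval_le I J" "interval J"
  shows "pmorphism (interval_pmod I :: ('k::field, 'k, 'd::finite) pmod) (interval_pmod J)
           (\<lambda>p x. if p \<in> I \<and> p \<in> J then x else 0)"
  using interval_le_source[OF assms(1)] interval_le_target[OF assms]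
  by (auto simp: pmorphism_def linear_btw_def)

lemma interval_le_imp_interleaved:
  fixes I J :: "(real^'d::finite) set"
  assumes "interval_le I (ishift \<epsilon> J)" "interval_le J (ishift \<epsilon> I)"
    and "interval (ishift \<epsilon> I)" "interval (ishift \<epsilon> J)"
  shows "interleaved \<epsilon> (interval_pmod I :: ('k::field, 'k, 'd) pmod) (interval_pmod J)"
proof -
  let ?f = "\<lambda>p x. if p \<in> I \<and> p \<in> ishift \<epsilon> J then x else 0 :: 'k"
  let ?g = "\<lambda>p x. if p \<in> J \<and> p \<in> ishift \<epsilon> I then x else 0 :: 'k"
  have between: "p + diag \<epsilon> \<in> L" if "interval_le K (ishift \<epsilon> L)" "interval_le L (ishift \<epsilon> K)"
    "p \<in> K" "p + diag (2 * \<epsilon>) \<in> K" for p and K L :: "(real^'d) set"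
    using interval_le_between[OF that(1), of "ishift (2 * \<epsilon>) K" p]
      interval_le_ishift[OF that(2), of \<epsilon>] that(3,4) by (simp add: mem_ishift)
  show ?thesis
    unfolding interleaved_def
    using interval_le_imp_pmorphism[OF assms(1,4), where 'k = 'k]
      interval_le_imp_pmorphism[OF assms(2,3), where 'k = 'k]
      between[OF assms(1,2)] between[OF assms(2,1)]
    by (intro exI[of _ ?f] exI[of _ ?g])
      (auto simp: pshift_interval_pmod mem_ishift split: if_splits)
qed

text \<open>Only the zero morphisms are available for interleaving with zero, so this happens exactly
  for those intervals that do not survive a diagonal step of length \<open>2\<epsilon>\<close>.\<close>

lemma interleaved_zero_interval:
  fixes I :: "(real^'d::finite) set"
  shows "interleaved \<epsilon> (interval_pmod I :: ('k::field, 'k, 'd) pmod) (zero_pmod :: ('k, 'k, 'd) pmod)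
      \<longleftrightarrow> I \<inter> ishift (2 * \<epsilon>) I = {}"
proof
  assume "interleaved \<epsilon> (interval_pmod I :: ('k, 'k, 'd) pmod) (zero_pmod :: ('k, 'k, 'd) pmod)"
  then obtain f g where f: "pmorphism (interval_pmod I) (pshift \<epsilon> (zero_pmod :: ('k, 'k, 'd) pmod)) f"
    and g: "pmorphism (zero_pmod :: ('k, 'k, 'd) pmod) (pshift \<epsilon> (interval_pmod I)) g"
    and gf: "\<And>p x :: 'k. x \<in> pspace (interval_pmod I) p \<Longrightarrow>
      g (p + diag \<epsilon>) (f p x) = pmap (interval_pmod I) p (p + diag (2 * \<epsilon>)) x"
    unfolding interleaved_def by blast
  show "I \<inter> ishift (2 * \<epsilon>) I = {}"
  proof (rule ccontr)
    assume "I \<inter> ishift (2 * \<epsilon>) I \<noteq> {}"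
    then obtain p where p: "p \<in> I" "p + diag (2 * \<epsilon>) \<in> I" by (auto simp: mem_ishift)
    have "f p 1 = 0" using pmorphism_in[OF f, of 1 p] p by simp
    moreover have "g (p + diag \<epsilon>) 0 = 0"
      using linear_btw_0[OF pmorphism_linear[OF g, of "p + diag \<epsilon>"]] by simp
    ultimately show False using gf[of 1 p] p by simp
  qed
next
  assume "I \<inter> ishift (2 * \<epsilon>) I = {}"
  then show "interleaved \<epsilon> (interval_pmod I :: ('k, 'k, 'd) pmod) (zero_pmod :: ('k, 'k, 'd) pmod)"
    unfolding interleaved_def
    by (intro exI[of _ "\<lambda>p x. 0"]) (auto simp: pmorphism_def linear_btw_def mem_ishift)
qed

text \<open>A nonzero morphism is locally constant on \<open>I \<inter> J\<close>. Benignity makes this set connected.\<close>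

lemma benign_morphism_scalar:
  fixes \<phi> :: "real^'d::finite \<Rightarrow> 'k::field \<Rightarrow> 'k"
  assumes "benign TYPE('k) \<I>" "I \<in> \<I>" "J \<in> \<I>"
    and \<phi>: "pmorphism (interval_pmod I) (interval_pmod J) \<phi>"
  shows "\<exists>a. (\<forall>p\<in>I. \<forall>x. \<phi> p x = (if p \<in> J then a * x else 0)) \<and> (a \<noteq> 0 \<longrightarrow> interval_le I J)"
proof (cases "\<exists>p. \<exists>x\<in>pspace (interval_pmod I) p. \<phi> p x \<noteq> 0")
  case True
  then have int: "interval (I \<inter> J)" and le: "interval_le I J"
    using assms unfolding benign_def by blast+
  have outside: "\<phi> p x = 0" if "p \<in> I" "p \<notin> J" for p x
    using pmorphism_in[OF \<phi>, of x p] that by simp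
  have step: "\<phi> q 1 = \<phi> p 1" if "p \<le> q" "p \<in> I \<inter> J" "q \<in> I \<inter> J" for p q
    using pmorphism_natural[OF \<phi> that(1), of 1] that by simp
  have const: "\<phi> q 1 = \<phi> p 1" if p: "p \<in> I \<inter> J" and q: "q \<in> I \<inter> J" for p q
  proof -
    obtain f and m :: nat where zigzag: "f 0 = p \<and> f (2 * m) = q \<and> (\<forall>i\<le>2 * m. f i \<in> I \<inter> J) \<and>
        (\<forall>i<m. f (2 * i + 1) \<le> f (2 * i) \<and> f (2 * i + 1) \<le> f (2 * i + 2))"
      using int[unfolded interval_def, THEN conjunct2, rule_format, OF p q] by (elim exE) (rule that)
    then have f: "f 0 = p" "f (2 * m) = q" "\<And>i. i \<le> 2 * m \<Longrightarrow> f i \<in> I \<inter> J"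
      "\<And>i. i < m \<Longrightarrow> f (2 * i + 1) \<le> f (2 * i) \<and> f (2 * i + 1) \<le> f (2 * i + 2)"
      by blast+
    have "\<phi> (f (2 * i)) 1 = \<phi> p 1" if "i \<le> m" for i
      using that
    proof (induction i)
      case (Suc i)
      have "\<phi> (f (2 * i + 2)) 1 = \<phi> (f (2 * i + 1)) 1"
        using Suc.prems f(3)[of "2 * i + 1"] f(3)[of "2 * i + 2"] f(4)[of i] by (intro step) auto
      moreover have "\<phi> (f (2 * i)) 1 = \<phi> (f (2 * i + 1)) 1"
        using Suc.prems f(3)[of "2 * i"] f(3)[of "2 * i + 1"] f(4)[of i] by (intro step) auto
      ultimately show ?case using Suc by simp
    qed (simp add: f)
    then show ?thesis using f(2) by blast
  qed
  have scale: "\<phi> p x = \<phi> p 1 * x" if "p \<in> I" for p x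
    using linear_btw_scale[OF pmorphism_linear[OF \<phi>, of p], of 1 x] that by (simp add: mult.commute)
  obtain p x where "x \<in> pspace (interval_pmod I) p" "\<phi> p x \<noteq> 0" using True by blast
  show ?thesis
  proof (cases "I \<inter> J = {}")
    case True
    then show ?thesis using outside by (intro exI[of _ 0]) auto
  next
    case False
    then obtain r where "r \<in> I \<inter> J" by blast
    have "\<phi> p x = (if p \<in> J then \<phi> r 1 * x else 0)" if "p \<in> I" for p x
      using outside[OF that] scale[OF that, of x] const[OF \<open>r \<in> I \<inter> J\<close>, of p] that by auto
    then show ?thesis using le by blast
  qed
next
  case False
  then show ?thesis by (intro exI[of _ 0]) auto
qed


section \<open>Projections onto the summands of a finite decomposition\<close>

lemma submodule_pmodule: "submodule Q M \<Longrightarrow> pmodule Q"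
  by (simp add: submodule_def)

lemma submodule_pscale: "submodule Q M \<Longrightarrow> pscale Q = pscale M"
  by (simp add: submodule_def)

lemma submodule_in: "submodule Q M \<Longrightarrow> x \<in> pspace Q p \<Longrightarrow> x \<in> pspace M p"
  by (auto simp: submodule_def)

lemma submodule_pmap:
  "submodule Q M \<Longrightarrow> p \<le> q \<Longrightarrow> x \<in> pspace Q p \<Longrightarrow> pmap Q p q x = pmap M p q x"
  by (auto simp: submodule_def)

lemma submodule_inclusion: "submodule Q M \<Longrightarrow> pmorphism Q M (\<lambda>p x. x)"
  unfolding pmorphism_def linear_btw_def submodule_def by auto

lemma direct_sum_submodule: "is_direct_sum M \<B> \<Longrightarrow> Q \<in> \<B> \<Longrightarrow> submodule Q M"
  by (simp add: is_direct_sum_def)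

definition is_decomposition ::
  "('k::field, 'v::ab_group_add, 'd::finite) pmod set \<Rightarrow> real^'d \<Rightarrow> 'v
    \<Rightarrow> (('k, 'v, 'd) pmod \<Rightarrow> 'v) \<Rightarrow> bool" where
  "is_decomposition \<B> p x f \<longleftrightarrow>
     (\<forall>Q\<in>\<B>. f Q \<in> pspace Q p) \<and> (\<forall>Q. Q \<notin> \<B> \<longrightarrow> f Q = 0) \<and>
     finite {Q. f Q \<noteq> 0} \<and> x = (\<Sum>Q | f Q \<noteq> 0. f Q)"

lemma is_decomposition_finite:
  assumes "finite \<B>"
  shows "is_decomposition \<B> p x f \<longleftrightarrow>
    (\<forall>Q\<in>\<B>. f Q \<in> pspace Q p) \<and> (\<forall>Q. Q \<notin> \<B> \<longrightarrow> f Q = 0) \<and> x = (\<Sum>Q\<in>\<B>. f Q)"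
proof -
  have "finite {Q. f Q \<noteq> 0} \<and> (\<Sum>Q | f Q \<noteq> 0. f Q) = (\<Sum>Q\<in>\<B>. f Q)" if "\<forall>Q. Q \<notin> \<B> \<longrightarrow> f Q = 0"
  proof
    have "{Q. f Q \<noteq> 0} \<subseteq> \<B>" using that by auto
    then show "finite {Q. f Q \<noteq> 0}" using assms by (rule finite_subset)
    show "(\<Sum>Q | f Q \<noteq> 0. f Q) = (\<Sum>Q\<in>\<B>. f Q)"
      using assms \<open>{Q. f Q \<noteq> 0} \<subseteq> \<B>\<close> by (intro sum.mono_neutral_left) auto
  qed
  then show ?thesis unfolding is_decomposition_def by auto
qed

lemma is_direct_sum_iff:
  "is_direct_sum M \<B> \<longleftrightarrow>
     (\<forall>Q\<in>\<B>. submodule Q M) \<and> (\<forall>p. \<forall>x\<in>pspace M p. \<exists>!f. is_decomposition \<B> p x f)"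
  unfolding is_direct_sum_def is_decomposition_def ..

definition summand_proj ::
  "('k::field, 'v::ab_group_add, 'd::finite) pmod set \<Rightarrow> ('k, 'v, 'd) pmod \<Rightarrow> real^'d \<Rightarrow> 'v \<Rightarrow> 'v" where
  "summand_proj \<B> Q p x = (THE f. is_decomposition \<B> p x f) Q"

lemma summand_proj:
  assumes "is_direct_sum M \<B>" "finite \<B>" "x \<in> pspace M p"
  shows "Q \<in> \<B> \<Longrightarrow> summand_proj \<B> Q p x \<in> pspace Q p"
    and "(\<Sum>Q\<in>\<B>. summand_proj \<B> Q p x) = x"
proof -
  have "\<exists>!f. is_decomposition \<B> p x f"
    using assms(1,3) unfolding is_direct_sum_iff by blast
  from theI'[OF this] show "Q \<in> \<B> \<Longrightarrow> summand_proj \<B> Q p x \<in> pspace Q p"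
    and "(\<Sum>Q\<in>\<B>. summand_proj \<B> Q p x) = x"
    by (auto simp: is_decomposition_finite[OF assms(2)] summand_proj_def)
qed

lemma summand_proj_unique:
  assumes "is_direct_sum M \<B>" "finite \<B>" "x \<in> pspace M p"
    and "\<And>R. R \<in> \<B> \<Longrightarrow> g R \<in> pspace R p" "x = (\<Sum>R\<in>\<B>. g R)" "Q \<in> \<B>"
  shows "summand_proj \<B> Q p x = g Q"
proof -
  define h where "h = (\<lambda>R. if R \<in> \<B> then g R else 0)"
  have "is_decomposition \<B> p x h"
    using assms(4,5) by (auto simp: is_decomposition_finite[OF assms(2)] h_def)
  moreover have "\<exists>!f. is_decomposition \<B> p x f"
    using assms(1,3) unfolding is_direct_sum_iff by blast
  ultimately have "(THE f. is_decomposition \<B> p x f) = h"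
    by (rule the1_equality[rotated])
  then show ?thesis using assms(6) by (simp add: summand_proj_def h_def)
qed

lemma summand_proj_summand:
  assumes "is_direct_sum M \<B>" "finite \<B>" "Q \<in> \<B>" "R \<in> \<B>" "x \<in> pspace Q p"
  shows "summand_proj \<B> R p x = (if Q = R then x else 0)"
proof -
  note sub = direct_sum_submodule[OF assms(1)]
  have "(if Q = R' then x else 0) \<in> pspace R' p" if "R' \<in> \<B>" for R'
    using that assms(5) pmodule_zero[OF submodule_pmodule[OF sub[OF that]]] by auto
  moreover have "x = (\<Sum>R\<in>\<B>. if Q = R then x else 0)" using assms(2,3) by simp
  ultimately show ?thesis
    using summand_proj_unique[OF assms(1,2) submodule_in[OF sub[OF assms(3)] assms(5)],
        of "\<lambda>R. if Q = R then x else 0"] assms(4) by blast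
qed

lemma summand_proj_pmorphism:
  assumes "pmodule M" "is_direct_sum M \<B>" "finite \<B>" "Q \<in> \<B>"
  shows "pmorphism M Q (summand_proj \<B> Q)"
proof -
  note sub = direct_sum_submodule[OF assms(2)]
  note proj = summand_proj[OF assms(2,3)]
  interpret vector_space "pscale M" using assms(1) by (rule pmodule_vector_space)
  have subspace: "subspace (pspace R p)" if "R \<in> \<B>" for R p
    using pmodule_subspace[OF submodule_pmodule[OF sub[OF that]]] submodule_pscale[OF sub[OF that]]
    by simp
  note M_subspace = pmodule_subspace[OF assms(1)]
  have "summand_proj \<B> Q p (x + y) = summand_proj \<B> Q p x + summand_proj \<B> Q p y"
    if "x \<in> pspace M p" "y \<in> pspace M p" for p x y
    using that assms(4) subspace_add[OF M_subspace that]
    by (intro summand_proj_unique[OF assms(2,3),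
          where g = "\<lambda>R. summand_proj \<B> R p x + summand_proj \<B> R p y"])
      (auto simp: sum.distrib proj(2) intro!: subspace_add[OF subspace] proj(1))
  moreover have "summand_proj \<B> Q p (pscale M a x) = pscale M a (summand_proj \<B> Q p x)"
    if "x \<in> pspace M p" for p a x
    using that assms(4) subspace_scale[OF M_subspace that]
    by (intro summand_proj_unique[OF assms(2,3), where g = "\<lambda>R. pscale M a (summand_proj \<B> R p x)"])
      (auto simp: proj(2) simp flip: scale_sum_right intro!: subspace_scale[OF subspace] proj(1))
  moreover have "summand_proj \<B> Q q (pmap M p q x) = pmap Q p q (summand_proj \<B> Q p x)"
    if "p \<le> q" "x \<in> pspace M p" for p q x
  proof (rule summand_proj_unique[OF assms(2,3), where g = "\<lambda>R. pmap R p q (summand_proj \<B> R p x)"])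
    note lin = pmodule_linear[OF assms(1) that(1)]
    show "pmap M p q x \<in> pspace M q" using linear_btw_in[OF lin that(2)] .
    show "pmap R p q (summand_proj \<B> R p x) \<in> pspace R q" if "R \<in> \<B>" for R
      using linear_btw_in[OF pmodule_linear[OF submodule_pmodule[OF sub[OF that]] \<open>p \<le> q\<close>]]
        proj(1)[OF \<open>x \<in> pspace M p\<close> that] .
    have "pmap M p q x = pmap M p q (\<Sum>R\<in>\<B>. summand_proj \<B> R p x)" by (simp add: proj(2) that)
    also have "\<dots> = (\<Sum>R\<in>\<B>. pmap M p q (summand_proj \<B> R p x))"
      using proj(1)[OF that(2)] submodule_in[OF sub]
      by (intro linear_btw_sum[OF lin M_subspace vector_space_axioms]) blast
    also have "\<dots> = (\<Sum>R\<in>\<B>. pmap R p q (summand_proj \<B> R p x))"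
      using proj(1)[OF that(2)] submodule_pmap[OF sub that(1)] by (intro sum.cong) auto
    finally show "pmap M p q x = (\<Sum>R\<in>\<B>. pmap R p q (summand_proj \<B> R p x))" .
  qed (fact assms(4))
  ultimately show ?thesis
    using proj(1)[OF _ assms(4)] submodule_pscale[OF sub[OF assms(4)]]
    by (auto simp: pmorphism_def linear_btw_def)
qed


lemma benign_interval: "benign TYPE('k::field) \<I> \<Longrightarrow> I \<in> \<I> \<Longrightarrow> interval I"
  unfolding benign_def by (elim conjE) (rule bspec)

lemma benign_ishift: "benign TYPE('k::field) \<I> \<Longrightarrow> I \<in> \<I> \<Longrightarrow> ishift t I \<in> \<I>"
  unfolding benign_def by simp


section \<open>The matrices of an interleaving\<close>

definition interval_chart ::
  "(real^'d::finite) set set \<Rightarrow> ('k::field, 'v::ab_group_add, 'd) pmod set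
    \<Rightarrow> (('k, 'v, 'd) pmod \<Rightarrow> (real^'d) set)
    \<Rightarrow> (('k, 'v, 'd) pmod \<Rightarrow> real^'d \<Rightarrow> 'v \<Rightarrow> 'k) \<Rightarrow> (('k, 'v, 'd) pmod \<Rightarrow> real^'d \<Rightarrow> 'k \<Rightarrow> 'v) \<Rightarrow> bool" where
  "interval_chart \<I> \<B> I \<alpha> \<beta> \<longleftrightarrow>
     (\<forall>Q\<in>\<B>. I Q \<in> \<I> \<and> pmorphism Q (interval_pmod (I Q)) (\<alpha> Q) \<and> pmorphism (interval_pmod (I Q)) Q (\<beta> Q) \<and>
        (\<forall>p. \<forall>x\<in>pspace Q p. \<beta> Q p (\<alpha> Q p x) = x) \<and>
        (\<forall>p. \<forall>y\<in>pspace (interval_pmod (I Q)) p. \<alpha> Q p (\<beta> Q p y) = y))"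

text \<open>The component of \<open>\<phi>\<close> from \<open>Q\<close> to the shift of \<open>R\<close>, written in the two charts, is
  multiplication by \<open>a R Q\<close>.\<close>

definition represents ::
  "real \<Rightarrow> ('k::field, 'v::ab_group_add, 'd::finite) pmod set \<Rightarrow> ('k, 'v, 'd) pmod set
    \<Rightarrow> (('k, 'v, 'd) pmod \<Rightarrow> (real^'d) set)
    \<Rightarrow> (('k, 'v, 'd) pmod \<Rightarrow> real^'d \<Rightarrow> 'v \<Rightarrow> 'k) \<Rightarrow> (('k, 'v, 'd) pmod \<Rightarrow> real^'d \<Rightarrow> 'k \<Rightarrow> 'v)
    \<Rightarrow> (real^'d \<Rightarrow> 'v \<Rightarrow> 'v) \<Rightarrow> (('k, 'v, 'd) pmod \<Rightarrow> ('k, 'v, 'd) pmod \<Rightarrow> 'k) \<Rightarrow> bool" where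
  "represents \<epsilon> \<B> \<C> I \<alpha> \<beta> \<phi> a \<longleftrightarrow>
     (\<forall>Q\<in>\<B>. \<forall>R\<in>\<C>.
        (\<forall>p\<in>I Q. \<forall>x. \<alpha> R (p + diag \<epsilon>) (summand_proj \<C> R (p + diag \<epsilon>) (\<phi> p (\<beta> Q p x))) =
           (if p + diag \<epsilon> \<in> I R then a R Q * x else 0)) \<and>
        (a R Q \<noteq> 0 \<longrightarrow> interval_le (I Q) (ishift \<epsilon> (I R))))"

lemma ex_represents:
  assumes benign: "benign TYPE('k::field) \<I>"
    and N: "pmodule N" "is_direct_sum N \<C>" "finite \<C>" and M: "is_direct_sum M \<B>"
    and chart: "interval_chart \<I> (\<B> \<union> \<C>) I \<alpha> \<beta>"
    and \<phi>: "pmorphism M (pshift \<epsilon> N) \<phi>"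
  shows "\<exists>a :: ('k, 'v::ab_group_add, 'd::finite) pmod \<Rightarrow> _. represents \<epsilon> \<B> \<C> I \<alpha> \<beta> \<phi> a"
proof -
  have "\<exists>a. (\<forall>p\<in>I Q. \<forall>x. \<alpha> R (p + diag \<epsilon>) (summand_proj \<C> R (p + diag \<epsilon>) (\<phi> p (\<beta> Q p x))) =
           (if p + diag \<epsilon> \<in> I R then a * x else 0)) \<and> (a \<noteq> 0 \<longrightarrow> interval_le (I Q) (ishift \<epsilon> (I R)))"
    if "Q \<in> \<B>" "R \<in> \<C>" for Q R
  proof -
    have Q: "pmorphism (interval_pmod (I Q)) Q (\<beta> Q)" "I Q \<in> \<I>"
      using chart that unfolding interval_chart_def by blast+
    have R: "pmorphism R (interval_pmod (I R)) (\<alpha> R)" "I R \<in> \<I>"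
      using chart that unfolding interval_chart_def by blast+
    have "pmorphism (interval_pmod (I Q)) (pshift \<epsilon> N) (\<lambda>p x. \<phi> p (\<beta> Q p x))"
      using pmorphism_compose[OF pmorphism_compose[OF Q(1)
          submodule_inclusion[OF direct_sum_submodule[OF M that(1)]]] \<phi>] .
    then have "pmorphism (interval_pmod (I Q)) (pshift \<epsilon> (interval_pmod (I R)))
        (\<lambda>p x. \<alpha> R (p + diag \<epsilon>) (summand_proj \<C> R (p + diag \<epsilon>) (\<phi> p (\<beta> Q p x))))"
      by (intro pmorphism_compose[OF pmorphism_compose[OF _
          pmorphism_pshift[OF summand_proj_pmorphism[OF N that(2)]]] pmorphism_pshift[OF R(1)]])
    then have morphism: "pmorphism (interval_pmod (I Q)) (interval_pmod (ishift \<epsilon> (I R)))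
        (\<lambda>p x. \<alpha> R (p + diag \<epsilon>) (summand_proj \<C> R (p + diag \<epsilon>) (\<phi> p (\<beta> Q p x))))"
      by (simp only: pshift_interval_pmod)
    have "ishift \<epsilon> (I R) \<in> \<I>" using benign_ishift[OF benign R(2)] .
    from benign_morphism_scalar[OF benign Q(2) this morphism] show ?thesis
      by (simp only: mem_ishift)
  qed
  then have "\<exists>a. \<forall>Q\<in>\<B>. \<forall>R\<in>\<C>. (\<forall>p\<in>I Q. \<forall>x.
        \<alpha> R (p + diag \<epsilon>) (summand_proj \<C> R (p + diag \<epsilon>) (\<phi> p (\<beta> Q p x))) =
           (if p + diag \<epsilon> \<in> I R then a R Q * x else 0)) \<and>
        (a R Q \<noteq> 0 \<longrightarrow> interval_le (I Q) (ishift \<epsilon> (I R)))"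
    by (intro exI[of _ "\<lambda>R Q. SOME a. (\<forall>p\<in>I Q. \<forall>x.
        \<alpha> R (p + diag \<epsilon>) (summand_proj \<C> R (p + diag \<epsilon>) (\<phi> p (\<beta> Q p x))) =
           (if p + diag \<epsilon> \<in> I R then a * x else 0)) \<and>
        (a \<noteq> 0 \<longrightarrow> interval_le (I Q) (ishift \<epsilon> (I R)))"] ballI) (rule someI_ex)
  then show ?thesis unfolding represents_def .
qed

text \<open>The equation for the entry at \<open>(Q', Q)\<close> of the product is visible at every point where the
  internal map of length \<open>2\<epsilon>\<close> from \<open>Q\<close> to \<open>Q'\<close> could be nonzero. All summands \<open>R\<close> with a nonzero
  contribution are alive half-way by \<open>interval_le_between\<close>, so the full sum over \<open>R\<close> appears.\<close>

lemma represents_product: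
  assumes M: "pmodule M" "is_direct_sum M \<B>" "finite \<B>"
    and N: "pmodule N" "is_direct_sum N \<C>" "finite \<C>"
    and chart: "interval_chart \<I> (\<B> \<union> \<C>) I \<alpha> \<beta>"
    and \<phi>: "pmorphism M (pshift \<epsilon> N) \<phi>" and \<psi>: "pmorphism N (pshift \<epsilon> M) \<psi>"
    and \<psi>\<phi>: "\<And>p x. x \<in> pspace M p \<Longrightarrow> \<psi> (p + diag \<epsilon>) (\<phi> p x) = pmap M p (p + diag (2 * \<epsilon>)) x"
    and a: "represents \<epsilon> \<B> \<C> I \<alpha> \<beta> \<phi> a" and b: "represents \<epsilon> \<C> \<B> I \<alpha> \<beta> \<psi> b"
    and Q: "Q \<in> \<B>" "Q' \<in> \<B>" and p: "p \<in> I Q" "p + diag (2 * \<epsilon>) \<in> I Q'" and "0 \<le> \<epsilon>"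
  shows "(\<Sum>R\<in>\<C>. b Q' R * a R Q) = (if Q = Q' then 1 else 0)"
proof -
  have chartD: "pmorphism R (interval_pmod (I R)) (\<alpha> R)" "pmorphism (interval_pmod (I R)) R (\<beta> R)"
    "\<And>p x. x \<in> pspace R p \<Longrightarrow> \<beta> R p (\<alpha> R p x) = x"
    "\<And>p x. x \<in> pspace (interval_pmod (I R)) p \<Longrightarrow> \<alpha> R p (\<beta> R p x) = x" if "R \<in> \<B> \<union> \<C>" for R
    using chart that unfolding interval_chart_def by blast+
  have QB: "Q \<in> \<B> \<union> \<C>" "Q' \<in> \<B> \<union> \<C>" using Q by auto
  have le: "p \<le> p + diag (2 * \<epsilon>)" using \<open>0 \<le> \<epsilon>\<close> by (intro le_add_diag) simp
  let ?p1 = "p + diag \<epsilon>" and ?p2 = "p + diag (2 * \<epsilon>)"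
  have p2: "?p1 + diag \<epsilon> = ?p2" by (simp flip: mult_2)
  define y where "y = \<beta> Q p 1"
  have yQ: "y \<in> pspace Q p" using pmorphism_in[OF chartD(2)[OF QB(1)], of 1 p] p by (simp add: y_def)
  have y: "y \<in> pspace M p" using submodule_in[OF direct_sum_submodule[OF M(2) Q(1)] yQ] .
  define z where "z R = summand_proj \<C> R ?p1 (\<phi> p y)" for R
  define c where "c R = (if ?p1 \<in> I R then a R Q else 0)" for R
  have \<phi>y: "\<phi> p y \<in> pspace N ?p1" using pmorphism_in[OF \<phi> y] by simp
  have zR: "z R \<in> pspace R ?p1" if "R \<in> \<C>" for R
    using summand_proj(1)[OF N(2,3) \<phi>y that] by (simp add: z_def)
  have z: "z R = \<beta> R ?p1 (c R)" if "R \<in> \<C>" for R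
  proof -
    have "\<alpha> R ?p1 (z R) = c R"
      using a Q(1) that p(1) unfolding represents_def z_def y_def c_def by simp
    then show ?thesis using chartD(3)[of R "z R" ?p1] zR[OF that] that by simp
  qed
  let ?T = "\<lambda>x. \<alpha> Q' ?p2 (summand_proj \<B> Q' ?p2 (\<psi> ?p1 x))"
  have "pmorphism N (pshift \<epsilon> (interval_pmod (I Q')))
      (\<lambda>p x. \<alpha> Q' (p + diag \<epsilon>) (summand_proj \<B> Q' (p + diag \<epsilon>) (\<psi> p x)))"
    using pmorphism_compose[OF pmorphism_compose[OF \<psi>
          pmorphism_pshift[OF summand_proj_pmorphism[OF M Q(2)]]] pmorphism_pshift[OF chartD(1)[OF QB(2)]]] .
  from pmorphism_linear[OF this, of ?p1]
  have lin: "linear_btw (pscale N) (pspace N ?p1) (*) (pspace (interval_pmod (I Q')) ?p2) ?T"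
    unfolding p2 by (simp add: p2 del: add_diag_diag interval_pmod_sel(2))
  have "?T (\<phi> p y) = ?T (\<Sum>R\<in>\<C>. z R)"
    by (simp add: z_def summand_proj(2)[OF N(2,3) \<phi>y])
  also have "\<dots> = (\<Sum>R\<in>\<C>. ?T (z R))"
    using zR submodule_in[OF direct_sum_submodule[OF N(2)]]
    by (intro linear_btw_sum[OF lin pmodule_subspace[OF N(1)] pmodule_vector_space[OF N(1)]]) blast
  also have "\<dots> = (\<Sum>R\<in>\<C>. b Q' R * a R Q)"
  proof (rule sum.cong[OF refl])
    fix R assume R: "R \<in> \<C>"
    show "?T (z R) = b Q' R * a R Q"
    proof (cases "?p1 \<in> I R")
      case True
      then have "?T (\<beta> R ?p1 x) = b Q' R * x" for x
        using b R Q(2) p(2) p2 unfolding represents_def by metis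
      then show ?thesis using z[OF R] True by (simp add: c_def)
    next
      case False
      have "b Q' R = 0 \<or> a R Q = 0"
      proof (rule ccontr)
        assume "\<not> ?thesis"
        then have "interval_le (I Q) (ishift \<epsilon> (I R))" "interval_le (I R) (ishift \<epsilon> (I Q'))"
          using a b R Q unfolding represents_def by blast+
        then have "p \<in> ishift \<epsilon> (I R)"
          using interval_le_between[of "I Q" "ishift \<epsilon> (I R)" "ishift (2 * \<epsilon>) (I Q')" p]
            interval_le_ishift[of "I R" "ishift \<epsilon> (I Q')" \<epsilon>] p by (simp add: mem_ishift)
        then show False using False by (simp add: mem_ishift)
      qed
      moreover have "z R = 0"
        using z[OF R] False linear_btw_0[OF pmorphism_linear[OF chartD(2)[of R], of ?p1]] R
        by (simp add: c_def)
      moreover have "?T 0 = 0"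
        using linear_btw_0[OF lin pmodule_zero[OF N(1)]] .
      ultimately show ?thesis by auto
    qed
  qed
  finally have "?T (\<phi> p y) = (\<Sum>R\<in>\<C>. b Q' R * a R Q)" .
  moreover have "?T (\<phi> p y) = (if Q = Q' then 1 else 0)"
  proof -
    have "\<psi> ?p1 (\<phi> p y) = pmap Q p ?p2 y"
      using \<psi>\<phi>[OF y] submodule_pmap[OF direct_sum_submodule[OF M(2) Q(1)] le yQ] by simp
    moreover have "pmap Q p ?p2 y \<in> pspace Q ?p2"
      using linear_btw_in[OF pmodule_linear[OF submodule_pmodule[OF direct_sum_submodule[OF M(2) Q(1)]] le] yQ] .
    ultimately have "?T (\<phi> p y) = \<alpha> Q' ?p2 (if Q = Q' then pmap Q p ?p2 y else 0)"
      using summand_proj_summand[OF M(2,3) Q] by simp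
    moreover have "\<alpha> Q' ?p2 0 = 0"
      using linear_btw_0[OF pmorphism_linear[OF chartD(1)[OF QB(2)], of ?p2]]
        pmodule_zero[OF submodule_pmodule[OF direct_sum_submodule[OF M(2) Q(2)]]] by simp
    moreover have "\<alpha> Q ?p2 (pmap Q p ?p2 y) = 1" if "Q = Q'"
      using pmorphism_natural[OF chartD(1)[OF QB(1)] le yQ] chartD(4)[OF QB(1), of 1 p] p that
      by (simp add: y_def)
    ultimately show ?thesis by auto
  qed
  ultimately show ?thesis by simp
qed

text \<open>The products may differ from the identity, but at \<open>(Q', Q)\<close> only if \<open>Q'\<close>, shifted by
  \<open>2 * \<epsilon>\<close>, is dead wherever \<open>Q\<close> lives. This includes diagonal entries for short intervals.\<close>

definition near_inverse ::
  "real \<Rightarrow> 'x set \<Rightarrow> 'x set \<Rightarrow> ('x \<Rightarrow> (real^'d::finite) set)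
    \<Rightarrow> ('x \<Rightarrow> 'x \<Rightarrow> 'k::field) \<Rightarrow> ('x \<Rightarrow> 'x \<Rightarrow> 'k) \<Rightarrow> bool" where
  "near_inverse \<epsilon> X Y I a b \<longleftrightarrow>
     (\<forall>Q\<in>X. \<forall>R\<in>Y. a R Q \<noteq> 0 \<longrightarrow> interval_le (I Q) (ishift \<epsilon> (I R))) \<and>
     (\<forall>Q\<in>X. \<forall>R\<in>Y. b Q R \<noteq> 0 \<longrightarrow> interval_le (I R) (ishift \<epsilon> (I Q))) \<and>
     (\<forall>Q\<in>X. \<forall>Q'\<in>X. (\<Sum>R\<in>Y. b Q' R * a R Q) \<noteq> of_bool (Q' = Q) \<longrightarrow>
        interval_less (I Q) (ishift (2 * \<epsilon>) (I Q'))) \<and>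
     (\<forall>R\<in>Y. \<forall>R'\<in>Y. (\<Sum>Q\<in>X. a R' Q * b Q R) \<noteq> of_bool (R' = R) \<longrightarrow>
        interval_less (I R) (ishift (2 * \<epsilon>) (I R')))"

text \<open>Where the equation is not visible, the two intervals are disjoint. A nonzero error there
  still forces \<open>I Q \<le> ishift (2 * \<epsilon>) (I Q')\<close>, which together with disjointness is strict.\<close>

lemma interleaving_near_inverse:
  fixes M N :: "('k::field, 'v::ab_group_add, 'd::finite) pmod"
  assumes benign: "benign TYPE('k) \<I>" and "0 \<le> \<epsilon>"
    and M: "pmodule M" "is_direct_sum M \<B>" "finite \<B>"
    and N: "pmodule N" "is_direct_sum N \<C>" "finite \<C>"
    and isos: "\<forall>Q\<in>\<B> \<union> \<C>. I Q \<in> \<I> \<and> piso Q (interval_pmod (I Q) :: ('k, 'k, 'd) pmod)"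
    and int: "interleaved \<epsilon> M N"
  shows "\<exists>a b :: ('k, 'v, 'd) pmod \<Rightarrow> ('k, 'v, 'd) pmod \<Rightarrow> 'k. near_inverse \<epsilon> \<B> \<C> I a b"
proof -
  note iso = isos[rule_format]
  have "\<forall>Q\<in>\<B> \<union> \<C>. \<exists>\<alpha> \<beta>.
      I Q \<in> \<I> \<and> pmorphism Q (interval_pmod (I Q)) \<alpha> \<and> pmorphism (interval_pmod (I Q)) Q \<beta> \<and>
        (\<forall>p. \<forall>x\<in>pspace Q p. \<beta> p (\<alpha> p x) = x) \<and>
        (\<forall>p. \<forall>y\<in>pspace (interval_pmod (I Q)) p. \<alpha> p (\<beta> p y) = (y :: 'k))"
  proof
    fix Q assume "Q \<in> \<B> \<union> \<C>"
    then have "I Q \<in> \<I>" and iso_Q: "piso Q (interval_pmod (I Q) :: ('k, 'k, 'd) pmod)"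
      using iso by blast+
    from iso_Q[unfolded piso_def] obtain \<alpha> \<beta> where
      "pmorphism Q (interval_pmod (I Q)) \<alpha> \<and> pmorphism (interval_pmod (I Q)) Q \<beta> \<and>
        (\<forall>p. \<forall>x\<in>pspace Q p. \<beta> p (\<alpha> p x) = x) \<and>
        (\<forall>p. \<forall>y\<in>pspace (interval_pmod (I Q)) p. \<alpha> p (\<beta> p y) = (y :: 'k))"
      by (elim exE) (rule that)
    from conjI[OF \<open>I Q \<in> \<I>\<close> this] show "\<exists>\<alpha> \<beta>.
      I Q \<in> \<I> \<and> pmorphism Q (interval_pmod (I Q)) \<alpha> \<and> pmorphism (interval_pmod (I Q)) Q \<beta> \<and>
        (\<forall>p. \<forall>x\<in>pspace Q p. \<beta> p (\<alpha> p x) = x) \<and>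
        (\<forall>p. \<forall>y\<in>pspace (interval_pmod (I Q)) p. \<alpha> p (\<beta> p y) = (y :: 'k))"
      by (intro exI)
  qed
  from bchoice[OF this] obtain \<alpha> where "\<forall>Q\<in>\<B> \<union> \<C>. \<exists>\<beta>.
      I Q \<in> \<I> \<and> pmorphism Q (interval_pmod (I Q)) (\<alpha> Q) \<and> pmorphism (interval_pmod (I Q)) Q \<beta> \<and>
        (\<forall>p. \<forall>x\<in>pspace Q p. \<beta> p (\<alpha> Q p x) = x) \<and>
        (\<forall>p. \<forall>y\<in>pspace (interval_pmod (I Q)) p. \<alpha> Q p (\<beta> p y) = (y :: 'k))"
    by (rule exE)
  from bchoice[OF this] obtain \<beta> where chart: "interval_chart \<I> (\<B> \<union> \<C>) I \<alpha> \<beta>"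
    unfolding interval_chart_def by (rule exE)
  then have chart': "interval_chart \<I> (\<C> \<union> \<B>) I \<alpha> \<beta>" by (simp add: Un_commute)
  obtain \<phi> \<psi> where \<phi>: "pmorphism M (pshift \<epsilon> N) \<phi>" and \<psi>: "pmorphism N (pshift \<epsilon> M) \<psi>"
    and \<psi>\<phi>: "\<And>p x. x \<in> pspace M p \<Longrightarrow> \<psi> (p + diag \<epsilon>) (\<phi> p x) = pmap M p (p + diag (2 * \<epsilon>)) x"
    and \<phi>\<psi>: "\<And>p x. x \<in> pspace N p \<Longrightarrow> \<phi> (p + diag \<epsilon>) (\<psi> p x) = pmap N p (p + diag (2 * \<epsilon>)) x"
    using int unfolding interleaved_def by blast
  obtain a where a: "represents \<epsilon> \<B> \<C> I \<alpha> \<beta> \<phi> a"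
    using ex_represents[OF benign N M(2) chart \<phi>] by blast
  obtain b where b: "represents \<epsilon> \<C> \<B> I \<alpha> \<beta> \<psi> b"
    using ex_represents[OF benign M N(2) chart' \<psi>] by blast
  have less: "interval_less (I Q) (ishift (2 * \<epsilon>) (I Q'))"
    if err: "(\<Sum>R\<in>\<R>. f Q' R * g R Q) \<noteq> of_bool (Q' = Q)"
      and prod: "\<And>p. p \<in> I Q \<Longrightarrow> p + diag (2 * \<epsilon>) \<in> I Q' \<Longrightarrow>
        (\<Sum>R\<in>\<R>. f Q' R * g R Q) = (if Q = Q' then 1 else 0)"
      and le: "\<And>R. R \<in> \<R> \<Longrightarrow> f Q' R * g R Q \<noteq> 0 \<Longrightarrow> interval_le (I Q) (ishift (2 * \<epsilon>) (I Q'))"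
      and Q: "Q \<in> \<B> \<union> \<C>" "Q' \<in> \<B> \<union> \<C>"
    for \<R> and f g :: "_ \<Rightarrow> _ \<Rightarrow> 'k" and Q Q'
  proof (rule interval_lessI)
    have ints: "interval (I Q')" "interval (ishift (2 * \<epsilon>) (I Q'))"
      using benign_interval[OF benign] benign_ishift[OF benign] iso[OF Q(2)] by blast+
    show "interval (ishift (2 * \<epsilon>) (I Q'))" by fact
    show "I Q \<inter> ishift (2 * \<epsilon>) (I Q') = {}"
      using err prod by (cases "Q = Q'") (auto simp: mem_ishift)
    show "interval_le (I Q) (ishift (2 * \<epsilon>) (I Q'))"
    proof (cases "Q = Q'")
      case True
      then show ?thesis using interval_le_ishift_self[OF ints(1)] \<open>0 \<le> \<epsilon>\<close> by simp
    next
      case False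
      then have "(\<Sum>R\<in>\<R>. f Q' R * g R Q) \<noteq> 0" using err by auto
      then show ?thesis using le by (meson sum.not_neutral_contains_not_neutral)
    qed
  qed
  have le_a: "interval_le (I Q) (ishift \<epsilon> (I R))" if "Q \<in> \<B>" "R \<in> \<C>" "a R Q \<noteq> 0" for Q R
    using a that unfolding represents_def by blast
  have le_b: "interval_le (I R) (ishift \<epsilon> (I Q))" if "Q \<in> \<B>" "R \<in> \<C>" "b Q R \<noteq> 0" for Q R
    using b that unfolding represents_def by blast
  have two: "interval_le J (ishift (2 * \<epsilon>) L)"
    if "interval_le J (ishift \<epsilon> K)" "interval_le K (ishift \<epsilon> L)" for J K L :: "(real^'d) set"
    using interval_le_trans[OF that(1) interval_le_ishift[OF that(2)]] by simp
  have "interval_less (I Q) (ishift (2 * \<epsilon>) (I Q'))"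
    if Q: "Q \<in> \<B>" "Q' \<in> \<B>" "(\<Sum>R\<in>\<C>. b Q' R * a R Q) \<noteq> of_bool (Q' = Q)" for Q Q'
    using Q by (intro less[where \<R> = \<C> and f = b and g = a, OF Q(3)]
        represents_product[OF M N chart \<phi> \<psi> \<psi>\<phi> a b Q(1,2) _ _ \<open>0 \<le> \<epsilon>\<close>])
      (auto intro: two le_a le_b)
  moreover have "interval_less (I R) (ishift (2 * \<epsilon>) (I R'))"
    if R: "R \<in> \<C>" "R' \<in> \<C>" "(\<Sum>Q\<in>\<B>. a R' Q * b Q R) \<noteq> of_bool (R' = R)" for R R'
    using R by (intro less[where \<R> = \<B> and f = a and g = b, OF R(3)]
        represents_product[OF N M chart' \<psi> \<phi> \<phi>\<psi> b a R(1,2) _ _ \<open>0 \<le> \<epsilon>\<close>])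
      (auto intro: two le_a le_b)
  ultimately have "near_inverse \<epsilon> \<B> \<C> I a b"
    using le_a le_b by (simp add: near_inverse_def)
  then show ?thesis by blast
qed


section \<open>Solutions of CI problems on finite sets\<close>

lemma relpow_map:
  assumes "(x, y) \<in> R ^^ l" "\<And>x y. (x, y) \<in> R \<Longrightarrow> (h x, h y) \<in> S"
  shows "(h x, h y) \<in> S ^^ l"
  using assms(1)
proof (induction l arbitrary: y)
  case (Suc l)
  then show ?case using assms(2) by (auto intro: relcompI)
qed simp

text \<open>The matrix \<open>A\<close> is a permutation matrix, and \<open>B\<close> has to be its transpose. The zero patterns
  require that every matched pair is joined by edges in both directions.\<close>

lemma ci_simple_solution_iff:
  "(\<exists>(A :: 'k::field mat) B. ci_solution n (P, Q) A B \<and> ci_simple n A) \<longleftrightarrow>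
   (\<exists>\<kappa>. bij_betw \<kappa> {..<n} {..<n} \<and> (\<forall>j<n. P $$ (j, \<kappa> j) \<and> Q $$ (\<kappa> j, j)))"
proof
  assume "\<exists>(A :: 'k mat) B. ci_solution n (P, Q) A B \<and> ci_simple n A"
  then obtain A B :: "'k mat" where carrier: "A \<in> carrier_mat n n" "B \<in> carrier_mat n n"
    and AB: "A * B = 1\<^sub>m n"
    and P: "\<And>i j. i < n \<Longrightarrow> j < n \<Longrightarrow> \<not> P $$ (i, j) \<Longrightarrow> A $$ (i, j) = 0"
    and Q: "\<And>i j. i < n \<Longrightarrow> j < n \<Longrightarrow> \<not> Q $$ (i, j) \<Longrightarrow> B $$ (i, j) = 0"
    and ex1: "\<And>j. j < n \<Longrightarrow> \<exists>!i. i < n \<and> A $$ (j, i) = 1"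
    and other: "\<And>j i. j < n \<Longrightarrow> i < n \<Longrightarrow> A $$ (j, i) \<noteq> 1 \<Longrightarrow> A $$ (j, i) = 0"
    by (auto simp: ci_simple_def)
  define \<kappa> where "\<kappa> j = (THE i. i < n \<and> A $$ (j, i) = 1)" for j
  have \<kappa>: "\<kappa> j < n" "A $$ (j, \<kappa> j) = 1" if "j < n" for j
    using theI'[OF ex1[OF that]] by (auto simp: \<kappa>_def)
  have zero: "A $$ (j, i) = 0" if "j < n" "i < n" "i \<noteq> \<kappa> j" for j i
    using ex1[OF that(1)] \<kappa>[OF that(1)] other[OF that(1,2)] that(2,3) by blast
  have B: "B $$ (\<kappa> j, j') = (if j = j' then 1 else 0)" if "j < n" "j' < n" for j j'
  proof -
    have "(A * B) $$ (j, j') = (\<Sum>i<n. A $$ (j, i) * B $$ (i, j'))"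
      using that carrier by (simp add: scalar_prod_def atLeast0LessThan)
    also have "\<dots> = (\<Sum>i<n. if i = \<kappa> j then B $$ (i, j') else 0)"
      using zero[OF that(1)] \<kappa>[OF that(1)] by (intro sum.cong) auto
    also have "\<dots> = B $$ (\<kappa> j, j')" using \<kappa>[OF that(1)] by simp
    finally show ?thesis using AB that by simp
  qed
  have "inj_on \<kappa> {..<n}"
    using B by (intro inj_onI) (metis lessThan_iff zero_neq_one)
  moreover from this have "bij_betw \<kappa> {..<n} {..<n}"
    using \<kappa>(1) by (intro bij_betw_imageI) (auto simp: endo_inj_surj image_subset_iff)
  moreover have "P $$ (j, \<kappa> j)" "Q $$ (\<kappa> j, j)" if "j < n" for j
    using P[OF that \<kappa>(1)[OF that]] Q[OF \<kappa>(1)[OF that] that] \<kappa>(2)[OF that] B[OF that that]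
    by auto
  ultimately show "\<exists>\<kappa>. bij_betw \<kappa> {..<n} {..<n} \<and> (\<forall>j<n. P $$ (j, \<kappa> j) \<and> Q $$ (\<kappa> j, j))"
    by blast
next
  assume "\<exists>\<kappa>. bij_betw \<kappa> {..<n} {..<n} \<and> (\<forall>j<n. P $$ (j, \<kappa> j) \<and> Q $$ (\<kappa> j, j))"
  then obtain \<kappa> where bij: "bij_betw \<kappa> {..<n} {..<n}"
    and PQ: "\<And>j. j < n \<Longrightarrow> P $$ (j, \<kappa> j)" "\<And>j. j < n \<Longrightarrow> Q $$ (\<kappa> j, j)"
    by blast
  have \<kappa>: "\<kappa> j < n" if "j < n" for j
    using bij that by (auto simp: bij_betw_def)
  have inj: "\<kappa> j = \<kappa> j' \<longleftrightarrow> j = j'" if "j < n" "j' < n" for j j'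
    using bij that by (auto simp: bij_betw_def inj_on_def)
  define A :: "'k mat" where "A = Matrix.mat n n (\<lambda>(j, i). if i = \<kappa> j then 1 else 0)"
  define B :: "'k mat" where "B = Matrix.mat n n (\<lambda>(i, j). if i = \<kappa> j then 1 else 0)"
  have "A * B = 1\<^sub>m n"
  proof (rule eq_matI)
    fix j j' assume "j < dim_row (1\<^sub>m n :: 'k mat)" "j' < dim_col (1\<^sub>m n :: 'k mat)"
    then have j: "j < n" "j' < n" by auto
    then have "(A * B) $$ (j, j') = (\<Sum>i<n. (if i = \<kappa> j then 1 else 0) * (if i = \<kappa> j' then 1 else 0))"
      by (simp add: A_def B_def scalar_prod_def atLeast0LessThan)
    also have "\<dots> = (\<Sum>i<n. if i = \<kappa> j then (if \<kappa> j = \<kappa> j' then 1 else 0) else 0)"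
      by (intro sum.cong) auto
    also have "\<dots> = 1\<^sub>m n $$ (j, j')" using j \<kappa> inj by simp
    finally show "(A * B) $$ (j, j') = 1\<^sub>m n $$ (j, j')" .
  qed (auto simp: A_def B_def)
  moreover have "A $$ (j, i) = 0" if "j < n" "i < n" "\<not> P $$ (j, i)" for i j
    using that PQ(1)[OF that(1)] by (auto simp: A_def)
  moreover have "B $$ (i, j) = 0" if "i < n" "j < n" "\<not> Q $$ (i, j)" for i j
    using that PQ(2)[OF that(2)] by (auto simp: B_def)
  moreover have "A \<in> carrier_mat n n" "B \<in> carrier_mat n n" by (simp_all add: A_def B_def)
  ultimately have "ci_solution n (P, Q) A B" by simp
  moreover have "ci_simple n A"
    unfolding ci_simple_def
  proof (intro allI impI conjI)
    fix j assume j: "j < n"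
    have entry: "A $$ (j, i) = (if i = \<kappa> j then 1 else 0)" if "i < n" for i
      using j that by (simp add: A_def)
    show "\<exists>!i. i < n \<and> A $$ (j, i) = 1"
    proof (rule ex1I)
      show "\<kappa> j < n \<and> A $$ (j, \<kappa> j) = 1"
        using \<kappa>[OF j] entry[OF \<kappa>[OF j]] by simp
      show "i = \<kappa> j" if "i < n \<and> A $$ (j, i) = 1" for i
        using that entry[of i] by (auto split: if_splits)
    qed
    show "A $$ (j, i) = 0" if "i < n" "A $$ (j, i) \<noteq> 1" for i
      using that entry[of i] by (auto split: if_splits)
  qed
  ultimately show "\<exists>(A :: 'k mat) B. ci_solution n (P, Q) A B \<and> ci_simple n A" by blast
qed

definition ci_property :: "'k::field itself \<Rightarrow> nat \<Rightarrow> bool" where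
  "ci_property _ c' \<longleftrightarrow>
     (\<forall>n \<P>. ci_problem n \<P> \<longrightarrow> (\<exists>(A :: 'k mat) B. ci_solution n \<P> A B) \<longrightarrow>
        (\<exists>(A :: 'k mat) B. ci_solution n (ci_weakening n c' \<P>) A B \<and> ci_simple n A))"

text \<open>The smallest graph for which a given pair of mutually inverse matrices is a solution.\<close>

definition support_graph ::
  "'x set \<Rightarrow> 'y set \<Rightarrow> ('y \<Rightarrow> 'x \<Rightarrow> 'k::zero) \<Rightarrow> ('x \<Rightarrow> 'y \<Rightarrow> 'k) \<Rightarrow> (('x + 'y) \<times> ('x + 'y)) set" where
  "support_graph X Y a b =
     {(Inl x, Inr y) | x y. x \<in> X \<and> y \<in> Y \<and> a y x \<noteq> 0} \<union>
     {(Inr y, Inl x) | x y. x \<in> X \<and> y \<in> Y \<and> b x y \<noteq> 0}"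

lemma ci_property_finite_sets:
  fixes a :: "'y \<Rightarrow> 'x \<Rightarrow> 'k::field" and b :: "'x \<Rightarrow> 'y \<Rightarrow> 'k"
  assumes "ci_property TYPE('k) c'" "finite X" "finite Y" "card X = card Y"
    and ab: "\<And>y y'. y \<in> Y \<Longrightarrow> y' \<in> Y \<Longrightarrow> (\<Sum>x\<in>X. a y x * b x y') = (if y = y' then 1 else 0)"
  shows "\<exists>\<tau>. bij_betw \<tau> X Y \<and>
    (\<forall>x\<in>X. (\<exists>l\<le>c'. (Inl x, Inr (\<tau> x)) \<in> support_graph X Y a b ^^ l) \<and>
            (\<exists>l\<le>c'. (Inr (\<tau> x), Inl x) \<in> support_graph X Y a b ^^ l))"
proof -
  define n where "n = card X"
  obtain f where f: "bij_betw f {..<n} X"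
    using ex_bij_betw_nat_finite[OF assms(2)] by (auto simp: n_def atLeast0LessThan)
  obtain g where g: "bij_betw g {..<n} Y"
    using ex_bij_betw_nat_finite[OF assms(3)] by (auto simp: n_def assms(4) atLeast0LessThan)
  have fX: "f i \<in> X" and gY: "g i \<in> Y" if "i < n" for i
    using f g that by (auto simp: bij_betw_def)
  have g_eq: "g i = g j \<longleftrightarrow> i = j" if "i < n" "j < n" for i j
    using g that by (auto simp: bij_betw_def inj_on_def)
  define A where "A = Matrix.mat n n (\<lambda>(j, i). a (g j) (f i))"
  define B where "B = Matrix.mat n n (\<lambda>(i, j). b (f i) (g j))"
  define P where "P = Matrix.mat n n (\<lambda>(j, i). a (g j) (f i) \<noteq> 0)"
  define Q where "Q = Matrix.mat n n (\<lambda>(i, j). b (f i) (g j) \<noteq> 0)"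
  have "A * B = 1\<^sub>m n"
  proof (rule eq_matI)
    fix j j' assume "j < dim_row (1\<^sub>m n :: 'k mat)" "j' < dim_col (1\<^sub>m n :: 'k mat)"
    then have j: "j < n" "j' < n" by auto
    then have "(A * B) $$ (j, j') = (\<Sum>i<n. a (g j) (f i) * b (f i) (g j'))"
      by (simp add: A_def B_def scalar_prod_def atLeast0LessThan)
    also have "\<dots> = (\<Sum>x\<in>X. a (g j) x * b x (g j'))"
      by (rule sum.reindex_bij_betw[OF f])
    finally show "(A * B) $$ (j, j') = 1\<^sub>m n $$ (j, j')"
      using j by (simp add: ab gY g_eq)
  qed (auto simp: A_def B_def)
  moreover have "A $$ (j, i) = 0" if "j < n" "i < n" "\<not> P $$ (j, i)" for i j
    using that by (simp add: A_def P_def)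
  moreover have "B $$ (i, j) = 0" if "i < n" "j < n" "\<not> Q $$ (i, j)" for i j
    using that by (simp add: B_def Q_def)
  moreover have "A \<in> carrier_mat n n" "B \<in> carrier_mat n n" by (simp_all add: A_def B_def)
  ultimately have "ci_solution n (P, Q) A B" by simp
  moreover have "ci_problem n (P, Q)" by (simp add: P_def Q_def)
  ultimately obtain A' B' :: "'k mat"
    where "ci_solution n (ci_weakening n c' (P, Q)) A' B'" "ci_simple n A'"
    using assms(1) unfolding ci_property_def by blast
  then obtain \<kappa> where \<kappa>: "bij_betw \<kappa> {..<n} {..<n}"
    and paths: "\<And>j. j < n \<Longrightarrow> \<exists>l\<le>c'. (U_vertex (\<kappa> j), V_vertex j) \<in> ci_graph n (P, Q) ^^ l"
    "\<And>j. j < n \<Longrightarrow> \<exists>l\<le>c'. (V_vertex j, U_vertex (\<kappa> j)) \<in> ci_graph n (P, Q) ^^ l"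
  proof -
    from \<open>ci_solution n (ci_weakening n c' (P, Q)) A' B'\<close> \<open>ci_simple n A'\<close>
    obtain \<kappa> where \<kappa>: "bij_betw \<kappa> {..<n} {..<n}"
      and *: "\<And>j. j < n \<Longrightarrow> fst (ci_weakening n c' (P, Q)) $$ (j, \<kappa> j)"
      "\<And>j. j < n \<Longrightarrow> snd (ci_weakening n c' (P, Q)) $$ (\<kappa> j, j)"
      using ci_simple_solution_iff[of n "fst (ci_weakening n c' (P, Q))" "snd (ci_weakening n c' (P, Q))",
          where 'k = 'k] by auto
    have "\<kappa> j < n" if "j < n" for j using \<kappa> that by (auto simp: bij_betw_def)
    then show thesis using * by (intro that[OF \<kappa>]) (auto simp: ci_weakening_def)
  qed
  define h where "h v = (case v of U_vertex i \<Rightarrow> Inl (f i) | V_vertex j \<Rightarrow> Inr (g j))" for v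
  have hom: "(h v, h w) \<in> support_graph X Y a b" if "(v, w) \<in> ci_graph n (P, Q)" for v w
    using that fX gY by (auto simp: h_def support_graph_def P_def Q_def)
  define \<tau> where "\<tau> = g \<circ> inv_into {..<n} (f \<circ> \<kappa>)"
  have f\<kappa>: "bij_betw (f \<circ> \<kappa>) {..<n} X" using bij_betw_trans[OF \<kappa> f] .
  show ?thesis
  proof (intro exI[of _ \<tau>] conjI ballI)
    show "bij_betw \<tau> X Y"
      unfolding \<tau>_def using bij_betw_trans[OF bij_betw_inv_into[OF f\<kappa>] g] .
    fix x assume "x \<in> X"
    then obtain j where j: "j < n" "x = f (\<kappa> j)"
      using f\<kappa> by (auto simp: bij_betw_def)
    then have "\<tau> x = g j"
      using bij_betw_inv_into_left[OF f\<kappa>, of j] by (simp add: \<tau>_def)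
    then have h: "h (U_vertex (\<kappa> j)) = Inl x" "h (V_vertex j) = Inr (\<tau> x)"
      using j by (auto simp: h_def)
    show "\<exists>l\<le>c'. (Inl x, Inr (\<tau> x)) \<in> support_graph X Y a b ^^ l"
      using paths(1)[OF j(1)] relpow_map[where h = h, OF _ hom, of "U_vertex (\<kappa> j)" "V_vertex j"]
      unfolding h by blast
    show "\<exists>l\<le>c'. (Inr (\<tau> x), Inl x) \<in> support_graph X Y a b ^^ l"
      using paths(2)[OF j(1)] relpow_map[where h = h, OF _ hom, of "V_vertex j" "U_vertex (\<kappa> j)"]
      unfolding h by blast
  qed
qed

text \<open>The square matrix \<open>[[A, 1 - A B], [-1, B]]\<close> is invertible with inverse
  \<open>[[B, B A - 1], [1, A]]\<close>, whatever the (possibly rectangular) matrices \<open>A\<close> and \<open>B\<close> are. If \<open>A\<close>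
  and \<open>B\<close> are nearly inverse to each other then the blocks \<open>1 - A B\<close> and \<open>B A - 1\<close> are nearly
  zero.\<close>

fun dilation :: "'x set \<Rightarrow> ('y \<Rightarrow> 'x \<Rightarrow> 'k::field) \<Rightarrow> ('x \<Rightarrow> 'y \<Rightarrow> 'k) \<Rightarrow> 'y + 'x \<Rightarrow> 'x + 'y \<Rightarrow> 'k" where
  "dilation X A B (Inl y) (Inl x) = A y x"
| "dilation X A B (Inl y) (Inr y') = of_bool (y = y') - (\<Sum>x\<in>X. A y x * B x y')"
| "dilation X A B (Inr x) (Inl x') = - of_bool (x = x')"
| "dilation X A B (Inr x) (Inr y) = B x y"

fun dilation_inv :: "'y set \<Rightarrow> ('y \<Rightarrow> 'x \<Rightarrow> 'k::field) \<Rightarrow> ('x \<Rightarrow> 'y \<Rightarrow> 'k) \<Rightarrow> 'x + 'y \<Rightarrow> 'y + 'x \<Rightarrow> 'k" where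
  "dilation_inv Y A B (Inl x) (Inl y) = B x y"
| "dilation_inv Y A B (Inl x) (Inr x') = (\<Sum>y\<in>Y. B x y * A y x') - of_bool (x = x')"
| "dilation_inv Y A B (Inr y) (Inl y') = of_bool (y = y')"
| "dilation_inv Y A B (Inr y) (Inr x) = A y x"

lemma sum_mult_delta:
  fixes f :: "'i \<Rightarrow> 'k::field"
  assumes "finite F"
  shows "(\<Sum>i\<in>F. f i * of_bool (i = j)) = (if j \<in> F then f j else 0)"
    and "(\<Sum>i\<in>F. of_bool (j = i) * f i) = (if j \<in> F then f j else 0)"
proof -
  have "(\<Sum>i\<in>F. f i * of_bool (i = j)) = (\<Sum>i\<in>F. if i = j then f i else 0)"
    "(\<Sum>i\<in>F. of_bool (j = i) * f i) = (\<Sum>i\<in>F. if i = j then f i else 0)"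
    by (auto intro!: sum.cong)
  then show "(\<Sum>i\<in>F. f i * of_bool (i = j)) = (if j \<in> F then f j else 0)"
    "(\<Sum>i\<in>F. of_bool (j = i) * f i) = (if j \<in> F then f j else 0)"
    using assms by simp_all
qed

lemma dilation_inverse:
  fixes A :: "'y \<Rightarrow> 'x \<Rightarrow> 'k::field"
  assumes "finite X" "finite Y" "v \<in> Y <+> X" "v' \<in> Y <+> X"
  shows "(\<Sum>u\<in>X <+> Y. dilation X A B v u * dilation_inv Y A B u v') = (if v = v' then 1 else 0)"
proof -
  have split: "(\<Sum>u\<in>X <+> Y. dilation X A B v u * dilation_inv Y A B u v') =
      (\<Sum>x\<in>X. dilation X A B v (Inl x) * dilation_inv Y A B (Inl x) v') +
      (\<Sum>y\<in>Y. dilation X A B v (Inr y) * dilation_inv Y A B (Inr y) v')"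
    using assms by (simp add: sum.Plus)
  have assoc: "(\<Sum>x\<in>X. A y x * (\<Sum>y'\<in>Y. B x y' * A y' x')) =
      (\<Sum>y'\<in>Y. (\<Sum>x\<in>X. A y x * B x y') * A y' x')" for y x'
    by (simp add: sum_distrib_left sum_distrib_right mult.assoc sum.swap[of _ Y X])
  show ?thesis
  proof (cases v; cases v')
    fix y y' assume "v = Inl y" "v' = Inl y'"
    then show ?thesis using assms unfolding split by (auto simp: sum_mult_delta)
  next
    fix y x assume "v = Inl y" "v' = Inr x"
    then show ?thesis using assms unfolding split
      by (auto simp: sum_mult_delta right_diff_distrib left_diff_distrib sum_subtractf assoc)
  next
    fix x y assume "v = Inr x" "v' = Inl y"
    then show ?thesis using assms unfolding split by (auto simp: sum_mult_delta sum_negf)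
  next
    fix x x' assume "v = Inr x" "v' = Inr x'"
    then show ?thesis using assms unfolding split by (auto simp: sum_mult_delta sum_negf)
  qed
qed


section \<open>From CI problems to matchings\<close>

lemma walk_interval_le:
  assumes le: "\<forall>(x, y)\<in>G. interval_le (iv x) (ishift \<epsilon> (iv y))" and "(x, y) \<in> G ^^ l"
  shows "interval_le (iv x) (ishift (real l * \<epsilon>) (iv y))"
  using assms(2)
proof (induction l arbitrary: y)
  case 0
  then show ?case by (simp add: interval_le_def)
next
  case (Suc l)
  then obtain z where z: "(x, z) \<in> G ^^ l" "(z, y) \<in> G" by auto
  then have "interval_le (iv z) (ishift \<epsilon> (iv y))" using le by auto
  from interval_le_trans[OF Suc.IH[OF z(1)] interval_le_ishift[OF this]]
  show ?case by (simp add: algebra_simps)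
qed

text \<open>\<open>F\<close> is a part of the graph that cannot be left without passing to a strictly larger
  interval.\<close>

lemma walk_interval_less:
  assumes le: "\<forall>(x, y)\<in>G. interval_le (iv x) (ishift \<epsilon> (iv y))"
    and less: "\<forall>(x, y)\<in>G. x \<in> F \<longrightarrow> y \<notin> F \<longrightarrow> interval_less (iv x) (ishift \<epsilon> (iv y))"
    and "(x, y) \<in> G ^^ l" "x \<in> F" "y \<notin> F"
  shows "interval_less (iv x) (ishift (real l * \<epsilon>) (iv y))"
  using assms(3-)
proof (induction l arbitrary: y)
  case (Suc l)
  then obtain z where z: "(x, z) \<in> G ^^ l" "(z, y) \<in> G" by auto
  have eq: "ishift (real (Suc l) * \<epsilon>) (iv y) = ishift (real l * \<epsilon>) (ishift \<epsilon> (iv y))"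
    by (simp add: algebra_simps)
  show ?case
  proof (cases "z \<in> F")
    case True
    then have "interval_less (iv z) (ishift \<epsilon> (iv y))" using less z(2) Suc.prems by auto
    from interval_le_less_trans[OF walk_interval_le[OF le z(1)] interval_less_ishift[OF this]]
    show ?thesis unfolding eq .
  next
    case False
    have "interval_le (iv z) (ishift \<epsilon> (iv y))" using le z(2) by auto
    from interval_less_le_trans[OF Suc.IH[OF z(1) \<open>x \<in> F\<close> False] interval_le_ishift[OF this]]
    show ?thesis unfolding eq .
  qed
qed simp

text \<open>A visit to \<open>F\<close> makes the interval at the start of a closed walk strictly smaller than its
  shift by the length of the walk, and so disjoint from this shift. This is impossible for walks
  of length at most \<open>2 * c\<close> if the interval survives a step of \<open>2 * c * \<epsilon>\<close>.\<close>

lemma closed_walk_avoids: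
  assumes le: "\<forall>(x, y)\<in>G. interval_le (iv x) (ishift \<epsilon> (iv y))"
    and less: "\<forall>(x, y)\<in>G. x \<in> F \<longrightarrow> y \<notin> F \<longrightarrow> interval_less (iv x) (ishift \<epsilon> (iv y))"
    and walks: "(x, y) \<in> G ^^ l" "(y, x) \<in> G ^^ l'" "real l + real l' \<le> 2 * c"
    and "0 \<le> \<epsilon>" "x \<notin> F" and intervals: "\<And>t. interval (ishift t (iv x))"
    and survives: "iv x \<inter> ishift (2 * (c * \<epsilon>)) (iv x) \<noteq> {}"
  shows "y \<notin> F"
proof
  assume "y \<in> F"
  have "interval_less (iv x) (ishift (real l * \<epsilon>) (ishift (real l' * \<epsilon>) (iv x)))"
    using interval_le_less_trans[OF walk_interval_le[OF le walks(1)]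
      interval_less_ishift[OF walk_interval_less[OF le less walks(2) \<open>y \<in> F\<close> \<open>x \<notin> F\<close>]]] .
  moreover have "interval_le (ishift (real l * \<epsilon> + real l' * \<epsilon>) (iv x)) (ishift (2 * (c * \<epsilon>)) (iv x))"
    using interval_le_ishift_self[OF intervals[of "real l * \<epsilon> + real l' * \<epsilon>"],
        of "2 * (c * \<epsilon>) - (real l * \<epsilon> + real l' * \<epsilon>)"]
      mult_right_mono[OF walks(3) \<open>0 \<le> \<epsilon>\<close>] by (simp add: algebra_simps)
  ultimately have "interval_less (iv x) (ishift (2 * (c * \<epsilon>)) (iv x))"
    using interval_less_le_trans by simp
  then show False using interval_less_disjoint survives by blast
qed

text \<open>The intervals at the vertices of the dilated CI problem. The vertices in the second half of
  either side carry the intervals of the opposite module, delayed by \<open>\<epsilon>\<close>: then the identity blocks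
  of the dilation cost nothing, and an error block has the full shift \<open>2 * \<epsilon>\<close> at its disposal.\<close>

fun dilation_interval :: "real \<Rightarrow> ('x \<Rightarrow> (real^'d::finite) set) \<Rightarrow> ('x + 'x) + ('x + 'x) \<Rightarrow> (real^'d) set" where
  "dilation_interval \<epsilon> I (Inl (Inl Q)) = I Q"
| "dilation_interval \<epsilon> I (Inl (Inr R)) = ishift (- \<epsilon>) (I R)"
| "dilation_interval \<epsilon> I (Inr (Inl R)) = I R"
| "dilation_interval \<epsilon> I (Inr (Inr Q)) = ishift (- \<epsilon>) (I Q)"

definition dilation_dummies :: "(('x + 'x) + ('x + 'x)) set" where
  "dilation_dummies = Inl ` range Inr \<union> Inr ` range Inr"

lemma dilation_dummies_simps [simp]:
  "Inl (Inl Q) \<notin> dilation_dummies" "Inr (Inl R) \<notin> dilation_dummies"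
  "Inl (Inr R) \<in> dilation_dummies" "Inr (Inr Q) \<in> dilation_dummies"
  by (auto simp: dilation_dummies_def)

lemma dilation_graph:
  fixes I :: "'x \<Rightarrow> (real^'d::finite) set" and a b :: "'x \<Rightarrow> 'x \<Rightarrow> 'k::field"
  assumes near: "near_inverse \<epsilon> X Y I a b"
    and edge: "(v, w) \<in> support_graph (X <+> Y) (Y <+> X) (dilation X a b) (dilation_inv Y a b)"
  shows "interval_le (dilation_interval \<epsilon> I v) (ishift \<epsilon> (dilation_interval \<epsilon> I w))"
    and "v \<in> dilation_dummies \<Longrightarrow> w \<notin> dilation_dummies \<Longrightarrow>
      interval_less (dilation_interval \<epsilon> I v) (ishift \<epsilon> (dilation_interval \<epsilon> I w))"
proof -
  have a: "interval_le (I Q) (ishift \<epsilon> (I R))" if "Q \<in> X" "R \<in> Y" "a R Q \<noteq> 0" for Q R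
    using near that unfolding near_inverse_def by simp
  have b: "interval_le (I R) (ishift \<epsilon> (I Q))" if "Q \<in> X" "R \<in> Y" "b Q R \<noteq> 0" for Q R
    using near that unfolding near_inverse_def by simp
  have ba: "interval_less (I Q) (ishift (2 * \<epsilon>) (I Q'))"
    if "Q \<in> X" "Q' \<in> X" "(\<Sum>R\<in>Y. b Q' R * a R Q) \<noteq> of_bool (Q' = Q)" for Q Q'
    using near that unfolding near_inverse_def by blast
  have ab: "interval_less (I R) (ishift (2 * \<epsilon>) (I R'))"
    if "R \<in> Y" "R' \<in> Y" "(\<Sum>Q\<in>X. a R' Q * b Q R) \<noteq> of_bool (R' = R)" for R R'
    using near that unfolding near_inverse_def by blast
  have delayed: "interval_le (ishift (- \<epsilon>) J) K" if "interval_le J (ishift \<epsilon> K)" for J K :: "(real^'d) set"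
    using interval_le_ishift[OF that, of "- \<epsilon>"] by simp
  have error: "interval_less (ishift (- \<epsilon>) J) (ishift \<epsilon> K)" if "interval_less J (ishift (2 * \<epsilon>) K)"
    for J K :: "(real^'d) set"
    using interval_less_ishift[OF that, of "- \<epsilon>"] by simp
  have refl: "interval_le J J" for J :: "(real^'d) set" by (simp add: interval_le_def)
  have "interval_le (dilation_interval \<epsilon> I v) (ishift \<epsilon> (dilation_interval \<epsilon> I w)) \<and>
      (v \<in> dilation_dummies \<longrightarrow> w \<notin> dilation_dummies \<longrightarrow>
        interval_less (dilation_interval \<epsilon> I v) (ishift \<epsilon> (dilation_interval \<epsilon> I w)))"
    using edge unfolding support_graph_def
  proof (elim UnE CollectE exE conjE)
    fix x y assume vw: "(v, w) = (Inl x, Inr y)" and mem: "x \<in> X <+> Y" "y \<in> Y <+> X"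
      and nz: "dilation X a b y x \<noteq> 0"
    show ?thesis
    proof (cases x; cases y)
      fix Q R assume "x = Inl Q" "y = Inl R"
      then show ?thesis using vw mem nz a by auto
    next
      fix Q Q' assume "x = Inl Q" "y = Inr Q'"
      then show ?thesis using vw mem nz refl by auto
    next
      fix R R' assume "x = Inr R" "y = Inl R'"
      then show ?thesis using vw mem nz error[OF ab[of R R']] interval_less_imp_le by auto
    next
      fix R Q assume "x = Inr R" "y = Inr Q"
      then show ?thesis using vw mem nz delayed[OF b[of Q R]] by auto
    qed
  next
    fix x y assume vw: "(v, w) = (Inr y, Inl x)" and mem: "x \<in> X <+> Y" "y \<in> Y <+> X"
      and nz: "dilation_inv Y a b x y \<noteq> 0"
    show ?thesis
    proof (cases x; cases y)
      fix Q R assume "x = Inl Q" "y = Inl R"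
      then show ?thesis using vw mem nz b by auto
    next
      fix Q Q' assume "x = Inl Q" "y = Inr Q'"
      then show ?thesis using vw mem nz error[OF ba[of Q' Q]] interval_less_imp_le by auto
    next
      fix R R' assume "x = Inr R" "y = Inl R'"
      then show ?thesis using vw mem nz refl by auto
    next
      fix R Q assume "x = Inr R" "y = Inr Q"
      then show ?thesis using vw mem nz delayed[OF a[of Q R]] by auto
    qed
  qed
  then show "interval_le (dilation_interval \<epsilon> I v) (ishift \<epsilon> (dilation_interval \<epsilon> I w))"
    and "v \<in> dilation_dummies \<Longrightarrow> w \<notin> dilation_dummies \<Longrightarrow>
      interval_less (dilation_interval \<epsilon> I v) (ishift \<epsilon> (dilation_interval \<epsilon> I w))"
    by blast+
qed

text \<open>A perfect matching of the dilated problem restricts to a partial matching of the summands.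
  Two summands matched with each other are interleaved by \<open>walk_interval_le\<close>, used for the walks
  in both directions. A summand matched with a dummy lies on a closed walk of length at most
  \<open>2 * c\<close> through a dummy, and \<open>closed_walk_avoids\<close> shows that it is close to zero.\<close>

lemma ci_property_imp_matching:
  fixes M N :: "('k::field, 'v::ab_group_add, 'd::finite) pmod"
  assumes ci: "ci_property TYPE('k) c'" "real c' \<le> c"
    and benign: "benign TYPE('k) \<I>" and "0 \<le> \<epsilon>"
    and M: "pmodule M" "is_direct_sum M \<B>" "finite \<B>"
    and N: "pmodule N" "is_direct_sum N \<C>" "finite \<C>"
    and isos: "\<forall>Q\<in>\<B> \<union> \<C>. I Q \<in> \<I> \<and> piso Q (interval_pmod (I Q) :: ('k, 'k, 'd) pmod)"
    and int: "interleaved \<epsilon> M N"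
  shows "\<exists>\<B>' \<C>' \<sigma>. is_matching (c * \<epsilon>) \<B> \<C> \<B>' \<C>' \<sigma>"
proof -
  note iso = isos[rule_format]
  obtain a b :: "('k, 'v, 'd) pmod \<Rightarrow> ('k, 'v, 'd) pmod \<Rightarrow> 'k" where near: "near_inverse \<epsilon> \<B> \<C> I a b"
    using interleaving_near_inverse[OF benign \<open>0 \<le> \<epsilon>\<close> M N isos int] by blast
  define G where "G = support_graph (\<B> <+> \<C>) (\<C> <+> \<B>) (dilation \<B> a b) (dilation_inv \<C> a b)"
  let ?iv = "dilation_interval \<epsilon> I" and ?F = "dilation_dummies"
  have le: "\<forall>(x, y)\<in>G. interval_le (?iv x) (ishift \<epsilon> (?iv y))"
    and less: "\<forall>(x, y)\<in>G. x \<in> ?F \<longrightarrow> y \<notin> ?F \<longrightarrow> interval_less (?iv x) (ishift \<epsilon> (?iv y))"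
    using dilation_graph[OF near] unfolding G_def by blast+
  have "\<exists>\<tau>. bij_betw \<tau> (\<B> <+> \<C>) (\<C> <+> \<B>) \<and>
      (\<forall>x\<in>\<B> <+> \<C>. (\<exists>l\<le>c'. (Inl x, Inr (\<tau> x)) \<in> G ^^ l) \<and> (\<exists>l\<le>c'. (Inr (\<tau> x), Inl x) \<in> G ^^ l))"
    unfolding G_def
  proof (rule ci_property_finite_sets[OF ci(1)])
    show "finite (\<B> <+> \<C>)" "finite (\<C> <+> \<B>)" "card (\<B> <+> \<C>) = card (\<C> <+> \<B>)"
      using M(3) N(3) by (simp_all add: card_Plus)
    show "(\<Sum>u\<in>\<B> <+> \<C>. dilation \<B> a b v u * dilation_inv \<C> a b u v') = (if v = v' then 1 else 0)"
      if "v \<in> \<C> <+> \<B>" "v' \<in> \<C> <+> \<B>" for v v'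
      using that by (rule dilation_inverse[OF M(3) N(3)])
  qed
  then obtain \<tau> where \<tau>: "bij_betw \<tau> (\<B> <+> \<C>) (\<C> <+> \<B>)"
    and walks: "\<And>x. x \<in> \<B> <+> \<C> \<Longrightarrow>
      (\<exists>l\<le>c'. (Inl x, Inr (\<tau> x)) \<in> G ^^ l) \<and> (\<exists>l\<le>c'. (Inr (\<tau> x), Inl x) \<in> G ^^ l)"
    by auto
  have interval_I: "interval (ishift t (I Q))" if "Q \<in> \<B> \<union> \<C>" for t Q
    using iso[OF that] benign_ishift[OF benign] benign_interval[OF benign] by blast
  have nonneg: "0 \<le> c * \<epsilon>"
    using order_trans[OF of_nat_0_le_iff ci(2)] \<open>0 \<le> \<epsilon>\<close> by (rule mult_nonneg_nonneg)
  have close: "interval_le (I Q) (ishift (c * \<epsilon>) (I R))"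
    if "(v, w) \<in> G ^^ l" "l \<le> c'" "?iv v = I Q" "?iv w = I R" "R \<in> \<B> \<union> \<C>" for v w l Q R
  proof -
    have "real l * \<epsilon> \<le> c * \<epsilon>" using that(2) ci(2) \<open>0 \<le> \<epsilon>\<close> by (intro mult_right_mono) auto
    then have "interval_le (ishift (real l * \<epsilon>) (I R)) (ishift (c * \<epsilon>) (I R))"
      using interval_le_ishift_self[OF interval_I[OF that(5)], of "c * \<epsilon> - real l * \<epsilon>" "real l * \<epsilon>"] by simp
    then show ?thesis
      using walk_interval_le[OF le that(1)] that(3,4) interval_le_trans by metis
  qed
  have dummy: "interleaved (c * \<epsilon>) Q (zero_pmod :: ('k, 'k, 'd) pmod)"
    if "(v, w) \<in> G ^^ l" "(w, v) \<in> G ^^ l'" "l \<le> c'" "l' \<le> c'" "?iv v = I Q" "v \<notin> ?F" "w \<in> ?F" "Q \<in> \<B> \<union> \<C>"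
    for v w l l' Q
  proof -
    have "real l + real l' \<le> 2 * c" using that(3,4) ci(2) by linarith
    then have "I Q \<inter> ishift (2 * (c * \<epsilon>)) (I Q) = {}"
      using closed_walk_avoids[OF le less that(1,2) _ \<open>0 \<le> \<epsilon>\<close> that(6), of c] that(5,7)
        interval_I[OF that(8)] by auto
    then have "interleaved (c * \<epsilon>) (interval_pmod (I Q) :: ('k, 'k, 'd) pmod) (zero_pmod :: ('k, 'k, 'd) pmod)"
      by (simp add: interleaved_zero_interval)
    from interleaved_piso[OF iso[OF that(8), THEN conjunct2] piso_refl this nonneg]
    show ?thesis .
  qed
  define \<B>' where "\<B>' = {Q \<in> \<B>. \<tau> (Inl Q) \<in> range Inl}"
  define \<sigma> where "\<sigma> Q = projl (\<tau> (Inl Q))" for Q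
  have \<tau>_in: "\<tau> x \<in> \<C> <+> \<B>" if "x \<in> \<B> <+> \<C>" for x
    using \<tau> that by (auto simp: bij_betw_def)
  have \<sigma>: "\<tau> (Inl Q) = Inl (\<sigma> Q)" "\<sigma> Q \<in> \<C>" if "Q \<in> \<B>'" for Q
    using that \<tau>_in[OF InlI, of Q] by (auto simp: \<B>'_def \<sigma>_def)
  have "inj_on \<sigma> \<B>'"
  proof (rule inj_onI)
    fix Q Q' assume Q: "Q \<in> \<B>'" "Q' \<in> \<B>'" "\<sigma> Q = \<sigma> Q'"
    then have "\<tau> (Inl Q) = \<tau> (Inl Q')" by (simp add: \<sigma>)
    then show "Q = Q'"
      using inj_onD[OF bij_betw_imp_inj_on[OF \<tau>], of "Inl Q" "Inl Q'"] Q by (simp add: \<B>'_def InlI)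
  qed
  moreover have "interleaved (c * \<epsilon>) Q (\<sigma> Q)" if Q: "Q \<in> \<B>'" for Q
  proof -
    have QB: "Q \<in> \<B>" using Q by (simp add: \<B>'_def)
    obtain l l' where l: "l \<le> c'" "(Inl (Inl Q), Inr (Inl (\<sigma> Q))) \<in> G ^^ l"
      "l' \<le> c'" "(Inr (Inl (\<sigma> Q)), Inl (Inl Q)) \<in> G ^^ l'"
      using walks[OF InlI[OF QB]] \<sigma>[OF Q] by auto
    have "interval_le (I Q) (ishift (c * \<epsilon>) (I (\<sigma> Q)))" "interval_le (I (\<sigma> Q)) (ishift (c * \<epsilon>) (I Q))"
      using close[OF l(2,1)] close[OF l(4,3)] QB \<sigma>[OF Q] by simp_all
    then have "interleaved (c * \<epsilon>) (interval_pmod (I Q) :: ('k, 'k, 'd) pmod) (interval_pmod (I (\<sigma> Q)))"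
      using QB \<sigma>[OF Q] interval_I by (intro interval_le_imp_interleaved) auto
    then show ?thesis
      using interleaved_piso[of Q "interval_pmod (I Q) :: ('k, 'k, 'd) pmod" "\<sigma> Q"
          "interval_pmod (I (\<sigma> Q)) :: ('k, 'k, 'd) pmod" "c * \<epsilon>"]
        iso[of Q] iso[of "\<sigma> Q"] QB \<sigma>[OF Q] nonneg by simp
  qed
  moreover have "interleaved (c * \<epsilon>) Q (zero_pmod :: ('k, 'k, 'd) pmod)" if Q: "Q \<in> \<B> - \<B>'" for Q
  proof -
    obtain Q' where "\<tau> (Inl Q) = Inr Q'"
      using \<tau>_in[OF InlI, of Q] Q by (auto simp: \<B>'_def)
    then obtain l l' where l: "l \<le> c'" "(Inl (Inl Q), Inr (Inr Q')) \<in> G ^^ l"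
      "l' \<le> c'" "(Inr (Inr Q'), Inl (Inl Q)) \<in> G ^^ l'"
      using walks[OF InlI, of Q] Q by auto
    show ?thesis using Q by (intro dummy[OF l(2,4,1,3)]) auto
  qed
  moreover have "interleaved (c * \<epsilon>) R (zero_pmod :: ('k, 'k, 'd) pmod)" if R: "R \<in> \<C> - \<sigma> ` \<B>'" for R
  proof -
    have "Inl R \<in> \<tau> ` (\<B> <+> \<C>)" using \<tau> R by (simp add: bij_betw_def InlI)
    then obtain x where x: "x \<in> \<B> <+> \<C>" "\<tau> x = Inl R"
      unfolding image_iff by (elim bexE) (rule that, simp_all)
    have "x \<noteq> Inl Q" for Q
    proof
      assume "x = Inl Q"
      with x have "Q \<in> \<B>'" "\<sigma> Q = R" by (auto simp: \<B>'_def \<sigma>_def)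
      with R show False by auto
    qed
    then obtain R' where "x = Inr R'" by (cases x) auto
    then obtain l l' where l: "l \<le> c'" "(Inl (Inr R'), Inr (Inl R)) \<in> G ^^ l"
      "l' \<le> c'" "(Inr (Inl R), Inl (Inr R')) \<in> G ^^ l'"
      using walks[OF x(1)] x(2) by auto
    show ?thesis using R by (intro dummy[OF l(4,2,3,1)]) auto
  qed
  ultimately have "is_matching (c * \<epsilon>) \<B> \<C> \<B>' (\<sigma> ` \<B>') \<sigma>"
    using \<sigma>(2) unfolding is_matching_def bij_betw_def by (simp add: image_subset_iff \<B>'_def)
  then show ?thesis by blast
qed


section \<open>Truncated upsets\<close>

text \<open>An upset cut off by one upper bound for one coordinate is directed: the join of two of its
  points stays below the bound. So intersections of such sets are connected without further
  conditions.\<close>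

definition truncated :: "'d \<Rightarrow> real \<Rightarrow> (real^'d::finite) set \<Rightarrow> (real^'d) set" where
  "truncated i b U = {p \<in> U. vec_nth p i < b}"

definition vec_join :: "real^'d::finite \<Rightarrow> real^'d \<Rightarrow> real^'d" where
  "vec_join p q = (\<chi> k. max (vec_nth p k) (vec_nth q k))"

lemma vec_join: "p \<le> vec_join p q" "q \<le> vec_join p q"
  "vec_nth (vec_join p q) i = max (vec_nth p i) (vec_nth q i)"
  by (simp_all add: vec_join_def less_eq_vec_def)

lemma upsetD: "upset U \<Longrightarrow> p \<in> U \<Longrightarrow> p \<le> q \<Longrightarrow> q \<in> U"
  by (auto simp: upset_def)

lemma truncated_join:
  "upset U \<Longrightarrow> p \<in> truncated i b U \<Longrightarrow> q \<in> truncated i b U \<Longrightarrow> vec_join p q \<in> truncated i b U"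
  using upsetD[OF _ _ vec_join(1)] by (auto simp: truncated_def vec_join(3))

lemma interval_truncated:
  assumes "upset U"
  shows "interval (truncated i b U)"
  unfolding interval_def
proof (intro conjI allI impI ballI)
  fix p q r assume "p \<le> q" "q \<le> r" "p \<in> truncated i b U" "r \<in> truncated i b U"
  then have "q \<in> U" "vec_nth q i \<le> vec_nth r i" "vec_nth r i < b"
    using upsetD[OF assms, of p q] by (auto simp: truncated_def less_eq_vec_def)
  then show "q \<in> truncated i b U" by (simp add: truncated_def)
next
  fix p q assume pq: "p \<in> truncated i b U" "q \<in> truncated i b U"
  \<comment> \<open>The zigzag \<open>p \<ge> p \<le> p \<squnion> q \<ge> q \<le> q\<close>.\<close>
  let ?f = "\<lambda>n::nat. if n \<le> 1 then p else if n = 2 then vec_join p q else q"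
  have "?f 0 = p \<and> ?f (2 * 2) = q \<and> (\<forall>n\<le>2 * 2. ?f n \<in> truncated i b U) \<and>
      (\<forall>n<2. ?f (2 * n + 1) \<le> ?f (2 * n) \<and> ?f (2 * n + 1) \<le> ?f (2 * n + 2))"
    using pq truncated_join[OF assms pq] vec_join(1,2)[of p q] vec_join(2)[of q p] by auto
  then show "\<exists>f (m::nat). f 0 = p \<and> f (2 * m) = q \<and> (\<forall>n\<le>2 * m. f n \<in> truncated i b U) \<and>
      (\<forall>n<m. f (2 * n + 1) \<le> f (2 * n) \<and> f (2 * n + 1) \<le> f (2 * n + 2))"
    by (intro exI[of _ ?f] exI[of _ 2])
qed

lemma truncated_Int: "truncated i b U \<inter> truncated i b' U' = truncated i (min b b') (U \<inter> U')"
  by (auto simp: truncated_def)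

lemma upset_Int: "upset U \<Longrightarrow> upset U' \<Longrightarrow> upset (U \<inter> U')"
  by (auto simp: upset_def)

lemma upset_ishift: "upset U \<Longrightarrow> upset (ishift t U)"
  unfolding upset_def mem_ishift using add_diag_mono[OF _ order_refl] by blast

lemma ishift_truncated: "ishift t (truncated i b U) = truncated i (b - t) (ishift t U)"
  by (auto simp: ishift_def truncated_def diag_def)

definition generated_below :: "'d \<Rightarrow> real \<Rightarrow> (real^'d::finite) set \<Rightarrow> bool" where
  "generated_below i b U \<longleftrightarrow> (\<forall>p\<in>U. \<exists>q\<in>truncated i b U. q \<le> p)"

lemma generated_below_ishift:
  assumes "generated_below i b U"
  shows "generated_below i (b - t) (ishift t U)"
  unfolding generated_below_def
proof
  fix p assume "p \<in> ishift t U"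
  then obtain q where "q \<in> truncated i b U" "q \<le> p + diag t"
    using assms unfolding generated_below_def mem_ishift by blast
  then have "q + diag (- t) \<in> truncated i (b - t) (ishift t U)" "q + diag (- t) \<le> p"
    using add_diag_mono[of q "p + diag t" "- t" "- t"]
    unfolding ishift_truncated[symmetric] by (simp_all add: mem_ishift)
  then show "\<exists>q\<in>truncated i (b - t) (ishift t U). q \<le> p" by blast
qed

lemma upset_gen_truncated:
  "upset U \<Longrightarrow> generated_below i b U \<Longrightarrow> upset_gen (truncated i b U) = U"
  by (auto simp: mem_upset_gen generated_below_def set_eq_iff truncated_def intro: upsetD)

lemma interval_le_truncatedI:
  assumes "upset U" "generated_below i b U" "upset U'" "generated_below i b' U'" "U \<subseteq> U'" "b' \<le> b"
  shows "interval_le (truncated i b U) (truncated i b' U')"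
  using assms by (auto simp: interval_le_def upset_exit_def upset_gen_truncated) (auto simp: truncated_def)

lemma interval_le_truncated_ishift_iff:
  assumes U: "upset U" "generated_below i b U" and U': "upset U'" "generated_below i b U'" and "0 \<le> t"
  shows "interval_le (truncated i b U) (ishift t (truncated i b U')) \<longleftrightarrow> U \<subseteq> ishift t U'"
proof
  assume "interval_le (truncated i b U) (ishift t (truncated i b U'))"
  then show "U \<subseteq> ishift t U'"
    by (simp add: interval_le_def upset_gen_ishift upset_gen_truncated[OF U] upset_gen_truncated[OF U'])
next
  assume "U \<subseteq> ishift t U'"
  then show "interval_le (truncated i b U) (ishift t (truncated i b U'))"
    unfolding ishift_truncated using \<open>0 \<le> t\<close>
    by (intro interval_le_truncatedI U U' upset_ishift generated_below_ishift) simp_all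
qed

text \<open>Naturality propagates nonvanishing upwards inside the target, which excludes that the source
  is cut off first, and downwards inside the source, which then must lie in the target. The join
  of two points connects an arbitrary point of the source to one where the morphism is nonzero.\<close>

lemma nonzero_morphism_truncated:
  fixes \<phi> :: "real^'d::finite \<Rightarrow> 'k::field \<Rightarrow> 'k"
  assumes \<phi>: "pmorphism (interval_pmod (truncated i b U)) (interval_pmod (truncated i b' U')) \<phi>"
    and nz: "x \<in> pspace (interval_pmod (truncated i b U)) p" "\<phi> p x \<noteq> 0"
    and U: "upset U" "upset U'"
  shows "b' \<le> b" and "truncated i b' (truncated i b U) \<subseteq> U'"
proof -
  let ?X = "truncated i b U" and ?Y = "truncated i b' U'"
  have "\<phi> p 0 = 0" using linear_btw_0[OF pmorphism_linear[OF \<phi>, of p]] by simp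
  with nz have pX: "p \<in> ?X" by (auto split: if_splits)
  have pY: "p \<in> ?Y" using pmorphism_in[OF \<phi> nz(1)] nz(2) by (auto split: if_splits)
  show "b' \<le> b"
  proof (rule ccontr)
    assume "\<not> b' \<le> b"
    define q where "q = (\<chi> k. if k = i then b else vec_nth p k)"
    have "p \<le> q" using pX by (auto simp: q_def less_eq_vec_def truncated_def)
    moreover have "vec_nth q i = b" by (simp add: q_def)
    ultimately have q: "q \<in> ?Y" "q \<notin> ?X"
      using pY upsetD[OF U(2)] \<open>\<not> b' \<le> b\<close> by (auto simp: truncated_def)
    have "\<phi> q 0 = 0" using linear_btw_0[OF pmorphism_linear[OF \<phi>, of q]] by simp
    then show False using pmorphism_natural[OF \<phi> \<open>p \<le> q\<close> nz(1)] q pX pY nz(2) by simp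
  qed
  show "truncated i b' ?X \<subseteq> U'"
  proof
    fix q assume q: "q \<in> truncated i b' ?X"
    let ?r = "vec_join p q"
    have r: "?r \<in> ?X" "?r \<in> ?Y"
      using truncated_join[OF U(1) pX, of q] upsetD[OF U(2), OF _ vec_join(1)[of p q]] pY q
      by (auto simp: truncated_def vec_join(3))
    have "\<phi> ?r x = \<phi> p x" using pmorphism_natural[OF \<phi> vec_join(1) nz(1), of q] pX pY r by simp
    show "q \<in> U'"
    proof (rule ccontr)
      assume "q \<notin> U'"
      then have "\<phi> q x = 0" using pmorphism_in[OF \<phi>, of x q] q by (simp add: truncated_def)
      moreover have "q \<in> ?X" using q by (simp add: truncated_def)
      ultimately have "\<phi> ?r x = 0"
        using pmorphism_natural[OF \<phi> vec_join(2)[of q p], of x] r \<open>q \<notin> U'\<close>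
        by (simp add: truncated_def)
      then show False using \<open>\<phi> ?r x = \<phi> p x\<close> nz(2) by simp
    qed
  qed
qed


section \<open>Staircases with prescribed distances\<close>

text \<open>The generators \<open>z\<close> of a staircase sit along the antidiagonal of the \<open>(i, j)\<close>-plane at
  position \<open>pos z\<close>, raised diagonally by \<open>h z\<close>. If the positions are far apart, then a staircase
  with heights \<open>h\<close> is contained in the \<open>t\<close>-shift of one with heights \<open>h'\<close> iff \<open>h' \<le> h + t\<close>.\<close>

definition staircase :: "'d \<Rightarrow> 'd \<Rightarrow> 'w set \<Rightarrow> ('w \<Rightarrow> real) \<Rightarrow> ('w \<Rightarrow> real) \<Rightarrow> (real^'d::finite) set" where
  "staircase i j W pos h =
     {p. \<exists>z\<in>W. pos z + h z \<le> vec_nth p i \<and> h z - pos z \<le> vec_nth p j}"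

lemma upset_staircase: "upset (staircase i j W pos h)"
  unfolding upset_def
proof (intro allI impI)
  fix p q assume "p \<le> q" "p \<in> staircase i j W pos h"
  then obtain z where "z \<in> W" "pos z + h z \<le> vec_nth p i" "h z - pos z \<le> vec_nth p j"
    by (auto simp: staircase_def)
  moreover have "vec_nth p i \<le> vec_nth q i" "vec_nth p j \<le> vec_nth q j"
    using \<open>p \<le> q\<close> by (simp_all add: less_eq_vec_def)
  ultimately have "z \<in> W \<and> pos z + h z \<le> vec_nth q i \<and> h z - pos z \<le> vec_nth q j" by linarith
  then show "q \<in> staircase i j W pos h" unfolding staircase_def by blast
qed

lemma staircase_subset_ishift:
  assumes "\<And>z. z \<in> W \<Longrightarrow> h' z \<le> h z + t"
  shows "staircase i j W pos h \<subseteq> ishift t (staircase i j W pos h')"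
proof
  fix p assume "p \<in> staircase i j W pos h"
  then obtain z where "z \<in> W" "pos z + h z \<le> vec_nth p i" "h z - pos z \<le> vec_nth p j"
    by (auto simp: staircase_def)
  with assms[of z] show "p \<in> ishift t (staircase i j W pos h')"
    by (auto simp: mem_ishift staircase_def diag_def intro!: bexI[of _ z])
qed

lemma staircase_generated_below:
  assumes "\<And>z. z \<in> W \<Longrightarrow> pos z + h z < b" and "i \<noteq> j"
  shows "generated_below i b (staircase i j W pos h)"
  unfolding generated_below_def
proof
  fix p assume "p \<in> staircase i j W pos h"
  then obtain z where z: "z \<in> W" "pos z + h z \<le> vec_nth p i" "h z - pos z \<le> vec_nth p j"
    by (auto simp: staircase_def)
  let ?q = "\<chi> k. if k = i then pos z + h z else vec_nth p k"
  have "?q \<in> truncated i b (staircase i j W pos h)"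
    using z assms by (auto simp: truncated_def staircase_def)
  moreover have "?q \<le> p" using z by (simp add: less_eq_vec_def)
  ultimately show "\<exists>q\<in>truncated i b (staircase i j W pos h). q \<le> p" by blast
qed

lemma staircase_separation:
  assumes "staircase i j W pos h \<subseteq> ishift t (staircase i j W pos h')"
    and "x \<in> W" "h x = 0" and "\<And>z. z \<in> W \<Longrightarrow> 0 \<le> h' z" and "i \<noteq> j"
    and gap: "\<And>z. z \<in> W \<Longrightarrow> z \<noteq> x \<Longrightarrow> t < \<bar>pos z - pos x\<bar>"
  shows "h' x \<le> t"
proof -
  let ?p = "\<chi> k. if k = i then pos x else - pos x"
  have "?p \<in> staircase i j W pos h"
    using assms(2,3,5) unfolding staircase_def by (intro CollectI bexI[of _ x]) simp_all
  then have "?p \<in> ishift t (staircase i j W pos h')" using assms(1) by blast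
  then obtain z where z: "z \<in> W" "pos z + h' z \<le> pos x + t" "h' z - pos z \<le> t - pos x"
    using \<open>i \<noteq> j\<close> by (auto simp: mem_ishift staircase_def diag_def)
  then have "\<bar>pos z - pos x\<bar> \<le> t" using assms(4)[of z] by (simp add: abs_le_iff)
  then have "z = x" using gap[OF z(1)] by (cases "z = x") auto
  then show ?thesis using z by simp
qed

text \<open>Consider a nonzero morphism between shifts by \<open>s\<close> and \<open>t\<close>. If \<open>t - s \<le> K\<close> then the
  generators of the source come before both cut-offs, and \<open>nonzero_morphism_truncated\<close> puts them
  into the upset of the target. If \<open>t - s > K\<close> then the bound \<open>K\<close> on the heights is enough for
  this.\<close>

lemma benign_staircases:
  fixes i j :: "'d::finite" and h :: "'a \<Rightarrow> 'w \<Rightarrow> real"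
  assumes "i \<noteq> j"
    and h: "\<And>x z. x \<in> V \<Longrightarrow> z \<in> W \<Longrightarrow> 0 \<le> h x z" "\<And>x z. x \<in> V \<Longrightarrow> z \<in> W \<Longrightarrow> h x z \<le> K"
    and b: "\<And>z. z \<in> W \<Longrightarrow> pos z + 2 * K < b" and "0 \<le> K"
  shows "benign TYPE('k::field) {ishift t (truncated i b (staircase i j W pos (h x))) | t x. x \<in> V}"
    (is "benign _ ?\<I>")
proof -
  let ?S = "\<lambda>x. staircase i j W pos (h x)"
  have shifted: "ishift t (truncated i b (?S x)) = truncated i (b - t) (ishift t (?S x))" for t x
    by (rule ishift_truncated)
  have up: "upset (ishift t (?S x))" for t x
    by (intro upset_ishift upset_staircase)
  have gen: "generated_below i (b - t) (ishift t (?S x))" if x: "x \<in> V" for t x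
    using h(2)[OF x] b \<open>0 \<le> K\<close>
    by (intro generated_below_ishift staircase_generated_below \<open>i \<noteq> j\<close>) (smt (verit))
  have main: "interval (I \<inter> J) \<and> interval_le I J"
    if I: "I = ishift s (truncated i b (?S x))" "x \<in> V" and J: "J = ishift t (truncated i b (?S y))" "y \<in> V"
      and \<phi>: "pmorphism (interval_pmod I) (interval_pmod J) \<phi>"
      and nz: "v \<in> pspace (interval_pmod I) p" "\<phi> p v \<noteq> (0 :: 'k)"
    for I J s t x y \<phi> p v
  proof
    show "interval (I \<inter> J)"
      unfolding I J shifted truncated_Int by (intro interval_truncated upset_Int up)
    have st: "b - t \<le> b - s"
      and sub: "truncated i (b - t) (truncated i (b - s) (ishift s (?S x))) \<subseteq> ishift t (?S y)"
      using nonzero_morphism_truncated[OF \<phi>[unfolded I J shifted] nz(1)[unfolded I shifted] nz(2) up up] by blast+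
    have "ishift s (?S x) \<subseteq> ishift t (?S y)"
    proof (cases "t - s \<le> K")
      case True
      show ?thesis
      proof
        fix p assume "p \<in> ishift s (?S x)"
        then obtain z where z: "z \<in> W" "pos z + h x z \<le> vec_nth p i + s" "h x z - pos z \<le> vec_nth p j + s"
          by (auto simp: mem_ishift staircase_def diag_def)
        let ?q = "\<chi> k. if k = i then pos z + h x z - s else vec_nth p k"
        have "?q \<in> truncated i (b - t) (truncated i (b - s) (ishift s (?S x)))"
          using z \<open>i \<noteq> j\<close> h(2)[OF \<open>x \<in> V\<close> z(1)] b[OF z(1)] st True \<open>0 \<le> K\<close>
          by (auto simp: truncated_def mem_ishift staircase_def diag_def)
        moreover have "?q \<le> p" using z by (simp add: less_eq_vec_def)
        ultimately show "p \<in> ishift t (?S y)" using sub upsetD[OF up] by blast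
      qed
    next
      case False
      have "?S x \<subseteq> ishift (t - s) (?S y)"
        using h(1)[OF \<open>x \<in> V\<close>] h(2)[OF \<open>y \<in> V\<close>] False
        by (intro staircase_subset_ishift) (smt (verit))
      then have "ishift s (?S x) \<subseteq> ishift s (ishift (t - s) (?S y))" by (auto simp: mem_ishift)
      then show ?thesis by simp
    qed
    then show "interval_le I J"
      unfolding I J shifted using st I J by (intro interval_le_truncatedI up gen)
  qed
  show ?thesis
    unfolding benign_def
  proof (intro conjI ballI allI impI)
    show "interval I" if "I \<in> ?\<I>" for I
      using that up by (auto simp: shifted intro!: interval_truncated)
    show "ishift t I \<in> ?\<I>" if I: "I \<in> ?\<I>" for I t
    proof -
      obtain s x where "I = ishift s (truncated i b (?S x))" "x \<in> V" using I by blast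
      then have "ishift t I = ishift (t + s) (truncated i b (?S x))" "x \<in> V" by simp_all
      then show ?thesis by blast
    qed
    fix I J assume IJ: "I \<in> ?\<I>" "J \<in> ?\<I>" and
      "\<exists>\<phi>. pmorphism (interval_pmod I :: ('k, 'k, 'd) pmod) (interval_pmod J) \<phi> \<and>
         (\<exists>p. \<exists>x\<in>pspace (interval_pmod I) p. \<phi> p x \<noteq> 0)"
    then obtain \<phi> p v where "pmorphism (interval_pmod I :: ('k, 'k, 'd) pmod) (interval_pmod J) \<phi>"
      "v \<in> pspace (interval_pmod I) p" "\<phi> p v \<noteq> (0 :: 'k)" by (elim exE conjE bexE)
    moreover obtain s x where "I = ishift s (truncated i b (?S x))" "x \<in> V" using IJ(1) by blast
    moreover obtain t y where "J = ishift t (truncated i b (?S y))" "y \<in> V" using IJ(2) by blast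
    ultimately show "interval (I \<inter> J)" "interval_le I J" using main by blast+
  qed
qed


section \<open>Direct sums of interval modules\<close>

locale independent_sequence = vector_space scale
  for scale :: "'k::field \<Rightarrow> 'v::ab_group_add \<Rightarrow> 'v" +
  fixes e :: "nat \<Rightarrow> 'v"
  assumes inj_e: "inj e" and independent_e: "independent (range e)"
begin

definition coord :: "nat \<Rightarrow> 'v \<Rightarrow> 'k" where
  "coord i x = representation (range e) x (e i)"

definition lincomb :: "nat set \<Rightarrow> (nat \<Rightarrow> 'k) \<Rightarrow> 'v" where
  "lincomb A f = (\<Sum>i\<in>A. scale (f i) (e i))"

abbreviation carrier :: "'v set" where
  "carrier \<equiv> span (range e)"

lemma e_in_carrier [simp]: "e i \<in> carrier"
  by (simp add: span_base)

lemma lincomb_in_carrier [simp]: "lincomb A f \<in> carrier"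
  by (simp add: lincomb_def span_sum span_scale)

lemma coord_0 [simp]: "coord i 0 = 0"
  by (simp add: coord_def representation_zero)

lemma coord_add: "x \<in> carrier \<Longrightarrow> y \<in> carrier \<Longrightarrow> coord i (x + y) = coord i x + coord i y"
  by (simp add: coord_def representation_add[OF independent_e])

lemma coord_scale: "x \<in> carrier \<Longrightarrow> coord i (scale a x) = a * coord i x"
  by (simp add: coord_def representation_scale[OF independent_e])

lemma coord_e: "coord i (e j) = of_bool (i = j)"
  using inj_e by (auto simp: coord_def representation_basis[OF independent_e] inj_eq)

lemma coord_sum:
  assumes "\<And>a. a \<in> A \<Longrightarrow> g a \<in> carrier"
  shows "coord i (\<Sum>a\<in>A. g a) = (\<Sum>a\<in>A. coord i (g a))"
  using assms
  by (induction A rule: infinite_finite_induct) (auto simp: coord_add span_sum)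

lemma coord_lincomb:
  assumes "finite A"
  shows "coord i (lincomb A f) = (if i \<in> A then f i else 0)"
proof -
  have "coord i (lincomb A f) = (\<Sum>j\<in>A. coord i (scale (f j) (e j)))"
    unfolding lincomb_def by (intro coord_sum) (simp add: span_scale)
  also have "\<dots> = (\<Sum>j\<in>A. if i = j then f j else 0)"
    by (intro sum.cong refl) (simp add: coord_scale coord_e)
  finally show ?thesis using assms by simp
qed

text \<open>All identities between the maps defined below are checked on coordinates with this rule.\<close>

lemma coord_eqI:
  assumes "x \<in> carrier" "y \<in> carrier" "\<And>i. coord i x = coord i y"
  shows "x = y"
proof -
  have "representation (range e) x = representation (range e) y"
  proof
    fix v
    show "representation (range e) x v = representation (range e) y v"
    proof (cases "v \<in> range e")
      case True
      then show ?thesis using assms(3) by (auto simp: coord_def)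
    next
      case False
      then show ?thesis using representation_ne_zero[of "range e" _ v] by metis
    qed
  qed
  then show ?thesis
    using sum_nonzero_representation_eq[OF independent_e assms(1)]
      sum_nonzero_representation_eq[OF independent_e assms(2)] by metis
qed

definition interval_sum :: "nat \<Rightarrow> (nat \<Rightarrow> (real^'d::finite) set) \<Rightarrow> ('k, 'v, 'd) pmod" where
  "interval_sum n I =
     \<lparr> pscale = scale,
       pspace = (\<lambda>p. {x \<in> carrier. \<forall>i. coord i x \<noteq> 0 \<longrightarrow> i < n \<and> p \<in> I i}),
       pmap = (\<lambda>p q x. lincomb {i. i < n \<and> q \<in> I i} (\<lambda>i. coord i x)) \<rparr>"

definition summand :: "(real^'d::finite) set \<Rightarrow> nat \<Rightarrow> ('k, 'v, 'd) pmod" where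
  "summand I i =
     \<lparr> pscale = scale,
       pspace = (\<lambda>p. if p \<in> I then range (\<lambda>a. scale a (e i)) else {0}),
       pmap = (\<lambda>p q x. if q \<in> I then x else 0) \<rparr>"

lemma interval_sum_sel [simp]:
  "pscale (interval_sum n I) = scale"
  "x \<in> pspace (interval_sum n I) p \<longleftrightarrow> x \<in> carrier \<and> (\<forall>i. coord i x \<noteq> 0 \<longrightarrow> i < n \<and> p \<in> I i)"
  "pmap (interval_sum n I) p q x = lincomb {i. i < n \<and> q \<in> I i} (\<lambda>i. coord i x)"
  by (simp_all add: interval_sum_def)

lemma summand_sel [simp]:
  "pscale (summand I i) = scale"
  "pspace (summand I i) p = (if p \<in> I then range (\<lambda>a. scale a (e i)) else {0})"
  "pmap (summand I i) p q x = (if q \<in> I then x else 0)"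
  by (simp_all add: summand_def)

lemma coord_pmap: "coord j (pmap (interval_sum n I) p q x) = (if j < n \<and> q \<in> I j then coord j x else 0)"
  by (simp add: coord_lincomb)

lemma pspace_lincomb [simp]:
  assumes "\<And>i. i \<in> A \<Longrightarrow> i < n \<and> p \<in> I i"
  shows "lincomb A f \<in> pspace (interval_sum n I) p"
proof -
  have "A \<subseteq> {..<n}" using assms by auto
  then have "finite A" by (rule finite_subset) simp
  then show ?thesis using assms by (auto simp: coord_lincomb)
qed

lemma subspace_interval_sum: "subspace (pspace (interval_sum n I) p)"
proof (rule subspaceI)
  show "0 \<in> pspace (interval_sum n I) p" by (simp add: span_zero)
  fix x y assume xy: "x \<in> pspace (interval_sum n I) p" "y \<in> pspace (interval_sum n I) p"
  then have "coord i (x + y) = coord i x + coord i y" for i by (simp add: coord_add)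
  with xy show "x + y \<in> pspace (interval_sum n I) p"
    by (simp add: span_add) (metis add.right_neutral)
next
  fix a x assume "x \<in> pspace (interval_sum n I) p"
  then show "scale a x \<in> pspace (interval_sum n I) p" by (auto simp: coord_scale span_scale)
qed

lemma lincomb_coord_linear:
  assumes "finite A" "\<And>j x y. x \<in> V \<Longrightarrow> y \<in> V \<Longrightarrow> f j (x + y) = f j x + f j y"
    and "\<And>j a x. x \<in> V \<Longrightarrow> f j (scale a x) = a * f j x"
    and "\<And>x. x \<in> V \<Longrightarrow> lincomb A (\<lambda>j. f j x) \<in> W"
  shows "linear_btw scale V scale W (\<lambda>x. lincomb A (\<lambda>j. f j x))"
  unfolding linear_btw_def
  using assms
  by (auto simp: lincomb_def scale_left_distrib sum.distrib scale_sum_right)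

lemma pmodule_interval_sum:
  fixes I :: "nat \<Rightarrow> (real^'d::finite) set"
  assumes "\<And>i. i < n \<Longrightarrow> interval (I i)"
  shows "pmodule (interval_sum n I)"
proof -
  let ?M = "interval_sum n I"
  have "linear_btw scale (pspace ?M p) scale (pspace ?M q) (pmap ?M p q)" for p q
    unfolding interval_sum_sel(3)
  proof (rule lincomb_coord_linear)
    show "lincomb {i. i < n \<and> q \<in> I i} (\<lambda>i. coord i x) \<in> pspace ?M q" for x
      by (rule pspace_lincomb) simp
  qed (auto simp: coord_add coord_scale)
  moreover have "pmap ?M p p x = x" if "x \<in> pspace ?M p" for p x
    using that by (intro coord_eqI) (auto simp: coord_lincomb)
  moreover have "pmap ?M q r (pmap ?M p q x) = pmap ?M p r x"
    if pqr: "p \<le> q" "q \<le> r" and x: "x \<in> pspace ?M p" for p q r x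
  proof -
    have "q \<in> I i" if "i < n" "p \<in> I i" "r \<in> I i" for i
      using interval_convex[OF assms[OF that(1)] pqr that(2,3)] .
    then show ?thesis using x by (intro coord_eqI) (auto simp: coord_lincomb)
  qed
  ultimately show ?thesis
    unfolding pmodule_def using subspace_interval_sum[of n I] vector_space_axioms
    by (simp del: interval_sum_sel(2,3))
qed

lemma pfd_interval_sum: "pfd (interval_sum n I)"
  unfolding pfd_def
proof
  fix p
  let ?A = "{i. i < n \<and> p \<in> I i}"
  have "span (e ` ?A) = pspace (interval_sum n I) p"
  proof
    show "span (e ` ?A) \<subseteq> pspace (interval_sum n I) p"
      by (rule span_minimal[OF _ subspace_interval_sum]) (auto simp: coord_e)
    show "pspace (interval_sum n I) p \<subseteq> span (e ` ?A)"
    proof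
      fix x assume "x \<in> pspace (interval_sum n I) p"
      then have "x = lincomb ?A (\<lambda>i. coord i x)" by (intro coord_eqI) (auto simp: coord_lincomb)
      also have "\<dots> \<in> span (e ` ?A)"
        unfolding lincomb_def by (intro span_sum span_scale span_base) auto
      finally show "x \<in> span (e ` ?A)" .
    qed
  qed
  then show "\<exists>S. finite S \<and> module.span (pscale (interval_sum n I)) S = pspace (interval_sum n I) p"
    by (intro exI[of _ "e ` ?A"]) simp
qed

lemma scale_e_eq_iff [simp]: "scale a (e i) = scale b (e i) \<longleftrightarrow> a = b"
proof
  assume "scale a (e i) = scale b (e i)"
  from arg_cong[OF this, of "coord i"] show "a = b" by (simp add: coord_scale coord_e)
qed simp

lemma subspace_summand: "subspace (pspace (summand I i) p)"
proof (cases "p \<in> I")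
  case True
  have "subspace (range (\<lambda>a. scale a (e i)))"
  proof (rule subspaceI)
    show "0 \<in> range (\<lambda>a. scale a (e i))" by (rule range_eqI[of _ _ 0]) simp
    fix x y assume "x \<in> range (\<lambda>a. scale a (e i))" "y \<in> range (\<lambda>a. scale a (e i))"
    then obtain a b where "x = scale a (e i)" "y = scale b (e i)" by blast
    then show "x + y \<in> range (\<lambda>a. scale a (e i))"
      by (intro range_eqI[of _ _ "a + b"]) (simp add: scale_left_distrib)
  next
    fix c x assume "x \<in> range (\<lambda>a. scale a (e i))"
    then obtain a where "x = scale a (e i)" by blast
    then show "scale c x \<in> range (\<lambda>a. scale a (e i))" by (intro range_eqI[of _ _ "c * a"]) simp
  qed
  with True show ?thesis by simp
qed simp

lemma submodule_summand:
  assumes "i < n" "interval (I i)"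
  shows "submodule (summand (I i) i) (interval_sum n I)"
proof -
  let ?Q = "summand (I i) i"
  have "linear_btw scale (pspace ?Q p) scale (pspace ?Q q) (pmap ?Q p q)" for p q
    by (auto simp: linear_btw_def intro: range_eqI[of _ _ 0])
  moreover have "pmap ?Q q r (pmap ?Q p q x) = pmap ?Q p r x"
    if "p \<le> q" "q \<le> r" "x \<in> pspace ?Q p" for p q r x
    using that interval_convex[OF assms(2) that(1,2)] by (auto split: if_splits)
  moreover have "pmap ?Q p p x = x" if "x \<in> pspace ?Q p" for p x
    using that by (auto split: if_splits)
  ultimately have "pmodule ?Q"
    unfolding pmodule_def using subspace_summand[of "I i" i] vector_space_axioms
    by (simp del: summand_sel(2))
  moreover have "pspace ?Q p \<subseteq> pspace (interval_sum n I) p" for p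
    using assms(1) by (auto simp: coord_scale coord_e span_scale span_zero)
  moreover have "pmap ?Q p q x = pmap (interval_sum n I) p q x" if "x \<in> pspace ?Q p" for p q x
    using that assms(1)
    by (intro coord_eqI) (auto simp: coord_lincomb coord_scale coord_e span_scale span_zero split: if_splits)
  ultimately show ?thesis by (simp add: submodule_def)
qed

lemma piso_summand: "piso (summand I i) (interval_pmod I :: ('k, 'k, 'd::finite) pmod)"
  unfolding piso_def
proof (intro exI conjI)
  show "pmorphism (summand I i) (interval_pmod I) (\<lambda>p. coord i)"
    by (auto simp: pmorphism_def linear_btw_def coord_add coord_scale coord_e span_scale)
  show "pmorphism (interval_pmod I) (summand I i) (\<lambda>p a. scale a (e i))"
    by (auto simp: pmorphism_def linear_btw_def scale_left_distrib)
qed (auto simp: coord_scale coord_e split: if_splits)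

lemma summand_inject:
  assumes "I \<noteq> {}" "summand I i = summand J j"
  shows "i = j"
proof -
  obtain p where "p \<in> I" using assms(1) by blast
  then have "e i \<in> pspace (summand J j) p"
    unfolding assms(2)[symmetric] using scale_one[of "e i"] by (auto intro: range_eqI[of _ _ 1])
  then obtain a where "e i = scale a (e j)" by (auto split: if_splits intro: that[of 0])
  from arg_cong[OF this, of "coord i"] show ?thesis
    by (simp add: coord_scale coord_e of_bool_def split: if_splits)
qed

lemma direct_sum_interval_sum:
  fixes I :: "nat \<Rightarrow> (real^'d::finite) set"
  assumes I: "\<And>i. i < n \<Longrightarrow> interval (I i) \<and> I i \<noteq> {}"
  shows "is_direct_sum (interval_sum n I) ((\<lambda>i. summand (I i) i) ` {..<n})"
proof -
  let ?Q = "\<lambda>i. summand (I i) i" and ?B = "(\<lambda>i. summand (I i) i) ` {..<n}"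
  have inj: "inj_on ?Q {..<n}"
    using I by (intro inj_onI) (metis lessThan_iff summand_inject)
  have decomposition: "is_decomposition ?B p x f \<longleftrightarrow>
      (\<forall>Q. f Q = (if Q \<in> ?B then scale (coord (the_inv_into {..<n} ?Q Q) x) (e (the_inv_into {..<n} ?Q Q)) else 0))"
    (is "?L \<longleftrightarrow> ?R")
    if x: "x \<in> pspace (interval_sum n I) p" for p x f
  proof -
    have inv: "the_inv_into {..<n} ?Q (?Q i) = i" if "i < n" for i
      using the_inv_into_f_f[OF inj] that by simp
    have R: "?R \<longleftrightarrow> (\<forall>i<n. f (?Q i) = scale (coord i x) (e i)) \<and> (\<forall>Q. Q \<notin> ?B \<longrightarrow> f Q = 0)"
      using inv by auto
    have L: "?L \<longleftrightarrow> (\<forall>i<n. f (?Q i) \<in> pspace (?Q i) p) \<and> (\<forall>Q. Q \<notin> ?B \<longrightarrow> f Q = 0) \<and> x = (\<Sum>i<n. f (?Q i))"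
      by (subst is_decomposition_finite) (auto simp: sum.reindex[OF inj])
    have "f (?Q i) = scale (coord i x) (e i)"
      if f: "\<And>j. j < n \<Longrightarrow> f (?Q j) \<in> pspace (?Q j) p" "x = (\<Sum>j<n. f (?Q j))" and i: "i < n" for i
    proof -
      have "\<exists>a. f (?Q j) = scale a (e j)" if "j < n" for j
        using f(1)[OF that] by (auto split: if_splits intro: exI[of _ 0])
      then obtain a where a: "\<And>j. j < n \<Longrightarrow> f (?Q j) = scale (a j) (e j)" by metis
      have "x = lincomb {..<n} a" using f(2) a by (simp add: lincomb_def)
      then show ?thesis using a[OF i] i by (simp add: coord_lincomb)
    qed
    moreover have "x = (\<Sum>i<n. f (?Q i)) \<and> (\<forall>i<n. f (?Q i) \<in> pspace (?Q i) p)"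
      if f: "\<And>i. i < n \<Longrightarrow> f (?Q i) = scale (coord i x) (e i)"
    proof
      have "x = lincomb {..<n} (\<lambda>i. coord i x)"
        using x by (intro coord_eqI) (auto simp: coord_lincomb)
      then show "x = (\<Sum>i<n. f (?Q i))" using f by (simp add: lincomb_def)
      show "\<forall>i<n. f (?Q i) \<in> pspace (?Q i) p"
      proof (intro allI impI)
        fix i assume "i < n"
        show "f (?Q i) \<in> pspace (?Q i) p"
          using f[OF \<open>i < n\<close>] x by (cases "coord i x = 0") auto
      qed
    qed
    ultimately show ?thesis unfolding L R by blast
  qed
  show ?thesis
    unfolding is_direct_sum_iff
  proof (intro conjI ballI allI)
    show "submodule Q (interval_sum n I)" if "Q \<in> ?B" for Q
      using that I submodule_summand by auto
    show "\<exists>!f. is_decomposition ?B p x f" if "x \<in> pspace (interval_sum n I) p" for p x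
      unfolding decomposition[OF that] fun_eq_iff[symmetric] by blast
  qed
qed

text \<open>Of two complementary subspaces of a line one is the whole line. If this were not the same
  one at \<open>p\<close> and at \<open>q\<close>, both would be the whole line at an upper bound of \<open>p\<close> and \<open>q\<close>.\<close>

lemma indecomposable_summand:
  fixes I :: "(real^'d::finite) set"
  assumes directed: "\<And>p q. p \<in> I \<Longrightarrow> q \<in> I \<Longrightarrow> \<exists>r\<in>I. p \<le> r \<and> q \<le> r"
  shows "indecomposable (summand I i)"
  unfolding indecomposable_def
proof (intro allI impI)
  fix Q R :: "('k, 'v, 'd) pmod"
  assume Q: "submodule Q (summand I i)" and R: "submodule R (summand I i)"
    and sum: "\<forall>p. pspace (summand I i) p = {y + z | y z. y \<in> pspace Q p \<and> z \<in> pspace R p} \<and>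
      pspace Q p \<inter> pspace R p = {0}"
  have full: "\<exists>p\<in>I. \<forall>r\<in>I. p \<le> r \<longrightarrow> e i \<in> pspace S r"
    if S: "submodule S (summand I i)" and "nonzero_pmod S" for S :: "('k, 'v, 'd) pmod"
  proof -
    obtain p where "pspace S p \<noteq> {0}" using \<open>nonzero_pmod S\<close> by (auto simp: nonzero_pmod_def)
    then obtain x where x: "x \<in> pspace S p" "x \<noteq> 0"
      using pmodule_zero[OF submodule_pmodule[OF S], of p] by blast
    with submodule_in[OF S x(1)] obtain a where p: "p \<in> I" and a: "x = scale a (e i)"
      by (auto split: if_splits)
    have "e i \<in> pspace S r" if r: "r \<in> I" "p \<le> r" for r
    proof -
      have "x \<in> pspace S r"
        using linear_btw_in[OF pmodule_linear[OF submodule_pmodule[OF S] r(2)] x(1)]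
          submodule_pmap[OF S r(2) x(1)] r(1) by simp
      moreover have "e i = scale (inverse a) x" using a x(2) by auto
      moreover have "subspace (pspace S r)"
        using pmodule_subspace[OF submodule_pmodule[OF S], of r] submodule_pscale[OF S] by simp
      ultimately show ?thesis by (simp add: subspace_scale)
    qed
    with p show ?thesis by blast
  qed
  show "\<not> nonzero_pmod Q \<or> \<not> nonzero_pmod R"
  proof (rule ccontr)
    assume "\<not> ?thesis"
    then obtain p q where "p \<in> I" "\<forall>r\<in>I. p \<le> r \<longrightarrow> e i \<in> pspace Q r" "q \<in> I" "\<forall>r\<in>I. q \<le> r \<longrightarrow> e i \<in> pspace R r"
      using full[OF Q] full[OF R] by blast
    with directed[of p q] obtain r where "e i \<in> pspace Q r \<inter> pspace R r" by blast
    then have "e i = 0" using sum by auto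
    then show False using coord_e[of i i] by simp
  qed
qed

lemma barcode_interval_sum:
  fixes I :: "nat \<Rightarrow> (real^'d::finite) set"
  assumes "\<And>i. i < n \<Longrightarrow> interval (I i) \<and> I i \<noteq> {}"
    and "\<And>i p q. i < n \<Longrightarrow> p \<in> I i \<Longrightarrow> q \<in> I i \<Longrightarrow> \<exists>r\<in>I i. p \<le> r \<and> q \<le> r"
  shows "is_barcode (interval_sum n I) ((\<lambda>i. summand (I i) i) ` {..<n})"
proof -
  have "nonzero_pmod (summand (I i) i)" if i: "i < n" for i
  proof -
    obtain p where p: "p \<in> I i" using assms(1)[OF i] by blast
    have "e i \<in> pspace (summand (I i) i) p" using p by (auto intro: range_eqI[of _ _ 1])
    moreover have "e i \<noteq> 0" using coord_e[of i i] by auto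
    ultimately have "pspace (summand (I i) i) p \<noteq> {0}" by blast
    then show ?thesis unfolding nonzero_pmod_def by blast
  qed
  moreover have "indecomposable (summand (I i) i)" if "i < n" for i
    using assms(2)[OF that] by (rule indecomposable_summand)
  moreover have "is_direct_sum (interval_sum n I) ((\<lambda>i. summand (I i) i) ` {..<n})"
    using assms(1) by (rule direct_sum_interval_sum)
  ultimately show ?thesis unfolding is_barcode_def by auto
qed

definition matrix_morphism ::
  "nat \<Rightarrow> real \<Rightarrow> (nat \<Rightarrow> (real^'d::finite) set) \<Rightarrow> (nat \<Rightarrow> nat \<Rightarrow> 'k) \<Rightarrow> real^'d \<Rightarrow> 'v \<Rightarrow> 'v" where
  "matrix_morphism n \<epsilon> J a p x = lincomb {j. j < n \<and> p + diag \<epsilon> \<in> J j} (\<lambda>j. \<Sum>i<n. a j i * coord i x)"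

text \<open>Naturality between \<open>p\<close> and \<open>q\<close> fails only if a coefficient of \<open>x\<close> dies before \<open>q\<close> in the source
  while its image is alive in the target, or if its image is born between \<open>p\<close> and \<open>q\<close>. A nonzero
  matrix entry excludes the former by \<open>interval_le_source\<close> and the latter by \<open>interval_le_target\<close>.\<close>

lemma pmorphism_matrix:
  assumes le: "\<And>i j. i < n \<Longrightarrow> j < n \<Longrightarrow> a j i \<noteq> 0 \<Longrightarrow> interval_le (I i) (ishift \<epsilon> (J j))"
    and shift: "\<And>j. j < n \<Longrightarrow> interval (ishift \<epsilon> (J j))"
  shows "pmorphism (interval_sum n I) (pshift \<epsilon> (interval_sum n J)) (matrix_morphism n \<epsilon> J a)"
proof -
  let ?M = "interval_sum n I" and ?N = "interval_sum n J"
  have "linear_btw scale (pspace ?M p) scale (pspace ?N (p + diag \<epsilon>)) (matrix_morphism n \<epsilon> J a p)" for p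
    unfolding matrix_morphism_def
  proof (rule lincomb_coord_linear)
    show "lincomb {j. j < n \<and> p + diag \<epsilon> \<in> J j} (\<lambda>j. \<Sum>i<n. a j i * coord i x) \<in> pspace ?N (p + diag \<epsilon>)" for x
      by (rule pspace_lincomb) simp
  qed (auto simp: coord_add coord_scale sum.distrib distrib_left sum_distrib_left mult.left_commute)
  moreover have "matrix_morphism n \<epsilon> J a q (pmap ?M p q x) =
      pmap ?N (p + diag \<epsilon>) (q + diag \<epsilon>) (matrix_morphism n \<epsilon> J a p x)"
    if pq: "p \<le> q" and x: "x \<in> pspace ?M p" for p q x
  proof (rule coord_eqI)
    fix j
    have "a j i * coord i (pmap ?M p q x) = (if p + diag \<epsilon> \<in> J j then a j i * coord i x else 0)"
      if j: "j < n" "q + diag \<epsilon> \<in> J j" and i: "i < n" for i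
    proof (cases "a j i \<noteq> 0 \<and> coord i x \<noteq> 0")
      case True
      then have "p \<in> I i" "interval_le (I i) (ishift \<epsilon> (J j))" using x le i j by auto
      then have "q \<in> I i" "p \<in> ishift \<epsilon> (J j)"
        using interval_le_source[of "I i" "ishift \<epsilon> (J j)" p q]
          interval_le_target[of "I i" "ishift \<epsilon> (J j)" p q] pq j shift by (auto simp: mem_ishift)
      then show ?thesis using i by (simp add: coord_lincomb mem_ishift)
    next
      case False
      then show ?thesis using i by (auto simp: coord_lincomb)
    qed
    then show "coord j (matrix_morphism n \<epsilon> J a q (pmap ?M p q x)) =
        coord j (pmap ?N (p + diag \<epsilon>) (q + diag \<epsilon>) (matrix_morphism n \<epsilon> J a p x))"
      unfolding coord_pmap matrix_morphism_def
      by (simp add: coord_lincomb del: interval_sum_sel(3))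
  qed (simp_all add: matrix_morphism_def)
  ultimately show ?thesis by (simp add: pmorphism_def)
qed

text \<open>As in \<open>represents_product\<close>, the full matrix product appears because all contributing
  intermediate summands are alive half-way.\<close>

lemma matrix_morphism_compose:
  assumes le: "\<And>i j. i < n \<Longrightarrow> j < n \<Longrightarrow> a j i \<noteq> 0 \<Longrightarrow> interval_le (I i) (ishift \<epsilon> (J j))"
    "\<And>i j. i < n \<Longrightarrow> j < n \<Longrightarrow> b i j \<noteq> 0 \<Longrightarrow> interval_le (J j) (ishift \<epsilon> (I i))"
    and ba: "\<And>i i'. i < n \<Longrightarrow> i' < n \<Longrightarrow> (\<Sum>j<n. b i' j * a j i) = of_bool (i' = i)"
    and x: "x \<in> pspace (interval_sum n I) p"
  shows "matrix_morphism n \<epsilon> I b (p + diag \<epsilon>) (matrix_morphism n \<epsilon> J a p x) =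
    pmap (interval_sum n I) p (p + diag (2 * \<epsilon>)) x"
proof (rule coord_eqI)
  fix i'
  have p2: "p + diag \<epsilon> + diag \<epsilon> = p + diag (2 * \<epsilon>)" by (simp flip: mult_2)
  have "(\<Sum>j<n. b i' j * coord j (matrix_morphism n \<epsilon> J a p x)) = coord i' x"
    if i': "i' < n" "p + diag (2 * \<epsilon>) \<in> I i'"
  proof -
    have "b i' j * coord j (matrix_morphism n \<epsilon> J a p x) = (\<Sum>i<n. b i' j * a j i * coord i x)"
      if j: "j < n" for j
    proof (cases "p + diag \<epsilon> \<in> J j")
      case True
      then show ?thesis using j by (simp add: matrix_morphism_def coord_lincomb sum_distrib_left mult.assoc)
    next
      case False
      have "b i' j * a j i * coord i x = 0" if "i < n" for i
      proof (rule ccontr)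
        assume "b i' j * a j i * coord i x \<noteq> 0"
        then have nz: "b i' j \<noteq> 0" "a j i \<noteq> 0" "coord i x \<noteq> 0" by auto
        have "p \<in> I i" using x nz by simp
        then have "p \<in> ishift \<epsilon> (J j)"
          using interval_le_between[OF le(1)[OF that j nz(2)] interval_le_ishift[OF le(2)[OF i'(1) j nz(1)]], of p]
            i'(2) by (simp add: mem_ishift)
        then show False using False by (simp add: mem_ishift)
      qed
      then have "(\<Sum>i<n. b i' j * a j i * coord i x) = 0" by (intro sum.neutral ballI) simp
      then show ?thesis using False j by (simp add: matrix_morphism_def coord_lincomb)
    qed
    then have "(\<Sum>j<n. b i' j * coord j (matrix_morphism n \<epsilon> J a p x)) =
        (\<Sum>j<n. \<Sum>i<n. b i' j * a j i * coord i x)" by simp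
    also have "\<dots> = (\<Sum>i<n. (\<Sum>j<n. b i' j * a j i) * coord i x)"
      by (subst sum.swap) (simp add: sum_distrib_right)
    also have "\<dots> = (\<Sum>i<n. if i = i' then coord i x else 0)"
      using ba i'(1) by (intro sum.cong) auto
    finally show ?thesis using i'(1) by simp
  qed
  then show "coord i' (matrix_morphism n \<epsilon> I b (p + diag \<epsilon>) (matrix_morphism n \<epsilon> J a p x)) =
      coord i' (pmap (interval_sum n I) p (p + diag (2 * \<epsilon>)) x)"
    unfolding coord_pmap by (subst matrix_morphism_def) (simp add: coord_lincomb p2 del: add_diag_diag)
qed (simp_all add: matrix_morphism_def)

lemma interleaved_interval_sum:
  fixes a b :: "nat \<Rightarrow> nat \<Rightarrow> 'k"
  assumes "\<And>i. i < n \<Longrightarrow> interval (ishift \<epsilon> (I i))"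
    "\<And>j. j < n \<Longrightarrow> interval (ishift \<epsilon> (J j))"
    and le: "\<And>i j. i < n \<Longrightarrow> j < n \<Longrightarrow> a j i \<noteq> 0 \<Longrightarrow> interval_le (I i) (ishift \<epsilon> (J j))"
    "\<And>i j. i < n \<Longrightarrow> j < n \<Longrightarrow> b i j \<noteq> 0 \<Longrightarrow> interval_le (J j) (ishift \<epsilon> (I i))"
    and inverse: "\<And>i i'. i < n \<Longrightarrow> i' < n \<Longrightarrow> (\<Sum>j<n. b i' j * a j i) = of_bool (i' = i)"
    "\<And>j j'. j < n \<Longrightarrow> j' < n \<Longrightarrow> (\<Sum>i<n. a j' i * b i j) = of_bool (j' = j)"
  shows "interleaved \<epsilon> (interval_sum n I) (interval_sum n J)"
  unfolding interleaved_def
proof (intro exI conjI allI ballI)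
  show "pmorphism (interval_sum n I) (pshift \<epsilon> (interval_sum n J)) (matrix_morphism n \<epsilon> J a)"
    using assms(2) le(1) by (intro pmorphism_matrix) auto
  show "pmorphism (interval_sum n J) (pshift \<epsilon> (interval_sum n I)) (matrix_morphism n \<epsilon> I b)"
    using assms(1) le(2) by (intro pmorphism_matrix) auto
  show "matrix_morphism n \<epsilon> I b (p + diag \<epsilon>) (matrix_morphism n \<epsilon> J a p x) =
      pmap (interval_sum n I) p (p + diag (2 * \<epsilon>)) x" if "x \<in> pspace (interval_sum n I) p" for p x
    using le inverse(1) that by (intro matrix_morphism_compose) auto
  show "matrix_morphism n \<epsilon> J a (p + diag \<epsilon>) (matrix_morphism n \<epsilon> I b p x) =
      pmap (interval_sum n J) p (p + diag (2 * \<epsilon>)) x" if "x \<in> pspace (interval_sum n J) p" for p x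
    using le inverse(2) that by (intro matrix_morphism_compose) auto
qed

end


section \<open>From matchings to CI problems\<close>

definition capped_dist :: "('w \<times> 'w) set \<Rightarrow> nat \<Rightarrow> 'w \<Rightarrow> 'w \<Rightarrow> nat" where
  "capped_dist G K x y = (LEAST l. l = K \<or> (x, y) \<in> G ^^ l)"

lemma capped_dist_le: "l = K \<or> (x, y) \<in> G ^^ l \<Longrightarrow> capped_dist G K x y \<le> l"
  unfolding capped_dist_def by (rule Least_le)

lemma capped_dist_cases: "capped_dist G K x y = K \<or> (x, y) \<in> G ^^ capped_dist G K x y"
  unfolding capped_dist_def by (rule LeastI[of _ K]) simp

lemma capped_dist_refl: "capped_dist G K x x = 0"
  using capped_dist_le[of 0 K x x G] by simp

lemma capped_dist_step:
  assumes "(y, z) \<in> G"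
  shows "capped_dist G K x z \<le> capped_dist G K x y + 1"
  using capped_dist_cases[of G K x y]
proof
  assume "capped_dist G K x y = K"
  then show ?thesis using capped_dist_le[of K K x z G] by simp
next
  assume "(x, y) \<in> G ^^ capped_dist G K x y"
  then have "(x, z) \<in> G ^^ (capped_dist G K x y + 1)" using assms by auto
  then show ?thesis by (intro capped_dist_le) simp
qed

lemma odd_walk_ci_graph:
  assumes "(x, y) \<in> ci_graph n \<P> ^^ l"
  shows "odd l \<longleftrightarrow> x \<in> range U_vertex \<longleftrightarrow> y \<notin> range U_vertex"
  using assms
proof (induction l arbitrary: y)
  case (Suc l)
  then obtain z where z: "(x, z) \<in> ci_graph n \<P> ^^ l" "(z, y) \<in> ci_graph n \<P>" by auto
  have "z \<in> range U_vertex \<longleftrightarrow> y \<notin> range U_vertex"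
    using z(2) by (cases \<P>) auto
  with Suc.IH[OF z(1)] show ?case by auto
qed simp

lemma floor_odd_ge: "odd l \<Longrightarrow> real l \<le> c \<Longrightarrow> l \<le> floor_odd c"
  unfolding floor_odd_def by (rule Greatest_le_nat[where b = "nat \<lceil>c\<rceil>"]) (auto simp: le_nat_iff, linarith)

lemma floor_odd_le: "1 \<le> c \<Longrightarrow> real (floor_odd c) \<le> c"
proof -
  assume "1 \<le> c"
  have "odd (floor_odd c) \<and> real (floor_odd c) \<le> c"
    unfolding floor_odd_def
    by (rule GreatestI_nat[where k = 1 and b = "nat \<lceil>c\<rceil>"]) (use \<open>1 \<le> c\<close> in \<open>auto simp: le_nat_iff\<close>, linarith)
  then show ?thesis ..
qed

text \<open>The composition of the two morphisms is nonzero on a surviving interval, hence so are both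
  morphisms. In a benign set nonzero morphisms are comparisons.\<close>

lemma interleaved_imp_interval_le:
  fixes I J :: "(real^'d::finite) set"
  assumes benign: "benign TYPE('k::field) \<I>" and IJ: "I \<in> \<I>" "J \<in> \<I>"
    and survives: "I \<inter> ishift (2 * c) I \<noteq> {}"
    and int: "interleaved c (interval_pmod I :: ('k, 'k, 'd) pmod) (interval_pmod J)"
  shows "interval_le I (ishift c J)" "interval_le J (ishift c I)"
proof -
  obtain \<phi> \<psi> where \<phi>: "pmorphism (interval_pmod I) (pshift c (interval_pmod J)) \<phi>"
    and \<psi>: "pmorphism (interval_pmod J) (pshift c (interval_pmod I)) \<psi>"
    and \<psi>\<phi>: "\<forall>p. \<forall>x\<in>pspace (interval_pmod I :: ('k, 'k, 'd) pmod) p.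
      \<psi> (p + diag c) (\<phi> p x) = pmap (interval_pmod I) p (p + diag (2 * c)) x"
    using int unfolding interleaved_def by (elim exE conjE)
  obtain p where p: "p \<in> I" "p + diag (2 * c) \<in> I" using survives by (auto simp: mem_ishift)
  let ?y = "\<phi> p (1 :: 'k)"
  have y: "?y \<in> pspace (interval_pmod J) (p + diag c)" using pmorphism_in[OF \<phi>, of 1 p] p by simp
  have \<psi>y: "\<psi> (p + diag c) ?y = 1" using \<psi>\<phi> p by simp
  have "\<psi> (p + diag c) 0 = 0" using linear_btw_0[OF pmorphism_linear[OF \<psi>, of "p + diag c"]] by simp
  with \<psi>y have "?y \<noteq> 0" by auto
  have nonzero: "interval_le K (ishift c L)"
    if "K \<in> \<I>" "L \<in> \<I>" "pmorphism (interval_pmod K) (pshift c (interval_pmod L)) f"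
      "x \<in> pspace (interval_pmod K :: ('k, 'k, 'd) pmod) q" "f q x \<noteq> (0 :: 'k)" for K L f q x
    using benign that benign_ishift[OF benign that(2), of c]
    unfolding benign_def pshift_interval_pmod by blast
  show "interval_le I (ishift c J)" using nonzero[OF IJ \<phi>, of 1 p] p \<open>?y \<noteq> 0\<close> by simp
  show "interval_le J (ishift c I)" using nonzero[OF IJ(2,1) \<psi> y] \<psi>y by simp
qed

definition matching_property ::
  "'k::field itself \<Rightarrow> 'v::ab_group_add itself \<Rightarrow> 'd::finite itself \<Rightarrow> real \<Rightarrow> bool" where
  "matching_property _ _ _ c \<longleftrightarrow>
     (\<forall>(\<I> :: (real^'d) set set) (\<epsilon> :: real)
        (M :: ('k, 'v, 'd) pmod) (N :: ('k, 'v, 'd) pmod) \<B> \<C>.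
        benign TYPE('k) \<I> \<longrightarrow> \<epsilon> \<ge> 0 \<longrightarrow>
        pmodule M \<longrightarrow> pfd M \<longrightarrow> pmodule N \<longrightarrow> pfd N \<longrightarrow>
        interleaved \<epsilon> M N \<longrightarrow>
        is_barcode M \<B> \<longrightarrow> is_barcode N \<C> \<longrightarrow>
        finite \<B> \<longrightarrow> finite \<C> \<longrightarrow>
        (\<forall>Q \<in> \<B> \<union> \<C>. \<exists>I\<in>\<I>. piso Q (interval_pmod I :: ('k, 'k, 'd) pmod)) \<longrightarrow>
        (\<exists>\<B>' \<C>' \<sigma>. is_matching (c * \<epsilon>) \<B> \<C> \<B>' \<C>' \<sigma>))"

text \<open>A summand surviving a step of \<open>2 * c\<close> is not \<open>c\<close>-interleaved with zero. If this holds for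
  all summands then a \<open>c\<close>-matching cannot leave any of them out.\<close>

lemma matching_property_interval_families:
  fixes I J :: "nat \<Rightarrow> (real^'d::finite) set" and a b :: "nat \<Rightarrow> nat \<Rightarrow> 'k::field"
  assumes matching: "matching_property TYPE('k) TYPE('v::ab_group_add) TYPE('d) c" and "0 \<le> c"
    and universe: "pfd_universe TYPE('k) TYPE('v)"
    and benign: "benign TYPE('k) \<I>"
    and I: "\<And>i. i < n \<Longrightarrow> I i \<in> \<I>" and J: "\<And>j. j < n \<Longrightarrow> J j \<in> \<I>"
    and directed: "\<And>i p q. i < n \<Longrightarrow> p \<in> I i \<Longrightarrow> q \<in> I i \<Longrightarrow> \<exists>r\<in>I i. p \<le> r \<and> q \<le> r"
      "\<And>j p q. j < n \<Longrightarrow> p \<in> J j \<Longrightarrow> q \<in> J j \<Longrightarrow> \<exists>r\<in>J j. p \<le> r \<and> q \<le> r"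
    and survives: "\<And>i. i < n \<Longrightarrow> I i \<inter> ishift (2 * c) (I i) \<noteq> {}" "\<And>j. j < n \<Longrightarrow> J j \<inter> ishift (2 * c) (J j) \<noteq> {}"
    and le: "\<And>i j. i < n \<Longrightarrow> j < n \<Longrightarrow> a j i \<noteq> 0 \<Longrightarrow> interval_le (I i) (ishift 1 (J j))"
    "\<And>i j. i < n \<Longrightarrow> j < n \<Longrightarrow> b i j \<noteq> 0 \<Longrightarrow> interval_le (J j) (ishift 1 (I i))"
    and inverse: "\<And>i i'. i < n \<Longrightarrow> i' < n \<Longrightarrow> (\<Sum>j<n. b i' j * a j i) = of_bool (i' = i)"
    "\<And>j j'. j < n \<Longrightarrow> j' < n \<Longrightarrow> (\<Sum>i<n. a j' i * b i j) = of_bool (j' = j)"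
  shows "\<exists>\<tau>. bij_betw \<tau> {..<n} {..<n} \<and>
    (\<forall>i<n. interval_le (I i) (ishift c (J (\<tau> i))) \<and> interval_le (J (\<tau> i)) (ishift c (I i)))"
proof -
  obtain s :: "'k \<Rightarrow> 'v \<Rightarrow> 'v" and S where s: "vector_space s" "infinite S" "\<not> module.dependent s S"
    using universe unfolding pfd_universe_def by blast
  interpret vector_space s by fact
  obtain e :: "nat \<Rightarrow> 'v" where e: "inj e" "range e \<subseteq> S"
    using infinite_countable_subset[OF s(2)] by blast
  interpret independent_sequence s e
    using e(1) independent_mono[OF s(3) e(2)] by unfold_locales
  let ?M = "interval_sum n I" and ?N = "interval_sum n J"
  let ?Q = "\<lambda>i. summand (I i) i" and ?R = "\<lambda>j. summand (J j) j"
  let ?B = "?Q ` {..<n}" and ?C = "?R ` {..<n}"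
  have int: "interval K" "interval (ishift t K)" if "K \<in> \<I>" for K t
    using that benign_interval[OF benign] benign_ishift[OF benign] by blast+
  have nonempty: "I i \<noteq> {}" "J i \<noteq> {}" if "i < n" for i
    using survives that by blast+
  have "interleaved 1 ?M ?N"
    using I J int le inverse by (intro interleaved_interval_sum[where a = a and b = b]) auto
  moreover have "is_barcode ?M ?B" "is_barcode ?N ?C"
    using I J int nonempty directed by (auto intro!: barcode_interval_sum)
  moreover have "pmodule ?M" "pmodule ?N" "pfd ?M" "pfd ?N"
    using I J int by (auto intro!: pmodule_interval_sum pfd_interval_sum)
  moreover have "\<forall>Q \<in> ?B \<union> ?C. \<exists>K\<in>\<I>. piso Q (interval_pmod K :: ('k, 'k, 'd) pmod)"
    using I J piso_summand by blast
  ultimately have "\<exists>\<B>' \<C>' \<sigma>. is_matching (c * 1) ?B ?C \<B>' \<C>' \<sigma>"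
    using matching[unfolded matching_property_def, rule_format, OF benign, of 1 ?M ?N ?B ?C] by simp
  then obtain \<B>' \<C>' \<sigma> where \<sigma>: "is_matching c ?B ?C \<B>' \<C>' \<sigma>" by auto
  have not_zero: "\<not> interleaved c (summand K i) (zero_pmod :: ('k, 'k, 'd) pmod)"
    if "K \<inter> ishift (2 * c) K \<noteq> {}" for K :: "(real^'d) set" and i
    using interleaved_piso[OF piso_sym[OF piso_summand] piso_refl _ \<open>0 \<le> c\<close>]
      interleaved_zero_interval[of c K] that by blast
  have "?Q i \<in> \<B>'" if i: "i < n" for i
  proof (rule ccontr)
    assume "?Q i \<notin> \<B>'"
    then have "interleaved c (?Q i) (zero_pmod :: ('k, 'k, 'd) pmod)"
      using \<sigma> i unfolding is_matching_def by simp
    with not_zero[OF survives(1)[OF i], of i] show False by simp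
  qed
  moreover have "?R j \<in> \<C>'" if j: "j < n" for j
  proof (rule ccontr)
    assume "?R j \<notin> \<C>'"
    then have "interleaved c (?R j) (zero_pmod :: ('k, 'k, 'd) pmod)"
      using \<sigma> j unfolding is_matching_def by simp
    with not_zero[OF survives(2)[OF j], of j] show False by simp
  qed
  moreover have "\<B>' \<subseteq> ?B" "\<C>' \<subseteq> ?C" using \<sigma> unfolding is_matching_def by simp_all
  ultimately have "\<B>' = ?B" "\<C>' = ?C" by (auto simp only: set_eq_subset image_subset_iff lessThan_iff)
  then have bij: "bij_betw \<sigma> ?B ?C" and close: "\<And>i. i < n \<Longrightarrow> interleaved c (?Q i) (\<sigma> (?Q i))"
    using \<sigma> unfolding is_matching_def by auto
  have inj: "inj_on ?Q {..<n}" "inj_on ?R {..<n}"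
    using nonempty by (intro inj_onI; metis lessThan_iff summand_inject)+
  define \<tau> where "\<tau> = the_inv_into {..<n} ?R \<circ> (\<sigma> \<circ> ?Q)"
  have \<tau>_bij: "bij_betw \<tau> {..<n} {..<n}"
    unfolding \<tau>_def
    using bij_betw_trans[OF bij_betw_trans[OF bij_betw_imageI[OF inj(1) refl] bij]
        bij_betw_the_inv_into[OF bij_betw_imageI[OF inj(2) refl]]] .
  have \<tau>: "\<sigma> (?Q i) = ?R (\<tau> i)" if "i < n" for i
    using bij_betw_apply[OF bij, of "?Q i"] that f_the_inv_into_f[OF inj(2), of "\<sigma> (?Q i)"]
    by (simp add: \<tau>_def)
  have "interval_le (I i) (ishift c (J (\<tau> i))) \<and> interval_le (J (\<tau> i)) (ishift c (I i))" if i: "i < n" for i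
  proof -
    have "\<tau> i < n" using bij_betw_apply[OF \<tau>_bij, of i] i by simp
    have "interleaved c (interval_pmod (I i) :: ('k, 'k, 'd) pmod) (interval_pmod (J (\<tau> i)))"
      using interleaved_piso[OF piso_sym[OF piso_summand] piso_sym[OF piso_summand] close[OF i, unfolded \<tau>[OF i]] \<open>0 \<le> c\<close>] .
    from interleaved_imp_interval_le[OF benign I[OF i] J[OF \<open>\<tau> i < n\<close>] survives(1)[OF i] this]
    show ?thesis by blast
  qed
  with \<tau>_bij show ?thesis by blast
qed

text \<open>The vertex \<open>x\<close> becomes a staircase whose height at \<open>z\<close> is the distance from \<open>z\<close> to \<open>x\<close> in
  the graph. An edge from \<open>x\<close> to \<open>y\<close> increases no distance by more than \<open>1\<close>, so the staircase of
  \<open>x\<close> lies in the \<open>1\<close>-shift of that of \<open>y\<close> and the given solution is a \<open>1\<close>-interleaving.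
  Conversely, the step at \<open>x\<close> itself has height \<open>0\<close> in the staircase of \<open>x\<close> and height the
  distance from \<open>x\<close> to \<open>y\<close> in that of \<open>y\<close>, so a morphism of degree \<open>c\<close> bounds this distance by
  \<open>c\<close>. Distances between the two sides of the graph are odd.\<close>

lemma matching_property_imp_ci_property:
  fixes c :: real
  assumes dim: "CARD('d::finite) \<ge> 2" and universe: "pfd_universe TYPE('k::field) TYPE('v::ab_group_add)"
    and "1 \<le> c" and matching: "matching_property TYPE('k) TYPE('v) TYPE('d) c"
  shows "ci_property TYPE('k) (floor_odd c)"
  unfolding ci_property_def
proof (intro allI impI)
  fix n \<P> assume "\<exists>(A :: 'k mat) B. ci_solution n \<P> A B"
  then obtain A B :: "'k mat" and P Q where \<P>: "\<P> = (P, Q)" and sol: "ci_solution n (P, Q) A B"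
    by (cases \<P>) blast
  then have carrier: "A \<in> carrier_mat n n" "B \<in> carrier_mat n n" and AB: "A * B = 1\<^sub>m n"
    by simp_all
  have A: "P $$ (j, i)" if "i < n" "j < n" "A $$ (j, i) \<noteq> 0" for i j
    using sol that by auto
  have B: "Q $$ (i, j)" if "i < n" "j < n" "B $$ (i, j) \<noteq> 0" for i j
    using sol that by auto
  have BA: "B * A = 1\<^sub>m n" using mat_mult_left_right_inverse[OF carrier AB] .
  obtain i0 j0 :: 'd where "i0 \<noteq> j0"
    using dim card_le_Suc0_iff_eq[of "UNIV :: 'd set"] by fastforce
  define G where "G = ci_graph n \<P>"
  \<comment> \<open>Capping distances at some \<open>K > c\<close> gives finite heights also between unconnected vertices, and
     a walk for every distance that is at most \<open>c\<close>.\<close>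
  define K where "K = nat \<lceil>c\<rceil> + 1"
  have K: "c < real K" using \<open>1 \<le> c\<close> by (simp add: K_def) linarith
  define W where "W = U_vertex ` {..<n} \<union> V_vertex ` {..<n}"
  \<comment> \<open>Different positions have distance at least \<open>K + 1 > c\<close>, too far for a shift by \<open>c\<close> to
     move a step above another one.\<close>
  define slot where "slot x = (case x of U_vertex i \<Rightarrow> 2 * i | V_vertex j \<Rightarrow> 2 * j + 1)" for x
  define pos where "pos x = (real K + 1) * real (slot x)" for x
  \<comment> \<open>The largest position is \<open>(K + 1) * (2 * n - 1)\<close>. There is room for \<open>2 * K\<close> above it: for a height
     and a shift by at most \<open>K\<close> in the proof of benignity, and for the survival of a shift by \<open>2 * c\<close>.\<close>
  define b where "b = (real K + 1) * (2 * real n + 2)"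
  define h where "h x z = real (capped_dist G K z x)" for x z
  define S :: "ci_vertex \<Rightarrow> (real^'d) set" where "S x = staircase i0 j0 W pos (h x)" for x
  define T where "T x = truncated i0 b (S x)" for x
  have h: "0 \<le> h x z" "h x z \<le> real K" for x z
    using capped_dist_le[of K K z x G] by (simp_all add: h_def)
  have pos: "pos z + 2 * real K < b" if "z \<in> W" for z
  proof -
    have "slot z + 1 \<le> 2 * n" using that by (auto simp: W_def slot_def)
    then have "real (slot z) + 2 < 2 * real n + 2" by linarith
    then have "(real K + 1) * (real (slot z) + 2) < (real K + 1) * (2 * real n + 2)"
      by (intro mult_strict_left_mono) auto
    then show ?thesis by (simp add: pos_def b_def algebra_simps)
  qed
  have gap: "c < \<bar>pos z - pos x\<bar>" if "z \<noteq> x" for z x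
  proof -
    have "slot z \<noteq> slot x"
      using that by (cases z; cases x) (auto simp: slot_def, presburger+)
    then have "1 \<le> \<bar>real (slot z) - real (slot x)\<bar>" by linarith
    then have "(real K + 1) * 1 \<le> (real K + 1) * \<bar>real (slot z) - real (slot x)\<bar>"
      by (intro mult_left_mono) auto
    also have "\<dots> = \<bar>pos z - pos x\<bar>"
      by (simp add: pos_def abs_mult flip: right_diff_distrib)
    finally show ?thesis using K by simp
  qed
  define \<I> where "\<I> = {ishift t (T x) | t x. x \<in> W}"
  have benign: "benign TYPE('k) \<I>"
    unfolding \<I>_def T_def S_def using h pos \<open>i0 \<noteq> j0\<close> by (intro benign_staircases[where K = "real K"]) auto
  have T\<I>: "T x \<in> \<I>" if "x \<in> W" for x
    using that unfolding \<I>_def by (intro CollectI exI[of _ 0] exI[of _ x]) simp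
  have S: "upset (S x)" "generated_below i0 b (S x)" for x
    unfolding S_def using h[of x] pos \<open>i0 \<noteq> j0\<close>
    by (auto intro!: upset_staircase staircase_generated_below) (smt (verit))
  have directed: "\<exists>r\<in>T x. p \<le> r \<and> q \<le> r" if "p \<in> T x" "q \<in> T x" for x p q
    using truncated_join[OF S(1)] vec_join(1,2) that unfolding T_def by blast
  have survives: "T x \<inter> ishift (2 * c) (T x) \<noteq> {}" if x: "x \<in> W" for x
  proof -
    let ?p = "\<chi> k. if k = i0 then pos x else - pos x"
    have "?p \<in> S x"
      unfolding S_def staircase_def using x \<open>i0 \<noteq> j0\<close>
      by (intro CollectI bexI[of _ x]) (simp_all add: h_def capped_dist_refl)
    moreover from this have "?p + diag (2 * c) \<in> S x"
      using upsetD[OF S(1)] le_add_diag[of "2 * c" ?p] \<open>1 \<le> c\<close> by simp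
    ultimately have "?p \<in> T x \<inter> ishift (2 * c) (T x)"
      using pos[OF x] K \<open>1 \<le> c\<close> by (simp add: T_def truncated_def mem_ishift) (simp add: diag_def)
    then show ?thesis by blast
  qed
  have edge: "interval_le (T x) (ishift 1 (T y))" if "(x, y) \<in> G" for x y
  proof -
    have "h y z \<le> h x z + 1" for z
      using capped_dist_step[OF that, of K z] by (simp add: h_def)
    then show ?thesis
      unfolding T_def
      by (subst interval_le_truncated_ishift_iff[OF S S]) (simp_all add: S_def staircase_subset_ishift)
  qed
  have walk: "\<exists>l\<le>floor_odd c. (x, y) \<in> G ^^ l"
    if "interval_le (T x) (ishift c (T y))" and x: "x \<in> W"
      and sides: "x \<in> range U_vertex \<longleftrightarrow> y \<notin> range U_vertex" for x y
  proof -
    have "S x \<subseteq> ishift c (S y)"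
      using that(1) \<open>1 \<le> c\<close> unfolding T_def
      by (subst (asm) interval_le_truncated_ishift_iff[OF S S]) simp_all
    then have "h y x \<le> c"
      unfolding S_def
    proof (rule staircase_separation)
      show "h x x = 0" by (simp add: h_def capped_dist_refl)
      show "0 \<le> h y z" for z by (rule h(1))
      show "c < \<bar>pos z - pos x\<bar>" if "z \<noteq> x" for z using that by (rule gap)
    qed (fact x \<open>i0 \<noteq> j0\<close>)+
    then have l: "real (capped_dist G K x y) \<le> c" by (simp add: h_def)
    then have path: "(x, y) \<in> G ^^ capped_dist G K x y"
      using capped_dist_cases[of G K x y] K by auto
    then have "odd (capped_dist G K x y)"
      using odd_walk_ci_graph[where n = n and \<P> = \<P>, folded G_def] sides by blast
    from floor_odd_ge[OF this l] path show ?thesis by blast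
  qed
  let ?I = "\<lambda>i. T (U_vertex i)" and ?J = "\<lambda>j. T (V_vertex j)"
  have W: "U_vertex i \<in> W" "V_vertex i \<in> W" if "i < n" for i
    using that by (auto simp: W_def)
  have product: "(\<Sum>j<n. X $$ (i', j) * Y $$ (j, i)) = of_bool (i' = i)"
    if "X \<in> carrier_mat n n" "Y \<in> carrier_mat n n" "X * Y = 1\<^sub>m n" "i < n" "i' < n" for X Y :: "'k mat" and i i'
  proof -
    have "(\<Sum>j<n. X $$ (i', j) * Y $$ (j, i)) = (X * Y) $$ (i', i)"
      using that(1,2,4,5) by (simp add: scalar_prod_def atLeast0LessThan)
    then show ?thesis using that by simp
  qed
  have "\<exists>\<tau>. bij_betw \<tau> {..<n} {..<n} \<and>
      (\<forall>i<n. interval_le (?I i) (ishift c (?J (\<tau> i))) \<and> interval_le (?J (\<tau> i)) (ishift c (?I i)))"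
  proof (rule matching_property_interval_families[OF matching _ universe benign,
        where a = "\<lambda>j i. A $$ (j, i)" and b = "\<lambda>i j. B $$ (i, j)"])
    show "interval_le (?I i) (ishift 1 (?J j))" if "i < n" "j < n" "A $$ (j, i) \<noteq> 0" for i j
      using A[OF that] that by (intro edge) (simp add: G_def \<P>)
    show "interval_le (?J j) (ishift 1 (?I i))" if "i < n" "j < n" "B $$ (i, j) \<noteq> 0" for i j
      using B[OF that] that by (intro edge) (simp add: G_def \<P>)
  qed (use T\<I> W survives directed product[OF carrier(2,1) BA] product[OF carrier AB] \<open>1 \<le> c\<close> in auto)
  then obtain \<tau> where \<tau>: "bij_betw \<tau> {..<n} {..<n}"
    and close: "\<And>i. i < n \<Longrightarrow> interval_le (?I i) (ishift c (?J (\<tau> i))) \<and> interval_le (?J (\<tau> i)) (ishift c (?I i))"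
    by blast
  define \<kappa> where "\<kappa> = inv_into {..<n} \<tau>"
  have \<kappa>: "bij_betw \<kappa> {..<n} {..<n}" unfolding \<kappa>_def using \<tau> by (rule bij_betw_inv_into)
  have \<kappa>_lt: "\<kappa> j < n" and \<tau>\<kappa>: "\<tau> (\<kappa> j) = j" if "j < n" for j
    using bij_betw_apply[OF \<kappa>, of j] bij_betw_inv_into_right[OF \<tau>, of j] that by (simp_all add: \<kappa>_def)
  have "\<exists>l\<le>floor_odd c. (U_vertex (\<kappa> j), V_vertex j) \<in> G ^^ l"
    "\<exists>l\<le>floor_odd c. (V_vertex j, U_vertex (\<kappa> j)) \<in> G ^^ l" if "j < n" for j
    using close[OF \<kappa>_lt[OF that]] W(1)[OF \<kappa>_lt[OF that]] W(2)[OF that] unfolding \<tau>\<kappa>[OF that]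
    by (simp_all add: walk image_iff)
  then have "\<exists>\<kappa>. bij_betw \<kappa> {..<n} {..<n} \<and>
      (\<forall>j<n. fst (ci_weakening n (floor_odd c) \<P>) $$ (j, \<kappa> j) \<and> snd (ci_weakening n (floor_odd c) \<P>) $$ (\<kappa> j, j))"
    using \<kappa> \<kappa>_lt unfolding G_def by (intro exI[of _ \<kappa>]) (simp add: ci_weakening_def)
  then show "\<exists>(A :: 'k mat) B. ci_solution n (ci_weakening n (floor_odd c) \<P>) A B \<and> ci_simple n A"
    using ci_simple_solution_iff[of n "fst (ci_weakening n (floor_odd c) \<P>)"
        "snd (ci_weakening n (floor_odd c) \<P>)", where 'k = 'k] by simp
qed

section \<open>The equivalence\<close>

lemma ci_property_iff_matching_property:
  fixes c :: real
  assumes "CARD('d::finite) \<ge> 2" and "pfd_universe TYPE('k::field) TYPE('v::ab_group_add)" and "1 \<le> c"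
  shows "ci_property TYPE('k) (floor_odd c) \<longleftrightarrow> matching_property TYPE('k) TYPE('v) TYPE('d) c"
proof
  assume ci: "ci_property TYPE('k) (floor_odd c)"
  show "matching_property TYPE('k) TYPE('v) TYPE('d) c"
    unfolding matching_property_def
  proof (intro allI impI)
    fix \<I> :: "(real^'d) set set" and \<epsilon> and M N :: "('k, 'v, 'd) pmod" and \<B> \<C>
    assume "benign TYPE('k) \<I>" "0 \<le> \<epsilon>" "pmodule M" "pmodule N" "interleaved \<epsilon> M N"
      and barcodes: "is_barcode M \<B>" "is_barcode N \<C>" and "finite \<B>" "finite \<C>"
      and "\<forall>Q \<in> \<B> \<union> \<C>. \<exists>I\<in>\<I>. piso Q (interval_pmod I :: ('k, 'k, 'd) pmod)"
    then obtain I where "\<forall>Q\<in>\<B> \<union> \<C>. I Q \<in> \<I> \<and> piso Q (interval_pmod (I Q) :: ('k, 'k, 'd) pmod)"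
      using bchoice[of "\<B> \<union> \<C>" "\<lambda>Q I. I \<in> \<I> \<and> piso Q (interval_pmod I :: ('k, 'k, 'd) pmod)"] by blast
    moreover have "is_direct_sum M \<B>" "is_direct_sum N \<C>"
      using barcodes by (simp_all add: is_barcode_def)
    ultimately show "\<exists>\<B>' \<C>' \<sigma>. is_matching (c * \<epsilon>) \<B> \<C> \<B>' \<C>' \<sigma>"
      using ci_property_imp_matching[OF ci floor_odd_le[OF assms(3)] \<open>benign TYPE('k) \<I>\<close> \<open>0 \<le> \<epsilon>\<close>
          \<open>pmodule M\<close> _ \<open>finite \<B>\<close> \<open>pmodule N\<close> _ \<open>finite \<C>\<close> _ \<open>interleaved \<epsilon> M N\<close>] by blast
  qed
qed (rule matching_property_imp_ci_property[OF assms])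

theorem theorem6p18:
  fixes c :: real
  assumes "CARD('d::finite) \<ge> 2"
    and "pfd_universe TYPE('k::field) TYPE('v::ab_group_add)"
    and "c \<ge> 1"
  shows
    "(\<forall>n \<P>. ci_problem n \<P> \<longrightarrow>
        (\<exists>(A :: 'k mat) B. ci_solution n \<P> A B) \<longrightarrow>
        (\<exists>(A :: 'k mat) B. ci_solution n (ci_weakening n (floor_odd c) \<P>) A B \<and> ci_simple n A))
     \<longleftrightarrow>
     (\<forall>(\<I> :: (real^'d) set set) (\<epsilon> :: real)
        (M :: ('k, 'v, 'd) pmod) (N :: ('k, 'v, 'd) pmod) \<B> \<C>.
        benign TYPE('k) \<I> \<longrightarrow> \<epsilon> \<ge> 0 \<longrightarrow>
        pmodule M \<longrightarrow> pfd M \<longrightarrow> pmodule N \<longrightarrow> pfd N \<longrightarrow>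
        interleaved \<epsilon> M N \<longrightarrow>
        is_barcode M \<B> \<longrightarrow> is_barcode N \<C> \<longrightarrow>
        finite \<B> \<longrightarrow> finite \<C> \<longrightarrow>
        (\<forall>Q \<in> \<B> \<union> \<C>. \<exists>I\<in>\<I>. piso Q (interval_pmod I :: ('k, 'k, 'd) pmod)) \<longrightarrow>
        (\<exists>\<B>' \<C>' \<sigma>. is_matching (c * \<epsilon>) \<B> \<C> \<B>' \<C>' \<sigma>))"
  using ci_property_iff_matching_property[OF assms] unfolding ci_property_def matching_property_def .

end
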